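(* Let $\Omega\subset\mathbb{R}^d$, let $L^1_+(\Omega)=\{V\in L^1(\Omega): V\ge 0\}$, let $F:L^1_+(\Omega)\to\mathbb{R}$ be a functional which is lower semicontinuous with respect to the $\gamma$-convergence, and let $\mathcal{V}\subset L^1_+(\Omega)$ be a nonempty set which is compact for the weak topology of $L^1(\Omega)$. Then the problem $$\min\{F(V)\ :\ V\in\mathcal{V}\}$$ admits a solution.
   Context: Capacity: for $E\subset\mathbb{R}^d$, $\mathrm{cap}(E)=\inf\{\int_{\mathbb{R}^d}|\nabla u|^2dx+\int_{\mathbb{R}^d}u^2dx : u\in H^1(\mathbb{R}^d),\ u\ge1\text{ in a neighborhood of }E\}$; "quasi-everywhere" (q.e.) means up to a set of zero capacity. Every $u\in H^1(\mathbb{R}^d)$ is identified with its quasi-continuous representative. $H^1_0(\Omega)=\{u\in H^1(\mathbb{R}^d): u=0\text{ q.e. on }\mathbb{R}^d\setminus\Omega\}$. Here $\Omega$ is Lebesgue measurable. A capacitary measure is a positive Borel measure $\mu$ on $\mathbb{R}^d$ (values in $[0,+\infty]$, not necessarily finite or Radon) with $\mu(E)=0$ whenever $\mathrm{cap}(E)=0$. $\mathcal{M}^+_{\mathrm{cap}}(\Omega)$ is the set of capacitary measures $\mu$ such that $\mu(E)=+\infty$ whenever $\mathrm{cap}(E\setminus\Omega)>0$. For a measurable $V:\Omega\to[0,+\infty]$, $V\,dx$ denotes the element of $\mathcal{M}^+_{\mathrm{cap}}(\Omega)$ given by $E\mapsto\int_{E\cap\Omega}V\,dx+I_\Omega(E)$,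 where $I_\Omega(E)=0$ if $\mathrm{cap}(E\setminus\Omega)=0$ and $I_\Omega(E)=+\infty$ otherwise; thus for $u\in H^1(\mathbb{R}^d)$ the integral of $u^2$ against $V\,dx$ is $\int_\Omega Vu^2dx$ if $u\in H^1_0(\Omega)$ and $+\infty$ otherwise. $\gamma$-convergence: for $\mu\in\mathcal{M}^+_{\mathrm{cap}}(\Omega)$ and $u\in L^2(\Omega)$ set $Q_\mu(u)=\int_{\mathbb{R}^d}|\nabla u|^2dx+\int_{\mathbb{R}^d}u^2d\mu$ if (the extension by zero of) $u$ lies in $H^1(\mathbb{R}^d)$ and $\int u^2d\mu<\infty$, and $Q_\mu(u)=+\infty$ otherwise. A sequence $\mu_n\in\mathcal{M}^+_{\mathrm{cap}}(\Omega)$ $\gamma$-converges to $\mu\in\mathcal{M}^+_{\mathrm{cap}}(\Omega)$ if (i) $Q_\mu(u)\le\liminf_n Q_{\mu_n}(u_n)$ whenever $u_n\to u$ in $L^2(\Omega)$, and (ii) for every $u\in L^2(\Omega)$ there is $u_n\to u$ in $L^2(\Omega)$ with $Q_\mu(u)=\lim_n Q_{\mu_n}(u_n)$. $F$ is lower semicontinuous with respect to the $\gamma$-convergence if $F(V)\le\liminf_n F(V_n)$ whenever $V_n,V\in L^1_+(\Omega)$ and $V_n\,dx$ $\gamma$-converges to $V\,dx$. *)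

theory Defs
  imports "HOL-Analysis.Analysis"
begin

primrec C_k :: "nat \<Rightarrow> ('a::euclidean_space \<Rightarrow> real) \<Rightarrow> bool" where
  "C_k 0 f \<longleftrightarrow> continuous_on UNIV f"
| "C_k (Suc k) f \<longleftrightarrow> (\<forall>x. f differentiable (at x)) \<and>
     (\<forall>b\<in>Basis. C_k k (\<lambda>x. frechet_derivative f (at x) b))"

definition test_function :: "('a::euclidean_space \<Rightarrow> real) \<Rightarrow> bool" where
  "test_function \<phi> \<longleftrightarrow> (\<forall>k. C_k k \<phi>) \<and> compact (closure {x. \<phi> x \<noteq> 0})"

definition is_weak_gradient ::
    "('a::euclidean_space \<Rightarrow> real) \<Rightarrow> ('a \<Rightarrow> 'a) \<Rightarrow> bool" where
  "is_weak_gradient u g \<longleftrightarrow>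
     g \<in> borel_measurable lebesgue \<and> integrable lebesgue (\<lambda>x. (norm (g x))\<^sup>2) \<and>
     (\<forall>\<phi>. test_function \<phi> \<longrightarrow> (\<forall>b\<in>Basis.
        (\<integral>x. u x * frechet_derivative \<phi> (at x) b \<partial>lebesgue)
          = - (\<integral>x. (g x \<bullet> b) * \<phi> x \<partial>lebesgue)))"

text \<open>Elements of Lebesgue and Sobolev spaces are represented by functions; equality of two
  elements is equality almost everywhere.\<close>

definition L2 :: "'a::euclidean_space set \<Rightarrow> ('a \<Rightarrow> real) set" where
  "L2 \<Omega> = {u. u \<in> borel_measurable (lebesgue_on \<Omega>) \<and>
              integrable (lebesgue_on \<Omega>) (\<lambda>x. (u x)\<^sup>2)}"

definition H1 :: "('a::euclidean_space \<Rightarrow> real) set" where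
  "H1 = {u \<in> L2 UNIV. \<exists>g. is_weak_gradient u g}"

definition weak_gradient :: "('a::euclidean_space \<Rightarrow> real) \<Rightarrow> 'a \<Rightarrow> 'a" where
  "weak_gradient u = (SOME g. is_weak_gradient u g)"

definition dirichlet :: "('a::euclidean_space \<Rightarrow> real) \<Rightarrow> ennreal" where
  "dirichlet u = (\<integral>\<^sup>+x. ennreal ((norm (weak_gradient u x))\<^sup>2) \<partial>lebesgue)"

definition cap :: "'a::euclidean_space set \<Rightarrow> ennreal" where
  "cap E = Inf {dirichlet u + (\<integral>\<^sup>+x. ennreal ((u x)\<^sup>2) \<partial>lebesgue) | u.
     u \<in> H1 \<and> (\<exists>U. open U \<and> E \<subseteq> U \<and> (AE x in lebesgue. x \<in> U \<longrightarrow> 1 \<le> u x))}"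

definition quasi_continuous :: "('a::euclidean_space \<Rightarrow> real) \<Rightarrow> bool" where
  "quasi_continuous u \<longleftrightarrow>
     (\<forall>\<epsilon>>0. \<exists>A. open A \<and> cap A < \<epsilon> \<and> continuous_on (- A) u)"

text \<open>The quasi-continuous representative is unique up to a set of zero capacity. It is taken
  Borel measurable, by a modification on a set of zero capacity, so that it can be integrated
  against Borel measures; such measures below do not charge sets of zero capacity.\<close>

definition qc_rep :: "('a::euclidean_space \<Rightarrow> real) \<Rightarrow> 'a \<Rightarrow> real" where
  "qc_rep u = (SOME v. quasi_continuous v \<and> v \<in> borel_measurable borel \<and>
                       (AE x in lebesgue. v x = u x))"

definition capacitary_measure :: "'a::euclidean_space measure \<Rightarrow> bool" where
  "capacitary_measure \<mu> \<longleftrightarrow> sets \<mu> = sets borel \<and>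
     (\<forall>E\<in>sets borel. cap E = 0 \<longrightarrow> emeasure \<mu> E = 0)"

definition M_cap :: "'a::euclidean_space set \<Rightarrow> 'a measure set" where
  "M_cap \<Omega> = {\<mu>. capacitary_measure \<mu> \<and>
     (\<forall>E\<in>sets borel. cap (E - \<Omega>) > 0 \<longrightarrow> emeasure \<mu> E = \<infinity>)}"

text \<open>The measure \<open>V dx\<close>. For measurable \<open>\<Omega>\<close> and \<open>V\<close> the set function below is countably additive (capacity is
  countably subadditive), so \<^const>\<open>measure_of\<close> does not fall back to the zero measure.\<close>

definition potential_measure ::
    "'a::euclidean_space set \<Rightarrow> ('a \<Rightarrow> ennreal) \<Rightarrow> 'a measure" where
  "potential_measure \<Omega> V = measure_of UNIV (sets borel)
     (\<lambda>E. (\<integral>\<^sup>+x\<in>E \<inter> \<Omega>. V x \<partial>lebesgue) + (if cap (E - \<Omega>) = 0 then 0 else \<infinity>))"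

definition zero_ext :: "'a set \<Rightarrow> ('a \<Rightarrow> real) \<Rightarrow> 'a \<Rightarrow> real" where
  "zero_ext \<Omega> u = (\<lambda>x. if x \<in> \<Omega> then u x else 0)"

definition Q :: "'a::euclidean_space set \<Rightarrow> 'a measure \<Rightarrow> ('a \<Rightarrow> real) \<Rightarrow> ennreal" where
  "Q \<Omega> \<mu> u =
     (let w = zero_ext \<Omega> u; I = (\<integral>\<^sup>+x. ennreal ((qc_rep w x)\<^sup>2) \<partial>\<mu>)
      in if w \<in> H1 \<and> I < \<infinity> then dirichlet w + I else \<infinity>)"

definition L2_converges ::
    "'a::euclidean_space set \<Rightarrow> (nat \<Rightarrow> 'a \<Rightarrow> real) \<Rightarrow> ('a \<Rightarrow> real) \<Rightarrow> bool" where
  "L2_converges \<Omega> us u \<longleftrightarrow> (\<forall>n. us n \<in> L2 \<Omega>) \<and> u \<in> L2 \<Omega> \<and>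
     (\<lambda>n. \<integral>x. (us n x - u x)\<^sup>2 \<partial>lebesgue_on \<Omega>) \<longlonglongrightarrow> 0"

definition gamma_converges ::
    "'a::euclidean_space set \<Rightarrow> (nat \<Rightarrow> 'a measure) \<Rightarrow> 'a measure \<Rightarrow> bool" where
  "gamma_converges \<Omega> \<mu>s \<mu> \<longleftrightarrow>
     (\<forall>n. \<mu>s n \<in> M_cap \<Omega>) \<and> \<mu> \<in> M_cap \<Omega> \<and>
     (\<forall>us u. L2_converges \<Omega> us u \<longrightarrow> Q \<Omega> \<mu> u \<le> liminf (\<lambda>n. Q \<Omega> (\<mu>s n) (us n))) \<and>
     (\<forall>u\<in>L2 \<Omega>. \<exists>us. L2_converges \<Omega> us u \<and> (\<lambda>n. Q \<Omega> (\<mu>s n) (us n)) \<longlonglongrightarrow> Q \<Omega> \<mu> u)"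

definition L1 :: "'a::euclidean_space set \<Rightarrow> ('a \<Rightarrow> real) set" where
  "L1 \<Omega> = {V. integrable (lebesgue_on \<Omega>) V}"

definition L1_pos :: "'a::euclidean_space set \<Rightarrow> ('a \<Rightarrow> real) set" where
  "L1_pos \<Omega> = {V \<in> L1 \<Omega>. AE x in lebesgue_on \<Omega>. 0 \<le> V x}"

definition L1_dual :: "'a::euclidean_space set \<Rightarrow> (('a \<Rightarrow> real) \<Rightarrow> real) set" where
  "L1_dual \<Omega> = {l.
     (\<forall>f\<in>L1 \<Omega>. \<forall>g\<in>L1 \<Omega>. l (\<lambda>x. f x + g x) = l f + l g) \<and>
     (\<forall>c. \<forall>f\<in>L1 \<Omega>. l (\<lambda>x. c * f x) = c * l f) \<and>
     (\<exists>C. \<forall>f\<in>L1 \<Omega>. \<bar>l f\<bar> \<le> C * (\<integral>x. \<bar>f x\<bar> \<partial>lebesgue_on \<Omega>))}"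

text \<open>The topology lives on representatives: it is the pullback of the weak topology on classes,
  so a set of representatives is compact iff the corresponding set of classes is.\<close>

definition weak_L1 :: "'a::euclidean_space set \<Rightarrow> ('a \<Rightarrow> real) topology" where
  "weak_L1 \<Omega> = topology_generated_by
     {{f \<in> L1 \<Omega>. l f \<in> U} | l U. l \<in> L1_dual \<Omega> \<and> open U}"

text \<open>A functional on \<open>L\<^sup>1\<close>-classes, seen on representatives.\<close>

definition ae_invariant ::
    "'a::euclidean_space set \<Rightarrow> (('a \<Rightarrow> real) \<Rightarrow> real) \<Rightarrow> bool" where
  "ae_invariant \<Omega> F \<longleftrightarrow> (\<forall>V\<in>L1_pos \<Omega>. \<forall>W\<in>L1_pos \<Omega>.
     (AE x in lebesgue_on \<Omega>. V x = W x) \<longrightarrow> F V = F W)"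

definition gamma_lsc ::
    "'a::euclidean_space set \<Rightarrow> (('a \<Rightarrow> real) \<Rightarrow> real) \<Rightarrow> bool" where
  "gamma_lsc \<Omega> F \<longleftrightarrow> (\<forall>Vs V.
     (\<forall>n. Vs n \<in> L1_pos \<Omega>) \<and> V \<in> L1_pos \<Omega> \<and>
     gamma_converges \<Omega> (\<lambda>n. potential_measure \<Omega> (\<lambda>x. ennreal (Vs n x)))
                       (potential_measure \<Omega> (\<lambda>x. ennreal (V x)))
     \<longrightarrow> ereal (F V) \<le> liminf (\<lambda>n. ereal (F (Vs n))))"

end

theory Submission
  imports Defs
begin

text \<open>The proof is the direct method. From a minimising sequence in the weakly compact set of potentials
one extracts a subsequence \<open>V\<^sub>n\<close> with a limit \<open>V\<close> in the set, and lower semicontinuity of the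
functional finishes the argument once \<open>V\<^sub>n dx\<close> is known to \<open>\<gamma>\<close>-converge to \<open>V dx\<close>
(\<open>converges_on_sets_imp_gamma_converges\<close>).

Extraction. Because potentials are nonnegative, uniform integrability comes cheaply
(\<open>weakly_compact_uniformly_small\<close>): if sets \<open>T\<^sub>m\<close> decrease to a null set and \<open>V\<^sub>m\<close> has mass at least
\<open>e\<close> on \<open>T\<^sub>m\<close>, then all later \<open>V\<^sub>n\<close> have mass at least \<open>e\<close> on \<open>T\<^sub>m\<close>, hence so has a weak cluster point,
for every \<open>m\<close>, which is absurd. Uniform integrability turns the family of sets on which the masses
of a sequence converge into a Dynkin system, so convergence on a countable generating
\<open>\<pi>\<close>-system suffices, and a cluster point provides a subsequence with that property
(\<open>converging_subsequence_on_sets\<close>). Setwise convergence in turn gives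
\<open>\<integral> \<phi>\<^sub>n V\<^sub>n \<rightarrow> \<integral> \<phi> V\<close> whenever the \<open>\<phi>\<^sub>n\<close> are uniformly bounded and converge to \<open>\<phi>\<close> almost everywhere.

\<open>\<gamma>\<close>-convergence. For the lower bound let \<open>u\<^sub>n \<rightarrow> u\<close> in \<open>L\<^sup>2\<close> with bounded energies. The Dirichlet
integral is lower semicontinuous, and the potential terms are handled by applying the preceding
statement to \<open>min (u\<^sub>n\<^sup>2) M\<close> and letting \<open>M\<close> tend to infinity. The limit also has to vanish
quasi-everywhere outside \<open>\<Omega>\<close> (\<open>H10_weakly_closed\<close>). For the upper bound a bounded \<open>u\<close> is its own
recovery sequence, and a general \<open>u\<close> is approximated by truncations at a slowly growing height.

Sobolev functions. Everything about \<open>H\<^sup>1\<close> rests on the identity of the Dirichlet integral with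
\<open>energy u\<close>, the increasing limit over \<open>k\<close> of the sums over the coordinate directions \<open>b\<close> of
\<open>4\<^sup>k \<integral> (u (x + 2\<^sup>-\<^sup>k b) - u x)\<^sup>2 dx\<close> (\<open>H1_iff\<close>, \<open>dirichlet_eq_energy\<close>). With this description,
truncation, suprema, averages over balls and lower semicontinuity reduce to inequalities between
increments, and the parallelogram law survives the limit. Weak compactness in Hilbert space is
replaced by the remark that in a bounded sequence suitable iterated midpoints of the tails
converge strongly (\<open>forward_midpoints_Cauchy\<close>).

Capacity. Countable subadditivity comes from suprema of functions with values in \<open>[0, 1]\<close>. The
Chebyshev inequality \<open>cap {\<bar>v\<bar> > t} \<le> t\<^sup>-\<^sup>2 \<parallel>v\<parallel>\<^sup>2\<close> for quasi-continuous \<open>v\<close> yields existence and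
uniqueness of quasi-continuous representatives and the closedness of \<open>H\<^sup>1\<^sub>0\<close>; the representatives
are limits of continuous functions, which are dense because averages over small balls are
continuous and do not increase the energy.\<close>

section \<open>Square integrable functions\<close>


definition sq_norm :: "('a::euclidean_space \<Rightarrow> real) \<Rightarrow> ennreal" where
  "sq_norm u = (\<integral>\<^sup>+x. ennreal ((u x)\<^sup>2) \<partial>lebesgue)"

lemma lebesgue_measurable_shift [measurable]:
  "(\<lambda>x. x + h) \<in> lebesgue \<rightarrow>\<^sub>M (lebesgue :: 'a::euclidean_space measure)"
  using lebesgue_affine_measurable[of "\<lambda>_. 1" h] by (simp add: euclidean_representation add.commute)

lemma lebesgue_distr_shift:
  "distr lebesgue lebesgue (\<lambda>x. x + h) = (lebesgue :: 'a::euclidean_space measure)"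
  using lebesgue_affine_euclidean[of "\<lambda>_. 1" h]
  by (simp add: euclidean_representation density_1 add.commute)

lemma nn_integral_shift:
  fixes h :: "'a::euclidean_space"
  assumes "f \<in> borel_measurable lebesgue"
  shows "(\<integral>\<^sup>+x. f (x + h) \<partial>lebesgue) = (\<integral>\<^sup>+x. f x \<partial>lebesgue)"
  using nn_integral_distr[OF lebesgue_measurable_shift[of h], of f] assms
  by (simp add: lebesgue_distr_shift)

lemma integral_shift:
  fixes h :: "'a::euclidean_space" and f :: "'a \<Rightarrow> real"
  assumes "f \<in> borel_measurable lebesgue"
  shows "(\<integral>x. f (x + h) \<partial>lebesgue) = (\<integral>x. f x \<partial>lebesgue)"
  using integral_distr[OF lebesgue_measurable_shift[of h] assms]
  by (simp add: lebesgue_distr_shift)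

lemma AE_shift:
  fixes h :: "'a::euclidean_space"
  assumes "AE x in lebesgue. P x"
  shows "AE x in lebesgue. P (x + h)"
  by (rule AE_distrD[OF lebesgue_measurable_shift[of h], of P])
    (use assms in \<open>simp only: lebesgue_distr_shift\<close>)

lemma measurable_shift_comp:
  fixes h :: "'a::euclidean_space"
  assumes "f \<in> borel_measurable lebesgue"
  shows "(\<lambda>x. f (x + h)) \<in> borel_measurable lebesgue"
  using assms by measurable

lemma sq_norm_shift:
  "u \<in> borel_measurable lebesgue \<Longrightarrow> sq_norm (\<lambda>x. u (x + h)) = sq_norm u"
  unfolding sq_norm_def by (rule nn_integral_shift[of "\<lambda>x. ennreal ((u x)\<^sup>2)"]) measurable

lemma sq_norm_cong_AE:
  "AE x in lebesgue. u x = v x \<Longrightarrow> sq_norm u = sq_norm v"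
  unfolding sq_norm_def by (intro nn_integral_cong_AE) auto

lemma sq_norm_mono:
  "(\<And>x. \<bar>u x\<bar> \<le> \<bar>v x\<bar>) \<Longrightarrow> sq_norm u \<le> sq_norm v"
  unfolding sq_norm_def by (intro nn_integral_mono ennreal_leI) (simp add: abs_le_square_iff)

lemma sq_norm_zero [simp]: "sq_norm (\<lambda>x. 0) = 0"
  by (simp add: sq_norm_def)

lemma sq_norm_cmult:
  assumes [measurable]: "u \<in> borel_measurable lebesgue"
  shows "sq_norm (\<lambda>x. c * u x) = ennreal (c\<^sup>2) * sq_norm u"
  unfolding sq_norm_def
  by (simp add: power_mult_distrib ennreal_mult nn_integral_cmult)

lemma sq_norm_parallelogram:
  assumes [measurable]: "u \<in> borel_measurable lebesgue" "v \<in> borel_measurable lebesgue"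
  shows "sq_norm (\<lambda>x. u x + v x) + sq_norm (\<lambda>x. u x - v x) = 2 * sq_norm u + 2 * sq_norm v"
proof -
  have "sq_norm (\<lambda>x. u x + v x) + sq_norm (\<lambda>x. u x - v x)
     = (\<integral>\<^sup>+x. ennreal ((u x + v x)\<^sup>2) + ennreal ((u x - v x)\<^sup>2) \<partial>lebesgue)"
    unfolding sq_norm_def by (subst nn_integral_add) auto
  also have "\<dots> = (\<integral>\<^sup>+x. 2 * ennreal ((u x)\<^sup>2) + 2 * ennreal ((v x)\<^sup>2) \<partial>lebesgue)"
  proof (rule nn_integral_cong)
    fix x
    have "ennreal ((u x + v x)\<^sup>2) + ennreal ((u x - v x)\<^sup>2) = ennreal ((u x + v x)\<^sup>2 + (u x - v x)\<^sup>2)"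
      by (rule ennreal_plus[symmetric]) auto
    also have "\<dots> = ennreal (2 * (u x)\<^sup>2 + 2 * (v x)\<^sup>2)"
      by (simp add: power2_eq_square algebra_simps)
    also have "\<dots> = 2 * ennreal ((u x)\<^sup>2) + 2 * ennreal ((v x)\<^sup>2)"
      by (simp add: ennreal_mult)
    finally show "ennreal ((u x + v x)\<^sup>2) + ennreal ((u x - v x)\<^sup>2) = 2 * ennreal ((u x)\<^sup>2) + 2 * ennreal ((v x)\<^sup>2)" .
  qed
  also have "\<dots> = 2 * sq_norm u + 2 * sq_norm v"
    unfolding sq_norm_def by (subst nn_integral_add) (auto simp: nn_integral_cmult)
  finally show ?thesis .
qed

lemma sq_norm_add_le:
  assumes "u \<in> borel_measurable lebesgue" "v \<in> borel_measurable lebesgue"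
  shows "sq_norm (\<lambda>x. u x + v x) \<le> 2 * sq_norm u + 2 * sq_norm v"
  using sq_norm_parallelogram[OF assms] by (metis le_iff_add)

lemma sq_norm_Fatou:
  assumes [measurable]: "\<And>k. h k \<in> borel_measurable lebesgue"
    and "AE x in lebesgue. (\<lambda>k. h k x) \<longlonglongrightarrow> f x"
  shows "sq_norm f \<le> liminf (\<lambda>k. sq_norm (h k))"
proof -
  have "sq_norm f = (\<integral>\<^sup>+x. liminf (\<lambda>k. ennreal ((h k x)\<^sup>2)) \<partial>lebesgue)"
    unfolding sq_norm_def
  proof (rule nn_integral_cong_AE, use assms(2) in eventually_elim)
    fix x assume "(\<lambda>k. h k x) \<longlonglongrightarrow> f x"
    then have "(\<lambda>k. ennreal ((h k x)\<^sup>2)) \<longlonglongrightarrow> ennreal ((f x)\<^sup>2)"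
      by (intro tendsto_ennrealI tendsto_power)
    then show "ennreal ((f x)\<^sup>2) = liminf (\<lambda>k. ennreal ((h k x)\<^sup>2))"
      by (intro lim_imp_Liminf[symmetric]) auto
  qed
  also have "\<dots> \<le> liminf (\<lambda>k. sq_norm (h k))"
    unfolding sq_norm_def by (rule nn_integral_liminf) measurable
  finally show ?thesis .
qed

lemma L2_UNIV_iff:
  "u \<in> L2 UNIV \<longleftrightarrow> u \<in> borel_measurable lebesgue \<and> sq_norm u < \<infinity>"
  by (auto simp: L2_def lebesgue_on_UNIV_eq sq_norm_def integrable_iff_bounded)

lemma L2_measurable: "u \<in> L2 UNIV \<Longrightarrow> u \<in> borel_measurable lebesgue"
  by (simp add: L2_UNIV_iff)

lemma L2_integrable_square: "u \<in> L2 UNIV \<Longrightarrow> integrable lebesgue (\<lambda>x. (u x)\<^sup>2)"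
  by (simp add: L2_def lebesgue_on_UNIV_eq)

lemma sq_norm_eq_integral:
  "u \<in> L2 UNIV \<Longrightarrow> sq_norm u = ennreal (\<integral>x. (u x)\<^sup>2 \<partial>lebesgue)"
  unfolding sq_norm_def by (intro nn_integral_eq_integral L2_integrable_square) auto

lemma L2_add:
  assumes "u \<in> L2 UNIV" "v \<in> L2 UNIV"
  shows "(\<lambda>x. u x + v x) \<in> L2 UNIV"
proof -
  have "sq_norm (\<lambda>x. u x + v x) \<le> 2 * sq_norm u + 2 * sq_norm v"
    using assms by (intro sq_norm_add_le) (auto simp: L2_UNIV_iff)
  also have "\<dots> < \<infinity>"
    using assms by (auto simp: L2_UNIV_iff ennreal_mult_less_top)
  finally show ?thesis
    using assms by (auto simp: L2_UNIV_iff)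
qed

lemma L2_cmult: "u \<in> L2 UNIV \<Longrightarrow> (\<lambda>x. c * u x) \<in> L2 UNIV"
  by (auto simp: L2_UNIV_iff sq_norm_cmult ennreal_mult_less_top)

lemma L2_diff:
  assumes "u \<in> L2 UNIV" "v \<in> L2 UNIV"
  shows "(\<lambda>x. u x - v x) \<in> L2 UNIV"
  using L2_add[OF assms(1) L2_cmult[OF assms(2), of "-1"]] by simp

lemma L2_shift: "u \<in> L2 UNIV \<Longrightarrow> (\<lambda>x. u (x + h)) \<in> L2 UNIV"
  by (auto simp: L2_UNIV_iff sq_norm_shift)

lemma L2_midpoint:
  assumes "u \<in> L2 UNIV" "v \<in> L2 UNIV"
  shows "(\<lambda>x. (u x + v x) / 2) \<in> L2 UNIV"
  using L2_cmult[OF L2_add[OF assms], of "1/2"] by simp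

lemma L2_mult_integrable:
  assumes "u \<in> L2 UNIV" "v \<in> L2 UNIV"
  shows "integrable lebesgue (\<lambda>x. u x * v x)"
proof (rule Bochner_Integration.integrable_bound)
  show "integrable lebesgue (\<lambda>x. (u x)\<^sup>2 + (v x)\<^sup>2)"
    using assms by (intro Bochner_Integration.integrable_add L2_integrable_square)
  show "AE x in lebesgue. norm (u x * v x) \<le> norm ((u x)\<^sup>2 + (v x)\<^sup>2)"
  proof (rule AE_I2)
    fix x
    have "0 \<le> (\<bar>u x\<bar> - \<bar>v x\<bar>)\<^sup>2" by simp
    then have "2 * (\<bar>u x\<bar> * \<bar>v x\<bar>) \<le> (u x)\<^sup>2 + (v x)\<^sup>2"
      by (simp add: power2_diff)
    moreover have "0 \<le> \<bar>u x\<bar> * \<bar>v x\<bar>" by simp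
    ultimately have "\<bar>u x\<bar> * \<bar>v x\<bar> \<le> (u x)\<^sup>2 + (v x)\<^sup>2" by linarith
    then show "norm (u x * v x) \<le> norm ((u x)\<^sup>2 + (v x)\<^sup>2)"
      by (simp add: abs_mult)
  qed
qed (use assms in \<open>auto simp: L2_UNIV_iff\<close>)

lemma L2_Cauchy_Schwarz:
  assumes "u \<in> L2 UNIV" "v \<in> L2 UNIV"
  shows "(\<integral>x. u x * v x \<partial>lebesgue)\<^sup>2 \<le> (\<integral>x. (u x)\<^sup>2 \<partial>lebesgue) * (\<integral>x. (v x)\<^sup>2 \<partial>lebesgue)"
proof -
  let ?a = "\<integral>x. (u x)\<^sup>2 \<partial>lebesgue" and ?b = "\<integral>x. (v x)\<^sup>2 \<partial>lebesgue"
    and ?c = "\<integral>x. u x * v x \<partial>lebesgue"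
  note [measurable] = assms[THEN L2_measurable]
  have "ennreal \<bar>?c\<bar> \<le> (\<integral>\<^sup>+x. ennreal \<bar>u x\<bar> * ennreal \<bar>v x\<bar> \<partial>lebesgue)"
    using integral_norm_bound_ennreal[OF L2_mult_integrable[OF assms]]
    by (simp add: abs_mult ennreal_mult)
  then have "ennreal (?c\<^sup>2) \<le> (\<integral>\<^sup>+x. ennreal \<bar>u x\<bar> * ennreal \<bar>v x\<bar> \<partial>lebesgue)\<^sup>2"
    using power_mono[of "ennreal \<bar>?c\<bar>" _ 2] by (simp add: ennreal_power)
  also have "\<dots> \<le> (\<integral>\<^sup>+x. (ennreal \<bar>u x\<bar>)\<^sup>2 \<partial>lebesgue) * (\<integral>\<^sup>+x. (ennreal \<bar>v x\<bar>)\<^sup>2 \<partial>lebesgue)"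
    by (rule Cauchy_Schwarz_nn_integral) measurable
  also have "\<dots> = ennreal ?a * ennreal ?b"
    using sq_norm_eq_integral[OF assms(1)] sq_norm_eq_integral[OF assms(2)]
    by (simp add: ennreal_power sq_norm_def)
  finally show ?thesis
    by (simp add: ennreal_mult[symmetric] integral_nonneg_AE)
qed

lemma integral_square_parallelogram:
  assumes "u \<in> L2 UNIV" "v \<in> L2 UNIV"
  shows "(\<integral>x. (u x - v x)\<^sup>2 \<partial>lebesgue) = 2 * (\<integral>x. (u x)\<^sup>2 \<partial>lebesgue) + 2 * (\<integral>x. (v x)\<^sup>2 \<partial>lebesgue)
     - 4 * (\<integral>x. ((u x + v x) / 2)\<^sup>2 \<partial>lebesgue)"
proof -
  note L2_integrable_square[OF L2_midpoint[OF assms]] L2_integrable_square[OF L2_diff[OF assms]]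
    L2_integrable_square[OF assms(1)] L2_integrable_square[OF assms(2)]
  then have "(\<integral>x. (u x - v x)\<^sup>2 \<partial>lebesgue) + 4 * (\<integral>x. ((u x + v x) / 2)\<^sup>2 \<partial>lebesgue)
     = (\<integral>x. (u x - v x)\<^sup>2 + 4 * ((u x + v x) / 2)\<^sup>2 \<partial>lebesgue)"
    by simp
  also have "\<dots> = (\<integral>x. 2 * (u x)\<^sup>2 + 2 * (v x)\<^sup>2 \<partial>lebesgue)"
    by (intro Bochner_Integration.integral_cong refl) (simp add: power2_eq_square field_simps)
  also have "\<dots> = 2 * (\<integral>x. (u x)\<^sup>2 \<partial>lebesgue) + 2 * (\<integral>x. (v x)\<^sup>2 \<partial>lebesgue)"
    using L2_integrable_square[OF assms(1)] L2_integrable_square[OF assms(2)] by simp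
  finally show ?thesis by simp
qed

section \<open>Minimising sequences in midpoint-convex families\<close>

definition midpoint_closed :: "('a \<Rightarrow> real) set \<Rightarrow> bool" where
  "midpoint_closed K \<longleftrightarrow> (\<forall>f\<in>K. \<forall>g\<in>K. (\<lambda>x. (f x + g x) / 2) \<in> K)"

text \<open>The Hilbert space projection argument along a decreasing sequence of families: by the parallelogram
law two almost minimal elements are close, because their midpoint cannot be much smaller. The
infima over \<open>K n\<close> increase with \<open>n\<close> and are bounded, so they form a Cauchy sequence, which
controls elements of different families.\<close>

lemma minimising_sequence_Cauchy:
  fixes q :: "('a \<Rightarrow> real) \<Rightarrow> real" and K :: "nat \<Rightarrow> ('a \<Rightarrow> real) set"
  assumes nonneg: "\<And>f. 0 \<le> q f"
    and parallelogram: "\<And>f g. f \<in> K 0 \<Longrightarrow> g \<in> K 0 \<Longrightarrow>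
        q (\<lambda>x. f x - g x) = 2 * q f + 2 * q g - 4 * q (\<lambda>x. (f x + g x) / 2)"
    and dec: "\<And>n. K (Suc n) \<subseteq> K n"
    and mid: "\<And>n. midpoint_closed (K n)"
    and bound: "\<And>n. \<exists>f\<in>K n. q f \<le> C"
  obtains y where "\<And>n. y n \<in> K n" "\<And>n f. f \<in> K n \<Longrightarrow> q (y n) \<le> q f + 1 / Suc n"
    "\<And>\<epsilon>. 0 < \<epsilon> \<Longrightarrow> \<exists>N. \<forall>m\<ge>N. \<forall>n\<ge>N. q (\<lambda>x. y m x - y n x) < \<epsilon>"
proof -
  define i where "i n = Inf (q ` K n)" for n
  have bdd: "bdd_below (q ` K n)" for n
    using nonneg by (auto simp: bdd_below_def)
  have ne: "K n \<noteq> {}" for n using bound[of n] by auto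
  have i_le: "i n \<le> q f" if "f \<in> K n" for n f
    unfolding i_def using that bdd by (intro cInf_lower) auto
  define e where "e n = 1 / real (Suc n)" for n
  have "\<exists>f\<in>K n. q f < i n + e n" for n
    using cInf_lessD[of "q ` K n" "i n + e n"] ne[of n] by (auto simp: i_def e_def)
  then obtain y where y: "\<And>n. y n \<in> K n" "\<And>n. q (y n) < i n + e n"
    by metis
  have anti: "K n \<subseteq> K m" if "m \<le> n" for m n
    by (rule lift_Suc_antimono_le[of K, OF dec that])
  have i_mono: "i m \<le> i n" if "m \<le> n" for m n
    unfolding i_def using anti[OF that] ne[of n] bdd[of m] by (intro cInf_superset_mono) auto
  have "i n \<le> C" for n
    using bound[of n] i_le by force
  then have "Bseq i" using i_mono[of 0]
    by (intro BseqI'[of _ "max \<bar>C\<bar> \<bar>i 0\<bar>"]) (auto simp: abs_le_iff max_def; smt (verit))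
  moreover have "monoseq i" using i_mono by (simp add: monoseq_def)
  ultimately obtain L where "i \<longlonglongrightarrow> L"
    using Bseq_monoseq_convergent[of i] by (auto simp: convergent_def)
  then have i_conv: "Cauchy i" by (rule LIMSEQ_imp_Cauchy)
  have key: "q (\<lambda>x. y m x - y n x) \<le> 2 * \<bar>i m - i n\<bar> + 2 * e m + 2 * e n" if "m \<le> n" for m n
  proof -
    have "y n \<in> K m" "y n \<in> K 0" "y m \<in> K 0"
      using anti[OF that] anti[of 0] y(1) by auto
    then have "(\<lambda>x. (y m x + y n x) / 2) \<in> K m"
      using mid[of m] y(1)[of m] by (auto simp: midpoint_closed_def)
    then have "i m \<le> q (\<lambda>x. (y m x + y n x) / 2)"
      by (rule i_le)
    moreover have "d \<le> 2 * \<bar>a - b\<bar> + 2 * e + 2 * e'"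
      if "a \<le> c" "d = 2 * r + 2 * s - 4 * c" "r < a + e" "s < b + e'" for a b c d e e' r s :: real
      using that by (smt (verit))
    ultimately show ?thesis
      using parallelogram[OF \<open>y m \<in> K 0\<close> \<open>y n \<in> K 0\<close>] y(2)[of m] y(2)[of n]
      by blast
  qed
  show thesis
  proof
    show "y n \<in> K n" for n by (rule y)
    show "q (y n) \<le> q f + 1 / Suc n" if "f \<in> K n" for n f
      using y(2)[of n] i_le[OF that] unfolding e_def by linarith
    fix \<epsilon> :: real assume "0 < \<epsilon>"
    then obtain N1 where N1: "\<And>m n. m \<ge> N1 \<Longrightarrow> n \<ge> N1 \<Longrightarrow> \<bar>i m - i n\<bar> < \<epsilon> / 8"
      using i_conv by (force simp: Cauchy_def dist_real_def dest!: spec[of _ "\<epsilon> / 8"])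
    obtain N2 where N2: "e N2 < \<epsilon> / 8"
      using nat_approx_posE[of "\<epsilon> / 8"] \<open>0 < \<epsilon>\<close> by (auto simp: e_def)
    have small: "e n < \<epsilon> / 8" if "n \<ge> N2" for n
    proof -
      have "e n \<le> e N2" unfolding e_def using that by (intro frac_le) auto
      then show ?thesis using N2 by linarith
    qed
    have main: "q (\<lambda>x. y m x - y n x) < \<epsilon>" if "m \<ge> max N1 N2" "n \<ge> max N1 N2" "m \<le> n" for m n
    proof -
      have "\<bar>i m - i n\<bar> < \<epsilon> / 8" "e m < \<epsilon> / 8" "e n < \<epsilon> / 8"
        using N1[of m n] small[of m] small[of n] that unfolding max.bounded_iff by blast+
      moreover have "d < \<epsilon>" if "a < \<epsilon> / 8" "r < \<epsilon> / 8" "s < \<epsilon> / 8" "d \<le> 2 * a + 2 * r + 2 * s" for a r s d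
        using that \<open>0 < \<epsilon>\<close> by linarith
      ultimately show ?thesis using key[OF that(3)] by blast
    qed
    have sym: "q (\<lambda>x. y m x - y n x) = q (\<lambda>x. y n x - y m x)" for m n
    proof -
      have "y m \<in> K 0" "y n \<in> K 0" using anti[of 0] y(1) by blast+
      then show ?thesis
        using parallelogram[of "y m" "y n"] parallelogram[of "y n" "y m"] by (simp add: add.commute)
    qed
    show "\<exists>N. \<forall>m\<ge>N. \<forall>n\<ge>N. q (\<lambda>x. y m x - y n x) < \<epsilon>"
      using main sym by (metis nat_le_linear)
  qed
qed

text \<open>Riesz-Fischer: a subsequence whose successive distances are summable converges almost everywhere,
and Fatou's lemma identifies its limit as the \<open>L\<^sup>2\<close> limit of the whole sequence.\<close>

lemma L2_complete:
  fixes f :: "nat \<Rightarrow> 'a::euclidean_space \<Rightarrow> real"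
  assumes f: "\<And>n. f n \<in> L2 UNIV"
    and cauchy: "\<And>\<epsilon>. 0 < \<epsilon> \<Longrightarrow> \<exists>N. \<forall>m\<ge>N. \<forall>n\<ge>N. (\<integral>x. (f m x - f n x)\<^sup>2 \<partial>lebesgue) < \<epsilon>"
  obtains g where "g \<in> L2 UNIV" "(\<lambda>n. \<integral>x. (f n x - g x)\<^sup>2 \<partial>lebesgue) \<longlonglongrightarrow> 0"
proof -
  have meas [measurable]: "f n \<in> borel_measurable lebesgue" for n
    using f by (rule L2_measurable)
  have "\<exists>N. \<forall>m\<ge>N. \<forall>n\<ge>N. sq_norm (\<lambda>x. f m x - f n x) \<le> ennreal \<epsilon>" if "0 < \<epsilon>" for \<epsilon>
    using cauchy[OF that] sq_norm_eq_integral[OF L2_diff[OF f f]]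
    by (metis ennreal_leI less_imp_le)
  then have "\<exists>N. \<forall>m\<ge>N. \<forall>n\<ge>N. sq_norm (\<lambda>x. f m x - f n x) \<le> ennreal ((1/4)^k)" for k
    by simp
  then obtain N where N: "\<And>k m n. m \<ge> N k \<Longrightarrow> n \<ge> N k \<Longrightarrow> sq_norm (\<lambda>x. f m x - f n x) \<le> ennreal ((1/4)^k)"
    by metis
  define r where "r k = (\<Sum>j\<le>k. N j)" for k
  have r: "N k \<le> r k" "r k \<le> r (Suc k)" for k
    unfolding r_def by (auto simp: atMost_Suc intro: member_le_sum)
  have r_ge: "N k \<le> r j" if "k \<le> j" for k j
    using r lift_Suc_mono_le[of r k j] that by (meson order_trans)
  define d where "d k x = f (r (Suc k)) x - f (r k) x" for k x
  have [measurable]: "d k \<in> borel_measurable lebesgue" for k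
    unfolding d_def by measurable
  have d: "sq_norm (d k) \<le> ennreal ((1/4)^k)" for k
    unfolding d_def using r_ge by (intro N) auto
  have "(\<integral>\<^sup>+x. (\<Sum>k. ennreal (2^k * (d k x)\<^sup>2)) \<partial>lebesgue) = (\<Sum>k. ennreal (2^k) * sq_norm (d k))"
    unfolding sq_norm_def by (subst nn_integral_suminf) (auto simp: ennreal_mult nn_integral_cmult)
  also have "\<dots> \<le> (\<Sum>k. ennreal (2^k) * ennreal ((1/4)^k))"
    by (intro suminf_le mult_left_mono d) auto
  also have "\<dots> = (\<Sum>k. ennreal ((1/2)^k))"
    by (intro suminf_cong) (simp add: ennreal_mult[symmetric] power_mult_distrib[symmetric])
  also have "\<dots> < \<infinity>"
    using summable_geometric[of "1/2::real"] by (subst suminf_ennreal2) auto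
  finally have "AE x in lebesgue. (\<Sum>k. ennreal (2^k * (d k x)\<^sup>2)) \<noteq> \<infinity>"
    by (intro nn_integral_PInf_AE) auto
  then have conv: "AE x in lebesgue. convergent (\<lambda>k. f (r k) x)"
  proof eventually_elim
    fix x assume "(\<Sum>k. ennreal (2^k * (d k x)\<^sup>2)) \<noteq> \<infinity>"
    then have "summable (\<lambda>k. 2^k * (d k x)\<^sup>2)"
      by (intro summable_suminf_not_top) auto
    then have "summable (\<lambda>k. (1/2)^k + 2^k * (d k x)\<^sup>2)"
      by (intro summable_add summable_geometric) auto
    then have "summable (\<lambda>k. d k x)"
    \<comment> \<open>By the inequality between arithmetic and geometric mean, \<open>2 \<bar>d\<bar> \<le> 2\<^sup>-\<^sup>k + 2\<^sup>k d\<^sup>2\<close>.\<close>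
    proof (rule summable_comparison_test'[where N=0])
      fix k :: nat
      have "0 \<le> (1 - 2^k * \<bar>d k x\<bar>)\<^sup>2 / 2^k" by simp
      also have "\<dots> = (1/2)^k + 2^k * (d k x)\<^sup>2 - 2 * \<bar>d k x\<bar>"
        by (simp add: power2_eq_square field_simps power_one_over)
      finally have "2 * \<bar>d k x\<bar> \<le> (1/2)^k + 2^k * (d k x)\<^sup>2" by simp
      then show "norm (d k x) \<le> (1/2)^k + 2^k * (d k x)\<^sup>2"
        by simp
    qed
    then have "convergent (\<lambda>k. f (r 0) x + (\<Sum>j<k. d j x))"
      by (intro convergent_add convergent_const) (simp add: summable_iff_convergent)
    then show "convergent (\<lambda>k. f (r k) x)"
      using sum_lessThan_telescope[of "\<lambda>k. f (r k) x"] by (simp add: d_def)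
  qed
  define g where "g x = lim (\<lambda>k. f (r k) x)" for x
  have [measurable]: "g \<in> borel_measurable lebesgue"
    unfolding g_def by measurable
  have lim: "AE x in lebesgue. (\<lambda>k. f (r k) x) \<longlonglongrightarrow> g x"
    using conv by eventually_elim (simp add: g_def convergent_LIMSEQ_iff)
  have est: "sq_norm (\<lambda>x. f n x - g x) \<le> ennreal ((1/4)^k)" if "n \<ge> N k" for n k
  proof -
    have "sq_norm (\<lambda>x. f n x - g x) \<le> liminf (\<lambda>j. sq_norm (\<lambda>x. f n x - f (r j) x))"
      using lim by (intro sq_norm_Fatou) (auto elim!: eventually_mono intro: tendsto_intros)
    also have "\<dots> \<le> ennreal ((1/4)^k)"
    proof (rule order_trans[OF Liminf_le_Limsup Limsup_bounded])
      show "\<forall>\<^sub>F j in sequentially. sq_norm (\<lambda>x. f n x - f (r j) x) \<le> ennreal ((1/4)^k)"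
        using that r_ge by (intro eventually_sequentiallyI[of k] N) auto
    qed simp
    finally show ?thesis .
  qed
  have diff: "(\<lambda>x. f n x - g x) \<in> L2 UNIV" if "n \<ge> N 0" for n
    using est[OF that] by (auto simp: L2_UNIV_iff intro: le_less_trans)
  have gL2: "g \<in> L2 UNIV"
    using L2_diff[OF f[of "N 0"] diff[of "N 0"]] by simp
  show thesis
  proof (rule that[OF gL2], rule LIMSEQ_I)
    fix \<epsilon> :: real assume "0 < \<epsilon>"
    then obtain k where k: "(1/4)^k < \<epsilon>"
      using real_arch_pow_inv[of \<epsilon> "1/4"] by auto
    have "norm ((\<integral>x. (f n x - g x)\<^sup>2 \<partial>lebesgue) - 0) < \<epsilon>" if "n \<ge> N k" for n
      using est[OF that] sq_norm_eq_integral[OF L2_diff[OF f gL2], of n] k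
      by (simp add: ennreal_le_iff)
    then show "\<exists>no. \<forall>n\<ge>no. norm ((\<integral>x. (f n x - g x)\<^sup>2 \<partial>lebesgue) - 0) < \<epsilon>" by blast
  qed
qed

lemma L2_integral_mult_tendsto:
  assumes f: "\<And>n. f n \<in> L2 UNIV" and g: "g \<in> L2 UNIV" and h: "h \<in> L2 UNIV"
    and lim: "(\<lambda>n. \<integral>x. (f n x - g x)\<^sup>2 \<partial>lebesgue) \<longlonglongrightarrow> 0"
  shows "(\<lambda>n. \<integral>x. f n x * h x \<partial>lebesgue) \<longlonglongrightarrow> (\<integral>x. g x * h x \<partial>lebesgue)"
proof -
  have diff: "(\<integral>x. (f n x - g x) * h x \<partial>lebesgue) = (\<integral>x. f n x * h x \<partial>lebesgue) - (\<integral>x. g x * h x \<partial>lebesgue)" for n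
    using L2_mult_integrable[OF f h, of n] L2_mult_integrable[OF g h] by (simp add: left_diff_distrib)
  have "(\<lambda>n. (\<integral>x. (f n x - g x)\<^sup>2 \<partial>lebesgue) * (\<integral>x. (h x)\<^sup>2 \<partial>lebesgue)) \<longlonglongrightarrow> 0"
    using tendsto_mult[OF lim tendsto_const] by simp
  then have "(\<lambda>n. (\<integral>x. (f n x - g x) * h x \<partial>lebesgue)\<^sup>2) \<longlonglongrightarrow> 0"
    by (rule tendsto_sandwich[OF _ _ tendsto_const, rotated 2])
      (auto intro!: always_eventually L2_Cauchy_Schwarz L2_diff f g h)
  then have "(\<lambda>n. \<integral>x. (f n x - g x) * h x \<partial>lebesgue) \<longlonglongrightarrow> 0"
    by (simp add: tendsto_null_power)
  then show ?thesis
    unfolding diff by (rule LIM_zero_cancel)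
qed

lemma L2_integral_square_tendsto:
  assumes f: "\<And>n. f n \<in> L2 UNIV" and g: "g \<in> L2 UNIV"
    and lim: "(\<lambda>n. \<integral>x. (f n x - g x)\<^sup>2 \<partial>lebesgue) \<longlonglongrightarrow> 0"
  shows "(\<lambda>n. \<integral>x. (f n x)\<^sup>2 \<partial>lebesgue) \<longlonglongrightarrow> (\<integral>x. (g x)\<^sup>2 \<partial>lebesgue)"
proof -
  have "(\<integral>x. (f n x - g x)\<^sup>2 \<partial>lebesgue) + 2 * (\<integral>x. f n x * g x \<partial>lebesgue) - (\<integral>x. g x * g x \<partial>lebesgue)
      = (\<integral>x. (f n x - g x)\<^sup>2 + 2 * (f n x * g x) - g x * g x \<partial>lebesgue)" for n
    using L2_integrable_square[OF L2_diff[OF f g], of n] L2_mult_integrable[OF f g, of n] L2_mult_integrable[OF g g]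
    by simp
  also have "(\<integral>x. (f n x - g x)\<^sup>2 + 2 * (f n x * g x) - g x * g x \<partial>lebesgue) = (\<integral>x. (f n x)\<^sup>2 \<partial>lebesgue)" for n
    by (intro Bochner_Integration.integral_cong refl) (simp add: power2_eq_square algebra_simps)
  finally have "(\<integral>x. (f n x)\<^sup>2 \<partial>lebesgue) = (\<integral>x. (f n x - g x)\<^sup>2 \<partial>lebesgue) + 2 * (\<integral>x. f n x * g x \<partial>lebesgue)
      - (\<integral>x. g x * g x \<partial>lebesgue)" for n by simp
  moreover have "(\<lambda>n. (\<integral>x. (f n x - g x)\<^sup>2 \<partial>lebesgue) + 2 * (\<integral>x. f n x * g x \<partial>lebesgue)
      - (\<integral>x. g x * g x \<partial>lebesgue)) \<longlonglongrightarrow> 0 + 2 * (\<integral>x. g x * g x \<partial>lebesgue) - (\<integral>x. g x * g x \<partial>lebesgue)"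
    by (intro tendsto_intros lim L2_integral_mult_tendsto f g)
  ultimately show ?thesis by (simp add: power2_eq_square)
qed


section \<open>Test functions\<close>

lemma C_k_continuous:
  assumes "C_k k f"
  shows "continuous_on UNIV f"
proof (cases k)
  case (Suc j)
  then have "isCont f x" for x
    using assms differentiable_imp_continuous_within[of f x UNIV] by simp
  then show ?thesis by (simp add: continuous_at_imp_continuous_on)
qed (use assms in simp)

lemma C_k_SucD: "C_k (Suc k) f \<Longrightarrow> C_k k f"
proof (induction k arbitrary: f)
  case 0
  then show ?case using C_k_continuous[OF 0] by simp
next
  case (Suc k)
  then show ?case by (metis C_k.simps(2))
qed

lemma C_k_const: "C_k k (\<lambda>x. c)"
  by (induction k arbitrary: c) auto

lemma C_k_add: "C_k k f \<Longrightarrow> C_k k g \<Longrightarrow> C_k k (\<lambda>x. f x + g x)"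
proof (induction k arbitrary: f g)
  case 0
  then show ?case by (auto intro: continuous_intros)
next
  case (Suc k)
  have eq: "frechet_derivative (\<lambda>x. f x + g x) (at x)
      = (\<lambda>b. frechet_derivative f (at x) b + frechet_derivative g (at x) b)" for x
    using Suc.prems by (intro frechet_derivative_at[symmetric] has_derivative_add)
      (auto simp: frechet_derivative_works[symmetric])
  show ?case
    using Suc by (auto simp: eq)
qed

lemma C_k_mult: "C_k k f \<Longrightarrow> C_k k g \<Longrightarrow> C_k k (\<lambda>x. f x * g x)"
proof (induction k arbitrary: f g)
  case 0
  then show ?case by (auto intro: continuous_intros)
next
  case (Suc k)
  have eq: "frechet_derivative (\<lambda>x. f x * g x) (at x)
      = (\<lambda>b. f x * frechet_derivative g (at x) b + frechet_derivative f (at x) b * g x)" for x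
    using Suc.prems by (intro frechet_derivative_at[symmetric] has_derivative_mult)
      (auto simp: frechet_derivative_works[symmetric])
  show ?case
    using Suc Suc.prems[THEN C_k_SucD] by (auto simp: eq intro!: C_k_add)
qed

lemma C_k_prod:
  "finite A \<Longrightarrow> (\<And>i. i \<in> A \<Longrightarrow> C_k k (f i)) \<Longrightarrow> C_k k (\<lambda>x. \<Prod>i\<in>A. f i x)"
  by (induction A rule: finite_induct) (auto intro: C_k_const C_k_mult)

lemma frechet_derivative_shift:
  fixes f :: "'a::euclidean_space \<Rightarrow> real"
  assumes "f differentiable (at (x + h))"
  shows "((\<lambda>x. f (x + h)) has_derivative frechet_derivative f (at (x + h))) (at x)"
proof -
  have "((\<lambda>x. x + h) has_derivative (\<lambda>x. x)) (at x)"
    by (auto intro!: derivative_eq_intros)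
  moreover have "(f has_derivative frechet_derivative f (at (x + h))) (at (x + h))"
    using assms by (simp add: frechet_derivative_works[symmetric])
  ultimately show ?thesis
    using has_derivative_compose[of "\<lambda>x. x + h" "\<lambda>x. x" x UNIV f] by simp
qed

lemma C_k_shift: "C_k k f \<Longrightarrow> C_k k (\<lambda>x. f (x + h))"
proof (induction k arbitrary: f)
  case 0
  then show ?case by (auto intro!: continuous_on_compose2[of UNIV f] continuous_intros)
next
  case (Suc k)
  have "((\<lambda>x. f (x + h)) has_derivative frechet_derivative f (at (x + h))) (at x)" for x
    using Suc.prems by (intro frechet_derivative_shift) auto
  then have "(\<lambda>x. f (x + h)) differentiable at x"
    "frechet_derivative (\<lambda>x. f (x + h)) (at x) = frechet_derivative f (at (x + h))" for x
    by (auto simp: differentiable_def frechet_derivative_at[symmetric])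
  moreover have "C_k k (\<lambda>x. frechet_derivative f (at (x + h)) b)" if "b \<in> Basis" for b
    using Suc.prems that by (intro Suc.IH[of "\<lambda>x. frechet_derivative f (at x) b"]) auto
  ultimately show ?case by auto
qed

text \<open>A smooth function of one variable is given here by the sequence \<open>H\<close> of all its derivatives; the
derivatives of its composition with an affine function are again of this form.\<close>

lemma C_k_compose_inner:
  fixes H :: "nat \<Rightarrow> real \<Rightarrow> real" and e :: "'a::euclidean_space"
  assumes H: "\<And>i t. (H i has_real_derivative H (Suc i) t) (at t)"
  shows "C_k k (\<lambda>x. H i (c * (x \<bullet> e) + d))"
proof (induction k arbitrary: i)
  case 0
  have "continuous_on UNIV (H i)"
    using H by (auto intro!: DERIV_continuous_on[of _ _ "H (Suc i)"] intro: DERIV_subset)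
  then show ?case
    by (auto intro!: continuous_on_compose2[of UNIV "H i"] continuous_intros)
next
  case (Suc k)
  have deriv: "((\<lambda>x. H i (c * (x \<bullet> e) + d)) has_derivative
      (\<lambda>b. H (Suc i) (c * (x \<bullet> e) + d) * (c * (b \<bullet> e)))) (at x)" for x
  proof -
    have "((\<lambda>x. c * (x \<bullet> e) + d) has_derivative (\<lambda>b. c * (b \<bullet> e))) (at x)"
      by (auto intro!: derivative_eq_intros)
    from has_derivative_compose[OF this, of "H i" "\<lambda>t. H (Suc i) (c * (x \<bullet> e) + d) * t"] H
    show ?thesis by (simp add: has_field_derivative_def)
  qed
  then have "frechet_derivative (\<lambda>x. H i (c * (x \<bullet> e) + d)) (at x)
      = (\<lambda>b. H (Suc i) (c * (x \<bullet> e) + d) * (c * (b \<bullet> e)))" for x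
    by (intro frechet_derivative_at[symmetric])
  then show ?case
    using deriv Suc by (auto simp: differentiable_def intro!: C_k_mult C_k_const)
qed

text \<open>The functions \<open>p (1 / t) exp (-1 / t)\<close>, extended by zero to \<open>t \<le> 0\<close>. Letting \<open>p\<close> range over all
polynomials makes the family closed under differentiation, which gives smoothness.\<close>

definition flat :: "real poly \<Rightarrow> real \<Rightarrow> real" where
  "flat p t = (if t \<le> 0 then 0 else poly p (1 / t) * exp (- 1 / t))"

lemma poly_mult_exp_minus_tendsto_0:
  "((\<lambda>s. poly p s * exp (- s)) \<longlongrightarrow> (0::real)) at_top"
proof -
  have "((\<lambda>s. \<Sum>i\<le>degree p. coeff p i * (s ^ i / exp s)) \<longlongrightarrow> (\<Sum>i\<le>degree p. coeff p i * 0)) at_top"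
    by (intro tendsto_sum tendsto_mult tendsto_const tendsto_power_div_exp_0)
  then show ?thesis
    by (simp add: poly_altdef sum_distrib_right exp_minus divide_inverse mult.assoc)
qed

text \<open>With \<open>s = 1 / t\<close> the derivative of \<open>p s exp (-s)\<close> with respect to \<open>t\<close> is \<open>s\<^sup>2 (p s - p' s) exp (-s)\<close>. At
the origin the difference quotient is \<open>s p s exp (-s)\<close>, which tends to zero as \<open>s\<close> tends to infinity.\<close>

lemma DERIV_flat:
  "(flat p has_real_derivative flat ([:0, 0, 1:] * (p - pderiv p)) t) (at t)"
proof -
  let ?q = "[:0, 0, 1:] * (p - pderiv p)"
  consider "t > 0" | "t < 0" | "t = 0" by linarith
  then show ?thesis
  proof cases
    case 1
    have "((\<lambda>t. poly p (1 / t) * exp (- 1 / t)) has_real_derivative flat ?q t) (at t)"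
      using 1 by (auto intro!: derivative_eq_intros DERIV_chain2[OF poly_DERIV]
          simp: flat_def field_simps power2_eq_square)
    then show ?thesis
      by (rule has_field_derivative_transform_within_open[of _ _ _ "{0<..}"])
        (use 1 in \<open>auto simp: flat_def\<close>)
  next
    case 2
    have "((\<lambda>t. 0) has_real_derivative flat ?q t) (at t)"
      using 2 by (auto simp: flat_def)
    then show ?thesis
      by (rule has_field_derivative_transform_within_open[of _ _ _ "{..<0}"])
        (use 2 in \<open>auto simp: flat_def\<close>)
  next
    case 3
    have "((\<lambda>h. poly (pCons 0 p) (inverse h) * exp (- inverse h)) \<longlongrightarrow> 0) (at_right 0)"
      using filterlim_compose[OF poly_mult_exp_minus_tendsto_0 filterlim_inverse_at_top_right] .
    then have "((\<lambda>h. flat p h / h) \<longlongrightarrow> 0) (at_right 0)"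
      by (rule Lim_transform_eventually)
        (auto simp: flat_def eventually_at_right_less field_simps intro!: eventually_at_rightI[of 0 1])
    moreover have "((\<lambda>h. flat p h / h) \<longlongrightarrow> 0) (at_left 0)"
      by (rule Lim_transform_eventually[OF tendsto_const])
        (auto simp: flat_def intro!: eventually_at_leftI[of "-1"])
    ultimately have "((\<lambda>h. flat p h / h) \<longlongrightarrow> 0) (at 0)"
      by (simp add: filterlim_split_at)
    then show ?thesis
      by (simp add: 3 DERIV_def flat_def)
  qed
qed

lemma flat_1: "flat 1 t = (if t \<le> 0 then 0 else exp (- 1 / t))"
  by (simp add: flat_def)

lemma C_k_flat_inner:
  "C_k k (\<lambda>x::'a::euclidean_space. flat p (c * (x \<bullet> e) + d))"
proof -
  define P where "P i = ((\<lambda>p. [:0, 0, 1:] * (p - pderiv p)) ^^ i) p" for i :: nat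
  have "C_k k (\<lambda>x::'a. flat (P 0) (c * (x \<bullet> e) + d))"
    by (rule C_k_compose_inner[of "\<lambda>i. flat (P i)"]) (use DERIV_flat in \<open>simp add: P_def\<close>)
  then show ?thesis by (simp add: P_def)
qed

text \<open>For \<open>t > 0\<close> the values \<open>flat 1 (n t)\<close> increase to 1 as \<open>n\<close> tends to infinity, so these smooth functions
supported in the closed box approximate the indicator function of the open box.\<close>

definition bump :: "'a::euclidean_space \<Rightarrow> 'a \<Rightarrow> nat \<Rightarrow> 'a \<Rightarrow> real" where
  "bump l u n x = (\<Prod>b\<in>Basis. flat 1 (real n * (x \<bullet> b - l \<bullet> b)) * flat 1 (real n * (u \<bullet> b - x \<bullet> b)))"

lemma bump_bounds: "0 \<le> bump l u n x" "bump l u n x \<le> 1"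
  unfolding bump_def
  by (auto intro!: prod_nonneg prod_le_1 mult_le_one simp: flat_1)

lemma bump_eq_0: "x \<notin> box l u \<Longrightarrow> bump l u n x = 0"
  unfolding bump_def by (subst prod_zero_iff) (auto simp: flat_1 box_def mult_le_0_iff not_less)

lemma bump_tendsto: "(\<lambda>n. bump l u n x) \<longlonglongrightarrow> indicator (box l u) x"
proof (cases "x \<in> box l u")
  case True
  have lim: "(\<lambda>n. flat 1 (real n * s)) \<longlonglongrightarrow> 1" if "0 < s" for s
  proof -
    have "(\<lambda>n. exp (- (1 / s) / real n)) \<longlonglongrightarrow> exp 0"
      by (intro tendsto_exp lim_const_over_n)
    then have "(\<lambda>n. exp (- 1 / (real n * s))) \<longlonglongrightarrow> 1"
      by (simp add: field_simps)
    then show ?thesis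
      by (rule Lim_transform_eventually)
        (use that in \<open>auto simp: flat_1 mult_le_0_iff intro!: eventually_sequentiallyI[of 1]\<close>)
  qed
  have "(\<lambda>n. bump l u n x) \<longlonglongrightarrow> (\<Prod>b\<in>(Basis::'a set). 1 * 1)"
    unfolding bump_def using True by (intro tendsto_prod tendsto_mult lim) (auto simp: box_def)
  then show ?thesis using True by simp
qed (simp add: bump_eq_0)

lemma test_functionI:
  assumes "\<And>k. C_k k \<phi>" "\<And>x. x \<notin> S \<Longrightarrow> \<phi> x = 0" "bounded S"
  shows "test_function \<phi>"
proof -
  have "{x. \<phi> x \<noteq> 0} \<subseteq> S" using assms(2) by auto
  then have "bounded (closure {x. \<phi> x \<noteq> 0})"
    using assms(3) by (meson bounded_closure bounded_subset)
  then show ?thesis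
    using assms(1) by (auto simp: test_function_def compact_eq_bounded_closed)
qed

lemma test_function_bump: "test_function (bump l u n)"
proof (rule test_functionI[of _ "box l u"])
  fix k
  have "C_k k (\<lambda>x. flat 1 (real n * (x \<bullet> b - l \<bullet> b)) * flat 1 (real n * (u \<bullet> b - x \<bullet> b)))" for b
    using C_k_mult[OF C_k_flat_inner[of k 1 "real n" b "- real n * (l \<bullet> b)"]
        C_k_flat_inner[of k 1 "- real n" b "real n * (u \<bullet> b)"]]
    by (simp add: algebra_simps)
  then show "C_k k (bump l u n)"
    unfolding bump_def[abs_def] by (intro C_k_prod) auto
qed (auto intro: bump_eq_0 bounded_box)

lemma test_function_support:
  assumes "test_function \<phi>"
  obtains S where "compact S" "\<And>x. x \<notin> S \<Longrightarrow> \<phi> x = 0"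
    "\<And>x b. x \<notin> S \<Longrightarrow> frechet_derivative \<phi> (at x) b = 0"
proof -
  define S where "S = closure {x. \<phi> x \<noteq> 0}"
  have S: "compact S" using assms by (simp add: test_function_def S_def)
  have zero: "\<phi> x = 0" if "x \<notin> S" for x
    using that closure_subset[of "{x. \<phi> x \<noteq> 0}"] unfolding S_def by blast
  have "frechet_derivative \<phi> (at x) b = 0" if "x \<notin> S" for x b
  proof -
    have "((\<lambda>x. 0) has_derivative (\<lambda>b. 0)) (at x)" by simp
    moreover have "open (- S)" using S by (simp add: compact_imp_closed open_Compl)
    ultimately have "(\<phi> has_derivative (\<lambda>b. 0)) (at x)"
      by (rule has_derivative_transform_within_open) (use that zero in auto)
    then show ?thesis
      by (metis frechet_derivative_at)
  qed
  then show thesis using that S zero by blast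
qed

lemma test_function_continuous: "test_function \<phi> \<Longrightarrow> continuous_on UNIV \<phi>"
  unfolding test_function_def using C_k_continuous by blast

lemma test_function_differentiable: "test_function \<phi> \<Longrightarrow> \<phi> differentiable (at x)"
  unfolding test_function_def using C_k.simps(2) by blast

lemma test_function_frechet_derivative:
  assumes "test_function \<phi>" "b \<in> Basis"
  shows "test_function (\<lambda>x. frechet_derivative \<phi> (at x) b)"
proof -
  obtain S where "compact S" "\<And>x. x \<notin> S \<Longrightarrow> \<phi> x = 0"
    "\<And>x b. x \<notin> S \<Longrightarrow> frechet_derivative \<phi> (at x) b = 0"
    using test_function_support[OF assms(1)] by blast
  moreover have "C_k k (\<lambda>x. frechet_derivative \<phi> (at x) b)" for k
    using assms C_k.simps(2)[of k \<phi>] unfolding test_function_def by blast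
  ultimately show ?thesis
    by (intro test_functionI[of _ S] compact_imp_bounded)
qed

lemma test_function_zero: "test_function (\<lambda>x. 0)"
  by (rule test_functionI[of _ "{}"]) (auto intro: C_k_const)

lemma test_function_lincomb:
  assumes "test_function \<phi>" "test_function \<psi>"
  shows "test_function (\<lambda>x. c * \<phi> x + d * \<psi> x)"
proof -
  obtain S where S: "compact S" "\<And>x. x \<notin> S \<Longrightarrow> \<phi> x = 0"
    "\<And>x b. x \<notin> S \<Longrightarrow> frechet_derivative \<phi> (at x) b = 0"
    using test_function_support[OF assms(1)] by blast
  obtain T where T: "compact T" "\<And>x. x \<notin> T \<Longrightarrow> \<psi> x = 0"
    "\<And>x b. x \<notin> T \<Longrightarrow> frechet_derivative \<psi> (at x) b = 0"
    using test_function_support[OF assms(2)] by blast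
  show ?thesis
  proof (rule test_functionI[of _ "S \<union> T"])
    show "C_k k (\<lambda>x. c * \<phi> x + d * \<psi> x)" for k
      using assms by (intro C_k_add C_k_mult C_k_const) (auto simp: test_function_def)
  qed (use S T in \<open>auto intro: compact_imp_bounded\<close>)
qed

lemma test_function_shift:
  assumes "test_function \<phi>"
  shows "test_function (\<lambda>x. \<phi> (x + h))"
proof -
  obtain S where S: "compact S" "\<And>x. x \<notin> S \<Longrightarrow> \<phi> x = 0"
    "\<And>x b. x \<notin> S \<Longrightarrow> frechet_derivative \<phi> (at x) b = 0"
    using test_function_support[OF assms(1)] by blast
  show ?thesis
  proof (rule test_functionI[of _ "(\<lambda>x. x - h) ` S"])
    show "C_k k (\<lambda>x. \<phi> (x + h))" for k
      using assms by (intro C_k_shift) (auto simp: test_function_def)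
    show "\<phi> (x + h) = 0" if "x \<notin> (\<lambda>x. x - h) ` S" for x
      using that by (intro S(2)) (force simp: image_iff)
    show "bounded ((\<lambda>x. x - h) ` S)"
      using S(1) by (intro compact_imp_bounded compact_continuous_image continuous_intros)
  qed
qed

lemma indicator_L2:
  fixes A :: "'a::euclidean_space set"
  assumes "A \<in> sets lebesgue" "emeasure lebesgue A < \<infinity>"
  shows "(indicator A :: 'a \<Rightarrow> real) \<in> L2 UNIV"
proof -
  have "ennreal ((indicator A x)\<^sup>2) = indicator A x" for x
    by (simp add: indicator_def)
  then have "sq_norm (indicator A :: 'a \<Rightarrow> real) = emeasure lebesgue A"
    unfolding sq_norm_def using assms(1) by (simp only: nn_integral_indicator)
  then show ?thesis
    using assms by (simp add: L2_UNIV_iff borel_measurable_indicator)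
qed

lemma bounded_support_L2:
  fixes f :: "'a::euclidean_space \<Rightarrow> real"
  assumes [measurable]: "f \<in> borel_measurable lebesgue"
    and "\<And>x. \<bar>f x\<bar> \<le> B" "\<And>x. x \<notin> S \<Longrightarrow> f x = 0" "compact S"
  shows "f \<in> L2 UNIV"
proof -
  have S: "S \<in> sets lborel" using \<open>compact S\<close> by (simp add: borel_compact)
  then have [measurable]: "S \<in> sets lebesgue" by (rule sets_completionI_sets)
  have "emeasure lebesgue S < \<infinity>"
    using emeasure_compact_finite[OF \<open>compact S\<close>] S by (simp add: main_part_sets)
  then have "(\<lambda>x. B * indicator S x) \<in> L2 UNIV"
    by (intro L2_cmult indicator_L2) auto
  moreover have "sq_norm f \<le> sq_norm (\<lambda>x. B * indicator S x)"
  proof (rule sq_norm_mono)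
    fix x show "\<bar>f x\<bar> \<le> \<bar>B * indicator S x\<bar>"
      using assms(2)[of x] assms(3)[of x] by (cases "x \<in> S") auto
  qed
  ultimately show ?thesis
    by (auto simp: L2_UNIV_iff intro: le_less_trans)
qed

lemma continuous_measurable_lebesgue:
  fixes f :: "'a::euclidean_space \<Rightarrow> real"
  assumes "continuous_on UNIV f"
  shows "f \<in> borel_measurable lebesgue"
  using borel_measurable_continuous_onI[OF assms] by (simp add: measurable_completion)

lemma test_function_bounded:
  assumes "test_function \<phi>"
  obtains B where "\<And>x. \<bar>\<phi> x\<bar> \<le> B" "0 \<le> B"
proof -
  obtain S where S: "compact S" "\<And>x. x \<notin> S \<Longrightarrow> \<phi> x = 0"
    "\<And>x b. x \<notin> S \<Longrightarrow> frechet_derivative \<phi> (at x) b = 0"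
    using test_function_support[OF assms(1)] by blast
  have "bounded (\<phi> ` S)"
    using S(1) test_function_continuous[OF assms]
    by (intro compact_imp_bounded compact_continuous_image) (auto intro: continuous_on_subset)
  then obtain B where "\<And>x. x \<in> S \<Longrightarrow> \<bar>\<phi> x\<bar> \<le> B"
    by (auto simp: bounded_iff)
  then have "\<bar>\<phi> x\<bar> \<le> \<bar>B\<bar>" for x
    using S(2)[of x] by (cases "x \<in> S") force+
  then show thesis using that[of "\<bar>B\<bar>"] by auto
qed

lemma test_function_L2:
  assumes "test_function \<phi>"
  shows "\<phi> \<in> L2 UNIV"
proof -
  obtain S where S: "compact S" "\<And>x. x \<notin> S \<Longrightarrow> \<phi> x = 0"
    "\<And>x b. x \<notin> S \<Longrightarrow> frechet_derivative \<phi> (at x) b = 0"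
    using test_function_support[OF assms(1)] by blast
  obtain B where "\<And>x. \<bar>\<phi> x\<bar> \<le> B"
    using test_function_bounded[OF assms] by blast
  then show ?thesis
    using S test_function_continuous[OF assms]
    by (intro bounded_support_L2[of \<phi> B S] continuous_measurable_lebesgue) auto
qed

section \<open>Density of test functions\<close>

text \<open>Boxes form a generating \<open>\<pi>\<close>-system, so after restriction to a bounded box, where the function is
integrable, its integral over every Borel set vanishes.\<close>

lemma integral_box_eq_0_imp_AE_0:
  fixes f :: "'a::euclidean_space \<Rightarrow> real"
  assumes f: "f \<in> L2 UNIV"
    and box: "\<And>l u. (\<integral>x. f x * indicator (box l u) x \<partial>lebesgue) = 0"
  shows "AE x in lebesgue. f x = 0"
proof -
  obtain g where g [measurable]: "g \<in> borel_measurable lborel" and fg: "AE x in lborel. f x = g x"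
    using completion_ex_borel_measurable_real[OF L2_measurable[OF f]] by blast
  have fg': "AE x in lebesgue. f x = g x"
    using fg by (rule AE_completion)
  define B where "B n = box (- real n *\<^sub>R One) (real n *\<^sub>R One :: 'a)" for n
  have [measurable]: "B n \<in> sets lborel" for n by (simp add: B_def)
  have [measurable]: "box l u \<in> sets lborel" "box l u \<in> sets lebesgue" for l u :: 'a by simp_all
  have gL2: "g \<in> L2 UNIV"
    using f sq_norm_cong_AE[OF fg'] by (auto simp: L2_UNIV_iff measurable_completion)
  have "(indicator (box l u) :: 'a \<Rightarrow> real) \<in> L2 UNIV" for l u :: 'a
    by (intro indicator_L2) (auto simp: emeasure_lborel_box_eq)
  then have int: "integrable lborel (\<lambda>x. g x * indicator (box l u) x)" for l u
    using L2_mult_integrable[OF gL2, of "indicator (box l u)"] by (simp add: integrable_completion)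
  have boxg: "(\<integral>x. g x * indicator (box l u) x \<partial>lborel) = 0" for l u
  proof -
    have "(\<integral>x. g x * indicator (box l u) x \<partial>lborel) = (\<integral>x. g x * indicator (box l u) x \<partial>lebesgue)"
      by (simp add: integral_completion)
    also have "\<dots> = (\<integral>x. f x * indicator (box l u) x \<partial>lebesgue)"
      using fg' L2_measurable[OF f]
      by (intro integral_cong_AE) (auto simp: measurable_completion elim: eventually_mono)
    finally show ?thesis using box by simp
  qed
  have "AE x in lborel. g x * indicator (B n) x = 0" for n
  proof (rule sigma_finite_measure.density_zero[OF lborel.sigma_finite_measure_axioms])
    show "integrable lborel (\<lambda>x. g x * indicator (B n) x)"
      using int by (simp add: B_def)
    fix A :: "'a set" assume "A \<in> sets lborel"
    then have A: "A \<in> sigma_sets UNIV (range (\<lambda>(a, b). box a b))"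
      by (simp add: borel_eq_box)
    have "Int_stable (range (\<lambda>(a, b). box a b :: 'a set))"
      by (auto simp: Int_stable_def box_Int_box)
    moreover have "range (\<lambda>(a, b). box a b :: 'a set) \<subseteq> Pow UNIV" by simp
    ultimately show "(LINT x:A|lborel. g x * indicator (B n) x) = 0"
      using A
    proof (induction rule: sigma_sets_induct_disjoint)
      case (basic A)
      then obtain l u where "A = box l u" by auto
      then have "A \<inter> B n \<in> range (\<lambda>(a, b). box a b)"
        by (auto simp: B_def box_Int_box)
      then obtain l u where "A \<inter> B n = box l u" by auto
      then have eq: "indicator A x * (g x * indicator (B n) x) = g x * indicator (box l u) x" for x
        by (metis indicator_inter_arith mult.assoc mult.commute)
      show ?case
        unfolding set_lebesgue_integral_def real_scaleR_def eq by (rule boxg)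
    next
      case empty
      show ?case by (simp add: set_lebesgue_integral_def)
    next
      case (compl A)
      have A [measurable]: "A \<in> sets borel"
        using compl by (simp add: borel_eq_box)
      have "(LINT x:UNIV - A|lborel. g x * indicator (B n) x)
        = (\<integral>x. g x * indicator (B n) x - indicator A x *\<^sub>R (g x * indicator (B n) x) \<partial>lborel)"
        unfolding set_lebesgue_integral_def
        by (intro Bochner_Integration.integral_cong) (auto simp: indicator_def)
      also have "\<dots> = (\<integral>x. g x * indicator (B n) x \<partial>lborel) - (LINT x:A|lborel. g x * indicator (B n) x)"
        unfolding set_lebesgue_integral_def using int
        by (intro Bochner_Integration.integral_diff integrable_mult_indicator) (auto simp: B_def)
      finally show ?case
        using compl boxg by (simp add: B_def)
    next
      case (union A)
      have [measurable]: "A i \<in> sets borel" for i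
        using union(2) by (auto simp: borel_eq_box)
      have "integrable lborel (\<lambda>x. g x * indicator (B n) x)"
        using int by (simp add: B_def)
      then have "set_integrable lborel (\<Union>i. A i) (\<lambda>x. g x * indicator (B n) x)"
        unfolding set_integrable_def by (intro integrable_mult_indicator) measurable
      moreover have "A i \<inter> A j = {}" if "i \<noteq> j" for i j
        using union(1) that by (auto simp: disjoint_family_on_def)
      ultimately have "(LINT x:(\<Union>i. A i)|lborel. g x * indicator (B n) x)
          = (\<Sum>i. (LINT x:(A i)|lborel. g x * indicator (B n) x))"
        by (intro lebesgue_integral_countable_add) auto
      then show ?case using union by simp
    qed
  qed
  then have "AE x in lborel. \<forall>n. g x * indicator (B n) x = 0"
    unfolding AE_all_countable by blast
  then have "AE x in lborel. g x = 0"
  proof eventually_elim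
    fix x :: 'a assume *: "\<forall>n. g x * indicator (B n) x = 0"
    obtain n where "norm x < real n" using reals_Archimedean2 by blast
    then have "x \<in> B n"
      using Basis_le_norm[of _ x] by (force simp: B_def box_def abs_le_iff)
    then show "g x = 0" using *[rule_format, of n] by simp
  qed
  then have "AE x in lebesgue. g x = 0" by (rule AE_completion)
  then show ?thesis using fg' by eventually_elim simp
qed

lemma orthogonal_to_test_functions_imp_AE_0:
  fixes f :: "'a::euclidean_space \<Rightarrow> real"
  assumes f: "f \<in> L2 UNIV"
    and orth: "\<And>\<phi>. test_function \<phi> \<Longrightarrow> (\<integral>x. f x * \<phi> x \<partial>lebesgue) = 0"
  shows "AE x in lebesgue. f x = 0"
proof (rule integral_box_eq_0_imp_AE_0[OF f])
  fix l u :: 'a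
  have [measurable]: "f \<in> borel_measurable lebesgue" "bump l u n \<in> borel_measurable lebesgue" for n
    using L2_measurable f test_function_bump test_function_L2 by blast+
  have box [measurable]: "box l u \<in> sets lebesgue" by simp
  have "(\<lambda>n. \<integral>x. f x * bump l u n x \<partial>lebesgue) \<longlonglongrightarrow> (\<integral>x. f x * indicator (box l u) x \<partial>lebesgue)"
  proof (rule integral_dominated_convergence)
    have "(indicator (box l u) :: 'a \<Rightarrow> real) \<in> L2 UNIV"
      by (intro indicator_L2) (auto simp: emeasure_lborel_box_eq)
    then show "integrable lebesgue (\<lambda>x. \<bar>f x * indicator (box l u) x\<bar>)"
      by (intro integrable_abs L2_mult_integrable f)
    show "AE x in lebesgue. norm (f x * bump l u n x) \<le> \<bar>f x * indicator (box l u) x\<bar>" for n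
    proof (rule AE_I2)
      fix x show "norm (f x * bump l u n x) \<le> \<bar>f x * indicator (box l u) x\<bar>"
        using bump_bounds[of l u n x] bump_eq_0[of x l u n]
        by (cases "x \<in> box l u") (auto simp: abs_mult mult_left_le)
    qed
    show "AE x in lebesgue. (\<lambda>n. f x * bump l u n x) \<longlonglongrightarrow> f x * indicator (box l u) x"
      by (intro AE_I2 tendsto_mult tendsto_const bump_tendsto)
  qed measurable
  then show "(\<integral>x. f x * indicator (box l u) x \<partial>lebesgue) = 0"
    using orth[OF test_function_bump] by (simp add: LIMSEQ_const_iff)
qed

text \<open>The distance from \<open>a\<close> to the test functions is approached by a sequence whose residuals \<open>a - \<phi>\<^sub>n\<close>
converge to some \<open>p\<close>. Minimality makes \<open>p\<close> orthogonal to every test function, hence zero.\<close>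

lemma test_functions_dense_L2:
  fixes a :: "'a::euclidean_space \<Rightarrow> real"
  assumes a: "a \<in> L2 UNIV"
  obtains \<phi> where "\<And>n. test_function (\<phi> n)" "(\<lambda>n. \<integral>x. (\<phi> n x - a x)\<^sup>2 \<partial>lebesgue) \<longlonglongrightarrow> 0"
proof -
  define K where "K = {(\<lambda>x. a x - \<phi> x) | \<phi>. test_function \<phi>}"
  define q where "q f = (\<integral>x. (f x)\<^sup>2 \<partial>lebesgue)" for f :: "'a \<Rightarrow> real"
  have K_L2: "K \<subseteq> L2 UNIV"
    using a test_function_L2 by (auto simp: K_def intro!: L2_diff)
  have K_mid: "midpoint_closed K"
  proof (unfold midpoint_closed_def, intro ballI)
    fix f g assume "f \<in> K" "g \<in> K"
    then obtain \<phi> \<psi> where *: "test_function \<phi>" "test_function \<psi>" "f = (\<lambda>x. a x - \<phi> x)" "g = (\<lambda>x. a x - \<psi> x)"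
      by (auto simp: K_def)
    then show "(\<lambda>x. (f x + g x) / 2) \<in> K"
      unfolding K_def using test_function_lincomb[OF *(1,2), of "1/2" "1/2"]
      by (auto simp: field_simps intro!: exI[of _ "\<lambda>x. 1/2 * \<phi> x + 1/2 * \<psi> x"])
  qed
  have aK: "a \<in> K"
    using test_function_zero by (auto simp: K_def intro!: exI[of _ "\<lambda>x. 0"])
  obtain y where y: "\<And>n. y n \<in> K" "\<And>n f. f \<in> K \<Longrightarrow> q (y n) \<le> q f + 1 / Suc n"
    "\<And>\<epsilon>. 0 < \<epsilon> \<Longrightarrow> \<exists>N. \<forall>m\<ge>N. \<forall>n\<ge>N. q (\<lambda>x. y m x - y n x) < \<epsilon>"
    by (rule minimising_sequence_Cauchy[of q "\<lambda>_. K" "q a"])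
      (use K_L2 K_mid aK in \<open>auto simp: q_def integral_square_parallelogram subset_iff\<close>)
  have yL2: "y n \<in> L2 UNIV" for n using y(1) K_L2 by auto
  obtain p where p: "p \<in> L2 UNIV" "(\<lambda>n. \<integral>x. (y n x - p x)\<^sup>2 \<partial>lebesgue) \<longlonglongrightarrow> 0"
    by (rule L2_complete[OF yL2 y(3)[unfolded q_def]])
  have "(\<integral>x. p x * \<psi> x \<partial>lebesgue) = 0" if \<psi>: "test_function \<psi>" for \<psi>
  proof -
    define c where "c = (\<integral>x. p x * \<psi> x \<partial>lebesgue)"
    define B where "B = q \<psi>"
    have \<psi>L2: "\<psi> \<in> L2 UNIV" using \<psi> by (rule test_function_L2)
    have B0: "0 \<le> B" by (simp add: B_def q_def)
    have ineq: "2 * s * (\<integral>x. y n x * \<psi> x \<partial>lebesgue) \<le> s\<^sup>2 * B + 1 / Suc n" for s n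
    proof -
      obtain \<phi> where \<phi>: "test_function \<phi>" "y n = (\<lambda>x. a x - \<phi> x)"
        using y(1)[of n] by (auto simp: K_def)
      have "(\<lambda>x. y n x - s * \<psi> x) \<in> K"
        unfolding K_def \<phi>(2) using test_function_lincomb[OF \<phi>(1) \<psi>, of 1 s]
        by (auto intro!: exI[of _ "\<lambda>x. 1 * \<phi> x + s * \<psi> x"])
      then have "q (y n) \<le> q (\<lambda>x. y n x - s * \<psi> x) + 1 / Suc n" by (rule y(2))
      also have "q (\<lambda>x. y n x - s * \<psi> x) = (\<integral>x. (y n x)\<^sup>2 + s\<^sup>2 * (\<psi> x)\<^sup>2 - 2 * s * (y n x * \<psi> x) \<partial>lebesgue)"
        unfolding q_def by (intro Bochner_Integration.integral_cong) (auto simp: power2_eq_square algebra_simps)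
      also have "\<dots> = q (y n) + s\<^sup>2 * B - 2 * s * (\<integral>x. y n x * \<psi> x \<partial>lebesgue)"
        using L2_integrable_square[OF yL2, of n] L2_integrable_square[OF \<psi>L2] L2_mult_integrable[OF yL2 \<psi>L2, of n]
        by (simp add: q_def B_def)
      finally show ?thesis by simp
    qed
    have lim: "2 * s * c \<le> s\<^sup>2 * B" for s
    proof (rule LIMSEQ_le)
      show "(\<lambda>n. 2 * s * (\<integral>x. y n x * \<psi> x \<partial>lebesgue)) \<longlonglongrightarrow> 2 * s * c"
        unfolding c_def by (intro tendsto_intros L2_integral_mult_tendsto yL2 p \<psi>L2)
      have "(\<lambda>n. s\<^sup>2 * B + 1 / Suc n) \<longlonglongrightarrow> s\<^sup>2 * B + 0"
        by (intro tendsto_intros LIMSEQ_inverse_real_of_nat[unfolded inverse_eq_divide])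
      then show "(\<lambda>n. s\<^sup>2 * B + 1 / Suc n) \<longlonglongrightarrow> s\<^sup>2 * B" by simp
    qed (use ineq in auto)
    \<comment> \<open>The inequality \<open>lim\<close> at this parameter forces \<open>c = 0\<close>; the summand 1 covers the case \<open>B = 0\<close>.\<close>
    define t where "t = c / (B + 1)"
    have c: "c = t * (B + 1)" using B0 by (simp add: t_def)
    have "t\<^sup>2 * B + 2 * t\<^sup>2 \<le> 0"
      using lim[of t] unfolding c by (simp add: power2_eq_square algebra_simps)
    moreover have "0 \<le> t\<^sup>2 * B" using B0 by simp
    ultimately have "t\<^sup>2 \<le> 0" by linarith
    then have "t = 0" by simp
    then show ?thesis using c by (simp add: c_def)
  qed
  then have p0: "AE x in lebesgue. p x = 0"
    by (intro orthogonal_to_test_functions_imp_AE_0 p) auto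
  have "\<exists>\<phi>. test_function \<phi> \<and> y n = (\<lambda>x. a x - \<phi> x)" for n
    using y(1)[of n] by (auto simp: K_def)
  then obtain \<phi> where \<phi>: "\<And>n. test_function (\<phi> n)" "\<And>n. y n = (\<lambda>x. a x - \<phi> n x)"
    by metis
  have "(\<integral>x. (y n x - p x)\<^sup>2 \<partial>lebesgue) = (\<integral>x. (\<phi> n x - a x)\<^sup>2 \<partial>lebesgue)" for n
  proof (rule integral_cong_AE)
    show "AE x in lebesgue. (y n x - p x)\<^sup>2 = (\<phi> n x - a x)\<^sup>2"
      using p0 by eventually_elim (simp add: \<phi>(2) power2_commute)
  qed (use L2_measurable[OF yL2] L2_measurable[OF p(1)] L2_measurable[OF a]
        L2_measurable[OF test_function_L2[OF \<phi>(1)]] in measurable)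
  then show thesis using that[of \<phi>] \<phi>(1) p(2) by simp
qed

lemma L2_bound_by_duality:
  fixes a :: "'a::euclidean_space \<Rightarrow> real"
  assumes a: "a \<in> L2 UNIV" and C: "0 \<le> C"
    and dual: "\<And>\<phi>. test_function \<phi> \<Longrightarrow> \<bar>\<integral>x. a x * \<phi> x \<partial>lebesgue\<bar> \<le> C * sqrt (\<integral>x. (\<phi> x)\<^sup>2 \<partial>lebesgue)"
  shows "(\<integral>x. (a x)\<^sup>2 \<partial>lebesgue) \<le> C\<^sup>2"
proof -
  define A where "A = (\<integral>x. (a x)\<^sup>2 \<partial>lebesgue)"
  obtain \<phi> where \<phi>: "\<And>n. test_function (\<phi> n)" "(\<lambda>n. \<integral>x. (\<phi> n x - a x)\<^sup>2 \<partial>lebesgue) \<longlonglongrightarrow> 0"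
    using test_functions_dense_L2[OF a] by blast
  note \<phi>L2 = test_function_L2[OF \<phi>(1)]
  have "A \<le> C * sqrt A"
  proof (rule LIMSEQ_le)
    show "(\<lambda>n. \<integral>x. \<phi> n x * a x \<partial>lebesgue) \<longlonglongrightarrow> A"
      using L2_integral_mult_tendsto[OF \<phi>L2 a a \<phi>(2)] by (simp add: A_def power2_eq_square)
    show "(\<lambda>n. C * sqrt (\<integral>x. (\<phi> n x)\<^sup>2 \<partial>lebesgue)) \<longlonglongrightarrow> C * sqrt A"
      unfolding A_def by (intro tendsto_intros L2_integral_square_tendsto \<phi>L2 a \<phi>(2))
    show "\<exists>N. \<forall>n\<ge>N. (\<integral>x. \<phi> n x * a x \<partial>lebesgue) \<le> C * sqrt (\<integral>x. (\<phi> n x)\<^sup>2 \<partial>lebesgue)"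
      using dual[OF \<phi>(1)] by (auto simp: mult.commute abs_le_iff)
  qed
  moreover have "0 \<le> A" by (simp add: A_def)
  ultimately have "sqrt A \<le> C"
  proof (cases "A = 0")
    case False
    then have "0 < sqrt A" using \<open>0 \<le> A\<close> by simp
    moreover have "sqrt A * sqrt A \<le> C * sqrt A"
      using \<open>A \<le> C * sqrt A\<close> \<open>0 \<le> A\<close> by simp
    ultimately show ?thesis by (rule mult_right_le_imp_le[rotated])
  qed (use C in simp)
  then have "(sqrt A)\<^sup>2 \<le> C\<^sup>2" using \<open>0 \<le> A\<close> by (intro power_mono) auto
  then show ?thesis using \<open>0 \<le> A\<close> by (simp add: A_def)
qed


section \<open>Strongly convergent midpoints of bounded sequences\<close>

inductive_set midpoint_hull :: "('a \<Rightarrow> real) set \<Rightarrow> ('a \<Rightarrow> real) set" for X where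
  base: "f \<in> X \<Longrightarrow> f \<in> midpoint_hull X"
| mid: "f \<in> midpoint_hull X \<Longrightarrow> g \<in> midpoint_hull X \<Longrightarrow> (\<lambda>x. (f x + g x) / 2) \<in> midpoint_hull X"

lemma midpoint_closed_hull: "midpoint_closed (midpoint_hull X)"
  by (auto simp: midpoint_closed_def intro: midpoint_hull.mid)

lemma midpoint_hull_minimal:
  assumes "X \<subseteq> S" "midpoint_closed S"
  shows "midpoint_hull X \<subseteq> S"
proof
  fix f assume "f \<in> midpoint_hull X"
  then show "f \<in> S"
    by induction (use assms in \<open>auto simp: midpoint_closed_def\<close>)
qed

lemma midpoint_hull_mono: "X \<subseteq> Y \<Longrightarrow> midpoint_hull X \<subseteq> midpoint_hull Y"
  by (rule midpoint_hull_minimal) (auto intro: midpoint_hull.base midpoint_closed_hull)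

lemma midpoint_closed_L2: "midpoint_closed (L2 UNIV)"
  by (auto simp: midpoint_closed_def intro: L2_midpoint)

text \<open>A substitute for weak compactness. Since \<open>y n\<close> is built from the tail \<open>a n, a (n + 1), \<dots>\<close>, every limit
and every linear relation that the sequence \<open>a\<close> satisfies asymptotically passes to \<open>y\<close>, which has the
advantage of being a Cauchy sequence for the quadratic form \<open>q\<close>.\<close>

lemma forward_midpoints_Cauchy:
  fixes q :: "('a \<Rightarrow> real) \<Rightarrow> real" and a :: "nat \<Rightarrow> 'a \<Rightarrow> real"
  assumes nonneg: "\<And>f. 0 \<le> q f"
    and S: "\<And>k. a k \<in> S" "midpoint_closed S"
    and parallelogram: "\<And>f g. f \<in> S \<Longrightarrow> g \<in> S \<Longrightarrow>
        q (\<lambda>x. f x - g x) = 2 * q f + 2 * q g - 4 * q (\<lambda>x. (f x + g x) / 2)"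
    and bound: "\<And>n. q (a n) \<le> C"
  obtains y where "\<And>n. y n \<in> midpoint_hull (a ` {n..})" "\<And>n. y n \<in> S" "\<And>n. q (y n) \<le> C + 1 / Suc n"
    "\<And>\<epsilon>. 0 < \<epsilon> \<Longrightarrow> \<exists>N. \<forall>m\<ge>N. \<forall>n\<ge>N. q (\<lambda>x. y m x - y n x) < \<epsilon>"
proof -
  define K where "K n = midpoint_hull (a ` {n..})" for n
  have KS: "K n \<subseteq> S" for n
    unfolding K_def using S by (intro midpoint_hull_minimal) auto
  have aK: "a n \<in> K n" for n
    by (auto simp: K_def intro: midpoint_hull.base)
  have dec: "K (Suc n) \<subseteq> K n" for n
    unfolding K_def by (intro midpoint_hull_mono) auto
  have par: "q (\<lambda>x. f x - g x) = 2 * q f + 2 * q g - 4 * q (\<lambda>x. (f x + g x) / 2)"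
    if "f \<in> K 0" "g \<in> K 0" for f g
    using that KS[of 0] by (intro parallelogram) auto
  have mid: "midpoint_closed (K n)" for n
    unfolding K_def by (rule midpoint_closed_hull)
  have bd: "\<exists>f\<in>K n. q f \<le> C" for n
    using aK bound by blast
  obtain y where y: "\<And>n. y n \<in> K n" "\<And>n f. f \<in> K n \<Longrightarrow> q (y n) \<le> q f + 1 / Suc n"
    "\<And>\<epsilon>. 0 < \<epsilon> \<Longrightarrow> \<exists>N. \<forall>m\<ge>N. \<forall>n\<ge>N. q (\<lambda>x. y m x - y n x) < \<epsilon>"
    by (rule minimising_sequence_Cauchy[of q K C, OF nonneg par dec mid bd]) blast+
  show thesis
  proof (rule that[of y])
    show "y n \<in> midpoint_hull (a ` {n..})" for n using y(1) by (simp add: K_def)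
    show "y n \<in> S" for n using y(1) KS by blast
    show "q (y n) \<le> C + 1 / Suc n" for n
      using y(2)[OF aK, of n] bound[of n] by (meson add_mono order_refl order_trans)
  qed (fact y(3))
qed

section \<open>Weak gradients and difference quotients\<close>

lemma frechet_derivative_expand:
  fixes \<phi> :: "'a::euclidean_space \<Rightarrow> real"
  assumes "\<phi> differentiable (at x)"
  shows "frechet_derivative \<phi> (at x) y = (\<Sum>b\<in>Basis. (y \<bullet> b) * frechet_derivative \<phi> (at x) b)"
proof -
  have lin: "linear (frechet_derivative \<phi> (at x))"
    using assms by (rule linear_frechet_derivative)
  have "frechet_derivative \<phi> (at x) y = frechet_derivative \<phi> (at x) (\<Sum>b\<in>Basis. (y \<bullet> b) *\<^sub>R b)"
    by (simp add: euclidean_representation)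
  also have "\<dots> = (\<Sum>b\<in>Basis. (y \<bullet> b) * frechet_derivative \<phi> (at x) b)"
    by (simp add: linear_sum[OF lin] linear_scale[OF lin])
  finally show ?thesis .
qed

lemma test_function_Lipschitz:
  fixes \<phi> :: "'a::euclidean_space \<Rightarrow> real"
  assumes \<phi>: "test_function \<phi>"
  obtains L where "\<And>x y. \<bar>\<phi> x - \<phi> y\<bar> \<le> L * norm (x - y)" "0 \<le> L"
proof -
  have "\<exists>B. (\<forall>x. \<bar>frechet_derivative \<phi> (at x) b\<bar> \<le> B) \<and> 0 \<le> B" if "b \<in> Basis" for b
    using test_function_bounded[OF test_function_frechet_derivative[OF \<phi> that]] by blast
  then obtain B where B: "\<And>b x. b \<in> Basis \<Longrightarrow> \<bar>frechet_derivative \<phi> (at x) b\<bar> \<le> B b"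
    "\<And>b. b \<in> Basis \<Longrightarrow> 0 \<le> B b"
    by metis
  define L where "L = (\<Sum>b\<in>Basis. B b)"
  have "\<bar>frechet_derivative \<phi> (at x) y\<bar> \<le> L * norm y" for x y
  proof -
    have "\<bar>frechet_derivative \<phi> (at x) y\<bar> \<le> (\<Sum>b\<in>Basis. \<bar>(y \<bullet> b) * frechet_derivative \<phi> (at x) b\<bar>)"
      unfolding frechet_derivative_expand[OF test_function_differentiable[OF \<phi>], of x y] by (rule sum_abs)
    also have "\<dots> \<le> (\<Sum>b\<in>Basis. norm y * B b)"
      by (intro sum_mono) (auto simp: abs_mult intro!: mult_mono B Basis_le_norm)
    finally show ?thesis by (simp add: L_def sum_distrib_left mult.commute)
  qed
  then have on: "onorm (frechet_derivative \<phi> (at x)) \<le> L" for x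
    by (intro onorm_le) auto
  have "\<bar>\<phi> x - \<phi> y\<bar> \<le> L * norm (x - y)" for x y
    using differentiable_bound[of UNIV \<phi> "\<lambda>x. frechet_derivative \<phi> (at x)" L x y] on
      test_function_differentiable[OF \<phi>] by (simp add: frechet_derivative_works[symmetric])
  moreover have "0 \<le> L" unfolding L_def by (intro sum_nonneg B)
  ultimately show thesis using that by blast
qed

text \<open>Dominated convergence: as \<open>t\<close> is bounded, the increments of \<open>\<phi>\<close> are supported in a fixed ball, and
\<open>\<phi>\<close> is Lipschitz.\<close>

lemma integral_difference_quotient_tendsto:
  fixes u \<phi> :: "'a::euclidean_space \<Rightarrow> real"
  assumes u: "u \<in> L2 UNIV" and \<phi>: "test_function \<phi>"
    and t: "t \<longlonglongrightarrow> 0" "\<And>i. t i \<noteq> 0"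
  shows "(\<lambda>i. \<integral>x. u x * ((\<phi> (x + t i *\<^sub>R y) - \<phi> x) / t i) \<partial>lebesgue)
    \<longlonglongrightarrow> (\<integral>x. u x * frechet_derivative \<phi> (at x) y \<partial>lebesgue)"
proof -
  obtain L where L: "\<And>x y. \<bar>\<phi> x - \<phi> y\<bar> \<le> L * norm (x - y)" "0 \<le> L"
    using test_function_Lipschitz[OF \<phi>] by blast
  obtain S where S: "compact S" "\<And>x. x \<notin> S \<Longrightarrow> \<phi> x = 0"
    "\<And>x b. x \<notin> S \<Longrightarrow> frechet_derivative \<phi> (at x) b = 0"
    using test_function_support[OF \<phi>] by blast
  obtain R where R: "\<And>x. x \<in> S \<Longrightarrow> norm x \<le> R"
    using compact_imp_bounded[OF S(1)] by (auto simp: bounded_iff)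
  obtain M where M: "\<And>i. \<bar>t i\<bar> \<le> M"
    using convergent_imp_Bseq[of t] t(1) by (auto simp: convergent_def Bseq_def)
  define r where "r = R + M * norm y"
  define D where "D x = \<bar>u x * (L * norm y * indicator (cball 0 r) x)\<bar>" for x
  note um = L2_measurable[OF u]
  have \<phi>m: "(\<lambda>x. \<phi> (x + h)) \<in> borel_measurable lebesgue" for h
    by (rule L2_measurable[OF test_function_L2[OF test_function_shift[OF \<phi>]]])
  have quot: "(\<lambda>x. (\<phi> (x + t i *\<^sub>R y) - \<phi> x) / t i) \<in> borel_measurable lebesgue" for i
    using \<phi>m[of 0] by (intro borel_measurable_divide borel_measurable_diff \<phi>m borel_measurable_const) simp
  have deriv: "(\<lambda>i. (\<phi> (x + t i *\<^sub>R y) - \<phi> x) / t i) \<longlonglongrightarrow> frechet_derivative \<phi> (at x) y" for x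
  proof -
    let ?D = "frechet_derivative \<phi> (at x)"
    have "(\<phi> has_derivative ?D) (at (x + 0 *\<^sub>R y))"
      using test_function_differentiable[OF \<phi>] by (simp add: frechet_derivative_works[symmetric])
    moreover have "((\<lambda>s::real. x + s *\<^sub>R y) has_derivative (\<lambda>s. s *\<^sub>R y)) (at 0)"
      by (auto intro!: derivative_eq_intros)
    ultimately have "((\<lambda>s. \<phi> (x + s *\<^sub>R y)) has_derivative (\<lambda>s. ?D (s *\<^sub>R y))) (at 0)"
      using has_derivative_compose[of "\<lambda>s. x + s *\<^sub>R y" "\<lambda>s. s *\<^sub>R y" 0 UNIV \<phi> ?D] by simp
    moreover have "?D (s *\<^sub>R y) = ?D y * s" for s
      using linear_scale[OF linear_frechet_derivative[OF test_function_differentiable[OF \<phi>]], of x s y] by simp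
    ultimately have "((\<lambda>s. \<phi> (x + s *\<^sub>R y)) has_real_derivative ?D y) (at 0)"
      by (simp add: has_field_derivative_def)
    then have "((\<lambda>h. (\<phi> (x + h *\<^sub>R y) - \<phi> x) / h) \<longlongrightarrow> ?D y) (at 0)"
      by (simp add: DERIV_def)
    moreover have "filterlim t (at 0) sequentially"
      using t by (auto simp: filterlim_at)
    ultimately show ?thesis
      by (rule filterlim_compose)
  qed
  show ?thesis
  proof (rule integral_dominated_convergence[where w = D])
    show "(\<lambda>x. u x * frechet_derivative \<phi> (at x) y) \<in> borel_measurable lebesgue"
      by (intro borel_measurable_times um borel_measurable_LIMSEQ_real[OF deriv] quot)
    show "(\<lambda>x. u x * ((\<phi> (x + t i *\<^sub>R y) - \<phi> x) / t i)) \<in> borel_measurable lebesgue" for i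
      by (intro borel_measurable_times um quot)
    have "(\<lambda>x. (L * norm y) * indicator (cball 0 r) x) \<in> L2 (UNIV :: 'a set)"
      by (intro L2_cmult indicator_L2) (use emeasure_compact_finite[of "cball (0::'a) r"] in auto)
    then show "integrable lebesgue D"
      unfolding D_def by (intro integrable_abs L2_mult_integrable u)
    show "AE x in lebesgue. (\<lambda>i. u x * ((\<phi> (x + t i *\<^sub>R y) - \<phi> x) / t i))
        \<longlonglongrightarrow> u x * frechet_derivative \<phi> (at x) y"
      by (intro AE_I2 tendsto_mult tendsto_const deriv)
    show "AE x in lebesgue. norm (u x * ((\<phi> (x + t i *\<^sub>R y) - \<phi> x) / t i)) \<le> D x" for i
    proof (rule AE_I2)
      fix x
      have "\<bar>(\<phi> (x + t i *\<^sub>R y) - \<phi> x) / t i\<bar> \<le> L * norm y * indicator (cball 0 r) x"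
      proof (cases "x \<in> cball 0 r")
        case True
        have "\<bar>\<phi> (x + t i *\<^sub>R y) - \<phi> x\<bar> \<le> L * norm y * \<bar>t i\<bar>"
          using L(1)[of "x + t i *\<^sub>R y" x] by (simp add: ac_simps)
        then show ?thesis using True t(2)[of i] by (simp add: abs_divide divide_le_eq ac_simps)
      next
        case False
        have t_le: "norm (t i *\<^sub>R y) \<le> M * norm y"
          using M[of i] by (simp add: mult_right_mono)
        have "0 \<le> M * norm y" using norm_ge_zero t_le by (rule order_trans)
        then have "x \<notin> S"
          using False R[of x] unfolding r_def by force
        moreover have "x + t i *\<^sub>R y \<notin> S"
          using False R[of "x + t i *\<^sub>R y"] t_le norm_triangle_ineq4[of "x + t i *\<^sub>R y" "t i *\<^sub>R y"]
          unfolding r_def by force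
        ultimately show ?thesis using False S(2) by simp
      qed
      then have "\<bar>u x\<bar> * \<bar>(\<phi> (x + t i *\<^sub>R y) - \<phi> x) / t i\<bar> \<le> \<bar>u x\<bar> * (L * norm y * indicator (cball 0 r) x)"
        by (rule mult_left_mono) simp
      then show "norm (u x * ((\<phi> (x + t i *\<^sub>R y) - \<phi> x) / t i)) \<le> D x"
        using L(2) by (simp add: D_def abs_mult)
    qed
  qed
qed

lemma weak_gradient_inner_L2:
  fixes g :: "'a::euclidean_space \<Rightarrow> 'a"
  assumes "is_weak_gradient u g"
  shows "(\<lambda>x. g x \<bullet> y) \<in> L2 UNIV"
proof -
  have [measurable]: "g \<in> borel_measurable lebesgue" and int: "integrable lebesgue (\<lambda>x. (norm (g x))\<^sup>2)"
    using assms by (auto simp: is_weak_gradient_def)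
  have "integrable lebesgue (\<lambda>x. (g x \<bullet> y)\<^sup>2)"
  proof (rule Bochner_Integration.integrable_bound)
    show "integrable lebesgue (\<lambda>x. (norm y)\<^sup>2 * (norm (g x))\<^sup>2)" using int by simp
    show "AE x in lebesgue. norm ((g x \<bullet> y)\<^sup>2) \<le> norm ((norm y)\<^sup>2 * (norm (g x))\<^sup>2)"
    proof (rule AE_I2)
      fix x
      have "\<bar>g x \<bullet> y\<bar>\<^sup>2 \<le> (norm (g x) * norm y)\<^sup>2"
        by (intro power_mono Cauchy_Schwarz_ineq2) auto
      then show "norm ((g x \<bullet> y)\<^sup>2) \<le> norm ((norm y)\<^sup>2 * (norm (g x))\<^sup>2)"
        by (simp add: power_mult_distrib mult.commute)
    qed
  qed measurable
  then show ?thesis by (simp add: L2_def lebesgue_on_UNIV_eq)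
qed

lemma weak_gradient_direction:
  fixes u :: "'a::euclidean_space \<Rightarrow> real"
  assumes u: "u \<in> L2 UNIV" and g: "is_weak_gradient u g" and \<phi>: "test_function \<phi>"
  shows "(\<integral>x. u x * frechet_derivative \<phi> (at x) y \<partial>lebesgue) = - (\<integral>x. (g x \<bullet> y) * \<phi> x \<partial>lebesgue)"
proof -
  have i1: "integrable lebesgue (\<lambda>x. u x * frechet_derivative \<phi> (at x) b)" if "b \<in> Basis" for b
    using that by (intro L2_mult_integrable u test_function_L2 test_function_frechet_derivative \<phi>)
  have i2: "integrable lebesgue (\<lambda>x. (g x \<bullet> b) * \<phi> x)" for b
    by (intro L2_mult_integrable weak_gradient_inner_L2[OF g] test_function_L2 \<phi>)
  have "(\<integral>x. u x * frechet_derivative \<phi> (at x) y \<partial>lebesgue)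
      = (\<integral>x. (\<Sum>b\<in>Basis. (y \<bullet> b) * (u x * frechet_derivative \<phi> (at x) b)) \<partial>lebesgue)"
    by (intro Bochner_Integration.integral_cong refl,
        subst frechet_derivative_expand[OF test_function_differentiable[OF \<phi>]])
      (simp add: sum_distrib_left mult.left_commute)
  also have "\<dots> = (\<Sum>b\<in>Basis. (y \<bullet> b) * (\<integral>x. u x * frechet_derivative \<phi> (at x) b \<partial>lebesgue))"
    using i1 by (simp add: Bochner_Integration.integral_sum)
  also have "\<dots> = (\<Sum>b\<in>Basis. (y \<bullet> b) * - (\<integral>x. (g x \<bullet> b) * \<phi> x \<partial>lebesgue))"
    using g \<phi> by (intro sum.cong refl) (simp add: is_weak_gradient_def)
  also have "\<dots> = - (\<integral>x. (\<Sum>b\<in>Basis. (y \<bullet> b) * ((g x \<bullet> b) * \<phi> x)) \<partial>lebesgue)"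
    using i2 by (simp add: Bochner_Integration.integral_sum sum_negf)
  also have "\<dots> = - (\<integral>x. (g x \<bullet> y) * \<phi> x \<partial>lebesgue)"
  proof -
    have "(\<Sum>b\<in>Basis. (y \<bullet> b) * ((g x \<bullet> b) * \<phi> x)) = (g x \<bullet> y) * \<phi> x" for x
      by (subst euclidean_inner[of "g x" y]) (simp add: sum_distrib_left ac_simps)
    then show ?thesis by simp
  qed
  finally show ?thesis .
qed

text \<open>By duality it suffices to test the increment with a test function \<open>\<phi>\<close>. The function
\<open>h s = \<integral> u x \<phi> (x - s y) dx\<close> has derivative \<open>\<integral> (g x \<bullet> y) \<phi> (x - s y) dx\<close>, which is at most
\<open>\<parallel>g \<bullet> y\<parallel> \<parallel>\<phi>\<parallel>\<close> because translations preserve the \<open>L\<^sup>2\<close> norm, and the mean value theorem on \<open>[0, 1]\<close>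
bounds \<open>h 1 - h 0\<close>.\<close>

lemma integral_shift_increment_le:
  fixes u :: "'a::euclidean_space \<Rightarrow> real"
  assumes u: "u \<in> L2 UNIV" and g: "is_weak_gradient u g"
  shows "(\<integral>x. (u (x + y) - u x)\<^sup>2 \<partial>lebesgue) \<le> (\<integral>x. (g x \<bullet> y)\<^sup>2 \<partial>lebesgue)"
proof -
  define C where "C = (\<integral>x. (g x \<bullet> y)\<^sup>2 \<partial>lebesgue)"
  have C0: "0 \<le> C" by (simp add: C_def)
  have "(\<integral>x. (u (x + y) - u x)\<^sup>2 \<partial>lebesgue) \<le> (sqrt C)\<^sup>2"
  proof (rule L2_bound_by_duality)
    show "(\<lambda>x. u (x + y) - u x) \<in> L2 UNIV" by (intro L2_diff L2_shift u)
    show "0 \<le> sqrt C" using C0 by simp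
    fix \<phi> :: "'a \<Rightarrow> real" assume \<phi>: "test_function \<phi>"
    define h where "h s = (\<integral>x. u x * \<phi> (x + s *\<^sub>R (- y)) \<partial>lebesgue)" for s :: real
    define h' where "h' s = (\<integral>x. (g x \<bullet> y) * \<phi> (x + s *\<^sub>R (- y)) \<partial>lebesgue)" for s :: real
    note test = test_function_shift[OF \<phi>]
    have deriv: "(h has_real_derivative h' s) (at s)" for s
      unfolding DERIV_def tendsto_at_iff_sequentially comp_def
    proof (intro allI impI)
      fix t :: "nat \<Rightarrow> real" assume "\<forall>i. t i \<in> UNIV - {0}" and t: "t \<longlonglongrightarrow> 0"
      then have t0: "t i \<noteq> 0" for i by auto
      define \<psi> where "\<psi> x = \<phi> (x + s *\<^sub>R (- y))" for x
      have \<psi>: "test_function \<psi>" unfolding \<psi>_def by (rule test)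
      have 1: "(\<integral>x. u x * ((\<psi> (x + t i *\<^sub>R (- y)) - \<psi> x) / t i) \<partial>lebesgue) = (h (s + t i) - h s) / t i" for i
      proof -
        have eq: "\<psi> (x + t i *\<^sub>R (- y)) = \<phi> (x + (s + t i) *\<^sub>R (- y))" for x
          by (simp add: \<psi>_def algebra_simps)
        have i: "integrable lebesgue (\<lambda>x. u x * \<phi> (x + r *\<^sub>R (- y)))" for r
          by (intro L2_mult_integrable u test_function_L2 test)
        have "(\<integral>x. u x * ((\<psi> (x + t i *\<^sub>R (- y)) - \<psi> x) / t i) \<partial>lebesgue)
            = (\<integral>x. (u x * \<phi> (x + (s + t i) *\<^sub>R (- y)) - u x * \<phi> (x + s *\<^sub>R (- y))) / t i \<partial>lebesgue)"
          unfolding eq unfolding \<psi>_def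
          by (intro Bochner_Integration.integral_cong refl) (simp add: right_diff_distrib)
        also have "\<dots> = (h (s + t i) - h s) / t i"
          unfolding h_def by (subst integral_divide_zero, subst Bochner_Integration.integral_diff[OF i i]) simp
        finally show ?thesis .
      qed
      have 2: "(\<integral>x. u x * frechet_derivative \<psi> (at x) (- y) \<partial>lebesgue) = h' s"
        unfolding weak_gradient_direction[OF u g \<psi>] h'_def \<psi>_def by simp
      show "(\<lambda>i. (h (s + t i) - h s) / t i) \<longlonglongrightarrow> h' s"
        using integral_difference_quotient_tendsto[OF u \<psi> t t0, of "- y"] unfolding 1 2 .
    qed
    obtain z where z: "h 1 - h 0 = (1 - 0) * h' z"
      using MVT2[of 0 1 h h'] deriv by auto
    have "h 1 = (\<integral>x. u (x + y) * \<phi> x \<partial>lebesgue)"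
    proof -
      have "(\<lambda>x. u x * \<phi> (x + 1 *\<^sub>R (- y))) \<in> borel_measurable lebesgue"
        by (intro borel_measurable_times L2_measurable[OF u] L2_measurable[OF test_function_L2[OF test]])
      from integral_shift[OF this, of y] show ?thesis
        by (simp add: h_def)
    qed
    moreover have "(\<integral>x. (u (x + y) - u x) * \<phi> x \<partial>lebesgue)
        = (\<integral>x. u (x + y) * \<phi> x \<partial>lebesgue) - (\<integral>x. u x * \<phi> x \<partial>lebesgue)"
      using L2_mult_integrable[OF L2_shift[OF u] test_function_L2[OF \<phi>], of y]
        L2_mult_integrable[OF u test_function_L2[OF \<phi>]] by (simp add: left_diff_distrib)
    ultimately have "(\<integral>x. (u (x + y) - u x) * \<phi> x \<partial>lebesgue) = h' z"
      using z by (simp add: h_def)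
    moreover have "\<bar>h' z\<bar> \<le> sqrt C * sqrt (\<integral>x. (\<phi> x)\<^sup>2 \<partial>lebesgue)"
    proof -
      have "(h' z)\<^sup>2 \<le> C * (\<integral>x. (\<phi> (x + z *\<^sub>R (- y)))\<^sup>2 \<partial>lebesgue)"
        unfolding h'_def C_def
        by (intro L2_Cauchy_Schwarz weak_gradient_inner_L2[OF g] test_function_L2 test)
      also have "(\<integral>x. (\<phi> (x + z *\<^sub>R (- y)))\<^sup>2 \<partial>lebesgue) = (\<integral>x. (\<phi> x)\<^sup>2 \<partial>lebesgue)"
        by (rule integral_shift[of "\<lambda>x. (\<phi> x)\<^sup>2"])
          (intro borel_measurable_power L2_measurable test_function_L2 \<phi>)
      finally show ?thesis
        using real_sqrt_le_mono by (fastforce simp: real_sqrt_mult)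
    qed
    ultimately show "\<bar>\<integral>x. (u (x + y) - u x) * \<phi> x \<partial>lebesgue\<bar> \<le> sqrt C * sqrt (\<integral>x. (\<phi> x)\<^sup>2 \<partial>lebesgue)"
      by simp
  qed
  then show ?thesis using C0 by (simp add: C_def)
qed

text \<open>The dyadic difference quotients are bounded in \<open>L\<^sup>2\<close> and, tested with \<open>\<phi>\<close>, converge to \<open>- \<integral> u \<partial>\<^sub>b \<phi>\<close>.
Strongly convergent midpoints of them inherit this limit, so their \<open>L\<^sup>2\<close> limit is a weak derivative.\<close>

lemma weak_partial_derivative_exists:
  fixes u :: "'a::euclidean_space \<Rightarrow> real"
  assumes u: "u \<in> L2 UNIV"
    and bound: "\<And>k. 4^k * (\<integral>x. (u (x + (1/2)^k *\<^sub>R b) - u x)\<^sup>2 \<partial>lebesgue) \<le> C"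
  obtains h where "h \<in> L2 UNIV" "(\<integral>x. (h x)\<^sup>2 \<partial>lebesgue) \<le> C"
    "\<And>\<phi>. test_function \<phi> \<Longrightarrow>
      (\<integral>x. u x * frechet_derivative \<phi> (at x) b \<partial>lebesgue) = - (\<integral>x. h x * \<phi> x \<partial>lebesgue)"
proof -
  define a where "a k x = 2^k * (u (x + (1/2)^k *\<^sub>R b) - u x)" for k x
  have a_L2: "a k \<in> L2 UNIV" for k
    unfolding a_def by (intro L2_cmult L2_diff L2_shift u)
  have a_bound: "(\<integral>x. (a k x)\<^sup>2 \<partial>lebesgue) \<le> C" for k
  proof -
    have sq: "((2::real)^k)\<^sup>2 = 4^k"
      by (simp add: power2_eq_square power_mult_distrib[symmetric])
    have "(\<integral>x. (a k x)\<^sup>2 \<partial>lebesgue) = 4^k * (\<integral>x. (u (x + (1/2)^k *\<^sub>R b) - u x)\<^sup>2 \<partial>lebesgue)"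
      by (simp add: a_def power_mult_distrib sq)
    then show ?thesis using bound[of k] by simp
  qed
  have nonneg: "0 \<le> (\<integral>x. (f x)\<^sup>2 \<partial>lebesgue)" for f :: "'a \<Rightarrow> real" by simp
  obtain y where y: "\<And>n. y n \<in> midpoint_hull (a ` {n..})" "\<And>n. y n \<in> L2 UNIV"
    "\<And>n. (\<integral>x. (y n x)\<^sup>2 \<partial>lebesgue) \<le> C + 1 / Suc n"
    "\<And>\<epsilon>. 0 < \<epsilon> \<Longrightarrow> \<exists>N. \<forall>m\<ge>N. \<forall>n\<ge>N. (\<integral>x. (y m x - y n x)\<^sup>2 \<partial>lebesgue) < \<epsilon>"
    using forward_midpoints_Cauchy[of "\<lambda>f. \<integral>x. (f x)\<^sup>2 \<partial>lebesgue" a "L2 UNIV" C,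
        OF nonneg a_L2 midpoint_closed_L2 integral_square_parallelogram a_bound] by blast
  obtain h where h: "h \<in> L2 UNIV" "(\<lambda>n. \<integral>x. (y n x - h x)\<^sup>2 \<partial>lebesgue) \<longlonglongrightarrow> 0"
    using L2_complete[OF y(2) y(4)] by blast
  have "(\<integral>x. (h x)\<^sup>2 \<partial>lebesgue) \<le> C + 0"
  proof (rule LIMSEQ_le)
    show "(\<lambda>n. \<integral>x. (y n x)\<^sup>2 \<partial>lebesgue) \<longlonglongrightarrow> (\<integral>x. (h x)\<^sup>2 \<partial>lebesgue)"
      by (rule L2_integral_square_tendsto[OF y(2) h])
    show "(\<lambda>n. C + 1 / Suc n) \<longlonglongrightarrow> C + 0"
      by (intro tendsto_intros LIMSEQ_inverse_real_of_nat[unfolded inverse_eq_divide])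
  qed (use y(3) in auto)
  moreover have "(\<integral>x. u x * frechet_derivative \<phi> (at x) b \<partial>lebesgue) = - (\<integral>x. h x * \<phi> x \<partial>lebesgue)"
    if \<phi>: "test_function \<phi>" for \<phi>
  proof -
    note \<phi>_L2 = test_function_L2[OF \<phi>]
    define l where "l = - (\<integral>x. u x * frechet_derivative \<phi> (at x) b \<partial>lebesgue)"
    have "(\<integral>x. a k x * \<phi> x \<partial>lebesgue) = - (\<integral>x. u x * ((\<phi> (x + (- ((1/2)^k)) *\<^sub>R b) - \<phi> x) / (- ((1/2)^k))) \<partial>lebesgue)" for k
    proof -
      let ?t = "(1/2)^k :: real"
      have m: "(\<lambda>x. u x * \<phi> (x + (- ?t) *\<^sub>R b)) \<in> borel_measurable lebesgue"
        by (intro borel_measurable_times L2_measurable[OF u] L2_measurable[OF L2_shift[OF \<phi>_L2]])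
      have "(\<integral>x. a k x * \<phi> x \<partial>lebesgue) = 2^k * (\<integral>x. u (x + ?t *\<^sub>R b) * \<phi> x - u x * \<phi> x \<partial>lebesgue)"
        by (simp add: a_def left_diff_distrib mult.assoc)
      also have "\<dots> = 2^k * ((\<integral>x. u (x + ?t *\<^sub>R b) * \<phi> x \<partial>lebesgue) - (\<integral>x. u x * \<phi> x \<partial>lebesgue))"
        by (subst Bochner_Integration.integral_diff) (intro L2_mult_integrable L2_shift u \<phi>_L2 refl)+
      also have "(\<integral>x. u (x + ?t *\<^sub>R b) * \<phi> x \<partial>lebesgue) = (\<integral>x. u x * \<phi> (x + (- ?t) *\<^sub>R b) \<partial>lebesgue)"
        using integral_shift[OF m, of "?t *\<^sub>R b"] by simp
      also have "2^k * ((\<integral>x. u x * \<phi> (x + (- ?t) *\<^sub>R b) \<partial>lebesgue) - (\<integral>x. u x * \<phi> x \<partial>lebesgue))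
          = 2^k * (\<integral>x. u x * \<phi> (x + (- ?t) *\<^sub>R b) - u x * \<phi> x \<partial>lebesgue)"
        by (subst Bochner_Integration.integral_diff) (intro L2_mult_integrable L2_shift u \<phi>_L2 refl)+
      also have "\<dots> = (\<integral>x. - (u x * ((\<phi> (x + (- ?t) *\<^sub>R b) - \<phi> x) / (- ?t))) \<partial>lebesgue)"
        by (subst integral_mult_right_zero[symmetric], intro Bochner_Integration.integral_cong refl)
          (simp add: power_one_over field_simps)
      finally show ?thesis by simp
    qed
    moreover have "(\<lambda>k. - (\<integral>x. u x * ((\<phi> (x + (- ((1/2)^k)) *\<^sub>R b) - \<phi> x) / (- ((1/2)^k))) \<partial>lebesgue)) \<longlonglongrightarrow> l"
    proof -
      have "(\<lambda>k. (1/2::real)^k) \<longlonglongrightarrow> 0" by (rule LIMSEQ_power_zero) simp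
      from tendsto_minus[OF this] have "(\<lambda>k. - ((1/2::real)^k)) \<longlonglongrightarrow> 0" by simp
      from tendsto_minus[OF integral_difference_quotient_tendsto[OF u \<phi> this, of b]]
      show ?thesis by (simp add: l_def)
    qed
    ultimately have lim: "(\<lambda>k. \<integral>x. a k x * \<phi> x \<partial>lebesgue) \<longlonglongrightarrow> l" by simp
    have "(\<lambda>n. \<integral>x. y n x * \<phi> x \<partial>lebesgue) \<longlonglongrightarrow> l"
    proof (rule LIMSEQ_I)
      fix r :: real assume "0 < r"
      then obtain N where N: "\<And>k. k \<ge> N \<Longrightarrow> \<bar>(\<integral>x. a k x * \<phi> x \<partial>lebesgue) - l\<bar> < r"
        using LIMSEQ_D[OF lim \<open>0 < r\<close>] by auto
      define S where "S = {f \<in> L2 UNIV. \<bar>(\<integral>x. f x * \<phi> x \<partial>lebesgue) - l\<bar> < r}"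
      have "midpoint_closed S"
      proof (unfold midpoint_closed_def, intro ballI)
        fix f g assume fg: "f \<in> S" "g \<in> S"
        then have L2: "f \<in> L2 UNIV" "g \<in> L2 UNIV" by (auto simp: S_def)
        have "(\<integral>x. (f x + g x) / 2 * \<phi> x \<partial>lebesgue) = (\<integral>x. (f x * \<phi> x + g x * \<phi> x) / 2 \<partial>lebesgue)"
          by (simp add: distrib_right)
        also have "\<dots> = ((\<integral>x. f x * \<phi> x \<partial>lebesgue) + (\<integral>x. g x * \<phi> x \<partial>lebesgue)) / 2"
          using L2_mult_integrable[OF L2(1) \<phi>_L2] L2_mult_integrable[OF L2(2) \<phi>_L2] by simp
        finally have eq: "(\<integral>x. (f x + g x) / 2 * \<phi> x \<partial>lebesgue) = \<dots>" .
        have "\<bar>(a + b) / 2 - l\<bar> < r" if "\<bar>a - l\<bar> < r" "\<bar>b - l\<bar> < r" for a b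
          using that unfolding abs_less_iff by argo
        then show "(\<lambda>x. (f x + g x) / 2) \<in> S"
          using fg L2_midpoint[OF L2] unfolding S_def mem_Collect_eq eq by blast
      qed
      moreover have "a ` {N..} \<subseteq> S"
        using N a_L2 by (auto simp: S_def)
      ultimately have "midpoint_hull (a ` {N..}) \<subseteq> S"
        by (intro midpoint_hull_minimal)
      moreover have "y n \<in> midpoint_hull (a ` {N..})" if "n \<ge> N" for n
      proof -
        have "a ` {n..} \<subseteq> a ` {N..}" using that by (intro image_mono) auto
        then show ?thesis using y(1)[of n] midpoint_hull_mono by blast
      qed
      ultimately have "norm ((\<integral>x. y n x * \<phi> x \<partial>lebesgue) - l) < r" if "n \<ge> N" for n
        using that by (auto simp: S_def)
      then show "\<exists>no. \<forall>n\<ge>no. norm ((\<integral>x. y n x * \<phi> x \<partial>lebesgue) - l) < r" by blast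
    qed
    moreover have "(\<lambda>n. \<integral>x. y n x * \<phi> x \<partial>lebesgue) \<longlonglongrightarrow> (\<integral>x. h x * \<phi> x \<partial>lebesgue)"
      by (rule L2_integral_mult_tendsto[OF y(2) h(1) \<phi>_L2 h(2)])
    ultimately have "l = (\<integral>x. h x * \<phi> x \<partial>lebesgue)" by (rule LIMSEQ_unique)
    then show ?thesis by (simp add: l_def)
  qed
  ultimately show thesis using that h(1) by simp
qed

section \<open>The Dirichlet integral as a limit of difference quotients\<close>

text \<open>Dyadic steps are used because halving the step can only increase the quotient, so that the
supremum over \<open>k\<close> is a limit and additive identities such as the parallelogram law pass to it.\<close>

definition quotient_energy :: "nat \<Rightarrow> ('a::euclidean_space \<Rightarrow> real) \<Rightarrow> ennreal" where
  "quotient_energy k u = (\<Sum>b\<in>Basis. ennreal (4^k) * sq_norm (\<lambda>x. u (x + (1/2)^k *\<^sub>R b) - u x))"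

definition energy :: "('a::euclidean_space \<Rightarrow> real) \<Rightarrow> ennreal" where
  "energy u = (SUP k. quotient_energy k u)"

text \<open>The increment over \<open>2 h\<close> is the sum of two translates of the increment over \<open>h\<close>, so its squared norm
is at most four times as large.\<close>

lemma incseq_partial_quotient:
  fixes u :: "'a::euclidean_space \<Rightarrow> real"
  assumes [measurable]: "u \<in> borel_measurable lebesgue"
  shows "incseq (\<lambda>k. ennreal (4^k) * sq_norm (\<lambda>x. u (x + (1/2)^k *\<^sub>R b) - u x))"
proof (rule incseq_SucI)
  fix k
  define h :: 'a where "h = (1/2)^Suc k *\<^sub>R b"
  define v where "v x = u (x + h) - u x" for x
  have vm: "v \<in> borel_measurable lebesgue"
    unfolding v_def by (intro borel_measurable_diff measurable_shift_comp[OF assms] assms)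
  have hh: "(1/2)^k *\<^sub>R b = h + h"
    by (simp add: h_def scaleR_left_distrib[symmetric])
  have "sq_norm (\<lambda>x. u (x + (1/2)^k *\<^sub>R b) - u x) = sq_norm (\<lambda>x. v (x + h) + v x)"
    by (simp add: v_def hh add.assoc)
  also have "\<dots> \<le> 2 * sq_norm (\<lambda>x. v (x + h)) + 2 * sq_norm v"
    by (intro sq_norm_add_le measurable_shift_comp[OF vm] vm)
  also have "\<dots> = 4 * sq_norm v"
    by (simp add: sq_norm_shift[OF vm] distrib_right[symmetric])
  finally have "ennreal (4^k) * sq_norm (\<lambda>x. u (x + (1/2)^k *\<^sub>R b) - u x) \<le> ennreal (4^k) * (4 * sq_norm v)"
    by (rule mult_left_mono) simp
  also have "\<dots> = ennreal (4^Suc k) * sq_norm v"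
  proof -
    have "ennreal (4^Suc k) = ennreal (4^k) * 4"
      by (simp add: ennreal_mult mult.commute)
    then show ?thesis by (simp add: mult.assoc)
  qed
  finally show "ennreal (4^k) * sq_norm (\<lambda>x. u (x + (1/2)^k *\<^sub>R b) - u x)
      \<le> ennreal (4^Suc k) * sq_norm (\<lambda>x. u (x + (1/2)^Suc k *\<^sub>R b) - u x)"
    by (simp add: v_def[abs_def] h_def)
qed

lemma energy_eq_sum:
  fixes u :: "'a::euclidean_space \<Rightarrow> real"
  assumes "u \<in> borel_measurable lebesgue"
  shows "energy u = (\<Sum>b\<in>Basis. SUP k. ennreal (4^k) * sq_norm (\<lambda>x. u (x + (1/2)^k *\<^sub>R b) - u x))"
  unfolding energy_def quotient_energy_def
  by (intro ennreal_SUP_sum incseq_partial_quotient assms)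

lemma incseq_quotient_energy:
  fixes u :: "'a::euclidean_space \<Rightarrow> real"
  assumes "u \<in> borel_measurable lebesgue"
  shows "incseq (\<lambda>k. quotient_energy k u)"
  using incseq_partial_quotient[OF assms] unfolding quotient_energy_def incseq_def
  by (intro allI impI sum_mono) blast

lemma nn_integral_norm_square_eq:
  fixes g :: "'a::euclidean_space \<Rightarrow> 'a"
  assumes [measurable]: "g \<in> borel_measurable lebesgue"
  shows "(\<integral>\<^sup>+x. ennreal ((norm (g x))\<^sup>2) \<partial>lebesgue) = (\<Sum>b\<in>Basis. sq_norm (\<lambda>x. g x \<bullet> b))"
proof -
  have "ennreal ((norm (g x))\<^sup>2) = (\<Sum>b\<in>Basis. ennreal ((g x \<bullet> b)\<^sup>2))" for x
    by (subst sum_ennreal) (auto simp: norm_eq_sqrt_inner euclidean_inner[of "g x" "g x"] power2_eq_square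
        sum_nonneg)
  then have "(\<integral>\<^sup>+x. ennreal ((norm (g x))\<^sup>2) \<partial>lebesgue) = (\<integral>\<^sup>+x. (\<Sum>b\<in>Basis. ennreal ((g x \<bullet> b)\<^sup>2)) \<partial>lebesgue)"
    by simp
  also have "\<dots> = (\<Sum>b\<in>Basis. sq_norm (\<lambda>x. g x \<bullet> b))"
    unfolding sq_norm_def by (intro nn_integral_sum) measurable
  finally show ?thesis .
qed

lemma energy_le_weak_gradient:
  fixes u :: "'a::euclidean_space \<Rightarrow> real"
  assumes u: "u \<in> L2 UNIV" and g: "is_weak_gradient u g"
  shows "energy u \<le> (\<integral>\<^sup>+x. ennreal ((norm (g x))\<^sup>2) \<partial>lebesgue)"
proof -
  have [measurable]: "g \<in> borel_measurable lebesgue" using g by (auto simp: is_weak_gradient_def)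
  have le: "sq_norm (\<lambda>x. u (x + y) - u x) \<le> sq_norm (\<lambda>x. g x \<bullet> y)" for y
    using integral_shift_increment_le[OF u g, of y]
      sq_norm_eq_integral[OF weak_gradient_inner_L2[OF g, of y]]
      sq_norm_eq_integral[OF L2_diff[OF L2_shift[OF u] u], of y]
    by (simp add: ennreal_leI)
  have "quotient_energy k u \<le> (\<Sum>b\<in>Basis. sq_norm (\<lambda>x. g x \<bullet> b))" for k
    unfolding quotient_energy_def
  proof (rule sum_mono)
    fix b :: 'a
    have "ennreal (4^k) * sq_norm (\<lambda>x. u (x + (1/2)^k *\<^sub>R b) - u x)
        \<le> ennreal (4^k) * sq_norm (\<lambda>x. g x \<bullet> ((1/2)^k *\<^sub>R b))"
      by (intro mult_left_mono le) simp
    also have "\<dots> = ennreal (4^k) * (ennreal (((1/2)^k)\<^sup>2) * sq_norm (\<lambda>x. g x \<bullet> b))"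
      by (simp only: inner_scaleR_right, subst sq_norm_cmult) simp_all
    also have "\<dots> = sq_norm (\<lambda>x. g x \<bullet> b)"
    proof -
      have "(4::real)^k * ((1/2)^k)\<^sup>2 = (4 * (1/2 * (1/2)))^k"
        by (simp only: power_mult_distrib power2_eq_square)
      then have "ennreal (4^k) * ennreal (((1/2)^k)\<^sup>2) = 1"
        by (subst ennreal_mult[symmetric]) simp_all
      then show ?thesis by (simp add: mult.assoc[symmetric])
    qed
    finally show "ennreal (4^k) * sq_norm (\<lambda>x. u (x + (1/2)^k *\<^sub>R b) - u x) \<le> sq_norm (\<lambda>x. g x \<bullet> b)" .
  qed
  then show ?thesis
    unfolding energy_def nn_integral_norm_square_eq[OF \<open>g \<in> borel_measurable lebesgue\<close>] by (rule SUP_least)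
qed

lemma weak_gradient_exists:
  fixes u :: "'a::euclidean_space \<Rightarrow> real"
  assumes u: "u \<in> L2 UNIV" and fin: "energy u < \<infinity>"
  obtains g where "is_weak_gradient u g" "(\<integral>\<^sup>+x. ennreal ((norm (g x))\<^sup>2) \<partial>lebesgue) \<le> energy u"
proof -
  note meas = L2_measurable[OF u]
  define E where "E b = (SUP k. ennreal (4^k) * sq_norm (\<lambda>x. u (x + (1/2)^k *\<^sub>R b) - u x))" for b :: 'a
  have energy: "energy u = (\<Sum>b\<in>Basis. E b)"
    using energy_eq_sum[OF meas] by (simp add: E_def)
  have E_fin: "E b < \<infinity>" if "b \<in> Basis" for b
    using member_le_sum[of b Basis E] fin that unfolding energy by (auto intro: le_less_trans)
  define P where "P b h \<longleftrightarrow> h \<in> L2 UNIV \<and> sq_norm h \<le> E b \<and> (\<forall>\<phi>. test_function \<phi> \<longrightarrow>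
      (\<integral>x. u x * frechet_derivative \<phi> (at x) b \<partial>lebesgue) = - (\<integral>x. h x * \<phi> x \<partial>lebesgue))" for b h
  have "\<exists>h. P b h" if b: "b \<in> Basis" for b
  proof -
    have "4^k * (\<integral>x. (u (x + (1/2)^k *\<^sub>R b) - u x)\<^sup>2 \<partial>lebesgue) \<le> enn2real (E b)" for k
    proof -
      have "ennreal (4^k * (\<integral>x. (u (x + (1/2)^k *\<^sub>R b) - u x)\<^sup>2 \<partial>lebesgue))
        = ennreal (4^k) * sq_norm (\<lambda>x. u (x + (1/2)^k *\<^sub>R b) - u x)"
        by (subst sq_norm_eq_integral[OF L2_diff[OF L2_shift[OF u] u]]) (simp add: ennreal_mult)
      also have "\<dots> \<le> E b" unfolding E_def by (rule SUP_upper) simp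
      also have "\<dots> = ennreal (enn2real (E b))" using E_fin[OF b] by simp
      finally show ?thesis by (subst (asm) ennreal_le_iff) auto
    qed
    then obtain h where h: "h \<in> L2 UNIV" "(\<integral>x. (h x)\<^sup>2 \<partial>lebesgue) \<le> enn2real (E b)"
      "\<And>\<phi>. test_function \<phi> \<Longrightarrow>
        (\<integral>x. u x * frechet_derivative \<phi> (at x) b \<partial>lebesgue) = - (\<integral>x. h x * \<phi> x \<partial>lebesgue)"
      using weak_partial_derivative_exists[OF u, of b] by blast
    have "sq_norm h \<le> ennreal (enn2real (E b))"
      unfolding sq_norm_eq_integral[OF h(1)] by (rule ennreal_leI[OF h(2)])
    then have "sq_norm h \<le> E b" using E_fin[OF b] by simp
    then show ?thesis using h unfolding P_def by blast
  qed
  then obtain h where "\<And>b. b \<in> Basis \<Longrightarrow> P b (h b)" by metis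
  then have h: "\<And>b. b \<in> Basis \<Longrightarrow> h b \<in> L2 UNIV" "\<And>b. b \<in> Basis \<Longrightarrow> sq_norm (h b) \<le> E b"
    "\<And>b \<phi>. b \<in> Basis \<Longrightarrow> test_function \<phi> \<Longrightarrow>
      (\<integral>x. u x * frechet_derivative \<phi> (at x) b \<partial>lebesgue) = - (\<integral>x. h b x * \<phi> x \<partial>lebesgue)"
    unfolding P_def by blast+
  define g where "g x = (\<Sum>b\<in>Basis. h b x *\<^sub>R b)" for x
  have inner: "g x \<bullet> b = h b x" if "b \<in> Basis" for x b
    using that by (simp add: g_def)
  have g_meas: "g \<in> borel_measurable lebesgue"
    unfolding g_def by (intro borel_measurable_sum borel_measurable_scaleR L2_measurable h borel_measurable_const)
  have le: "(\<integral>\<^sup>+x. ennreal ((norm (g x))\<^sup>2) \<partial>lebesgue) \<le> energy u"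
    unfolding nn_integral_norm_square_eq[OF g_meas] energy
    by (intro sum_mono) (simp add: inner h)
  have "integrable lebesgue (\<lambda>x. (norm (g x))\<^sup>2)"
    using g_meas le fin by (auto simp: integrable_iff_bounded intro: le_less_trans)
  then have "is_weak_gradient u g"
    using g_meas h(3) by (auto simp: is_weak_gradient_def inner)
  then show thesis using that le by blast
qed

lemma weak_gradient_unique:
  fixes u :: "'a::euclidean_space \<Rightarrow> real"
  assumes "is_weak_gradient u g" "is_weak_gradient u g'"
  shows "AE x in lebesgue. g x = g' x"
proof -
  have "AE x in lebesgue. g x \<bullet> b - g' x \<bullet> b = 0" if b: "b \<in> Basis" for b
  proof (rule orthogonal_to_test_functions_imp_AE_0)
    note L2 = assms[THEN weak_gradient_inner_L2, of b]
    show "(\<lambda>x. g x \<bullet> b - g' x \<bullet> b) \<in> L2 UNIV" by (intro L2_diff L2)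
    fix \<phi> :: "'a \<Rightarrow> real" assume \<phi>: "test_function \<phi>"
    have "(\<integral>x. (g x \<bullet> b - g' x \<bullet> b) * \<phi> x \<partial>lebesgue)
        = (\<integral>x. (g x \<bullet> b) * \<phi> x \<partial>lebesgue) - (\<integral>x. (g' x \<bullet> b) * \<phi> x \<partial>lebesgue)"
      using L2_mult_integrable[OF L2(1) test_function_L2[OF \<phi>]] L2_mult_integrable[OF L2(2) test_function_L2[OF \<phi>]]
      by (simp add: left_diff_distrib)
    also have "\<dots> = 0"
      using assms \<phi> b by (auto simp: is_weak_gradient_def)
    finally show "(\<integral>x. (g x \<bullet> b - g' x \<bullet> b) * \<phi> x \<partial>lebesgue) = 0" .
  qed
  then have "AE x in lebesgue. \<forall>b\<in>Basis. g x \<bullet> b - g' x \<bullet> b = 0"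
    by (simp add: AE_finite_all[OF finite_Basis])
  then show ?thesis
    by eventually_elim (auto intro: euclidean_eqI)
qed

text \<open>Together with \<open>dirichlet_eq_energy\<close> this is the bridge from weak gradients to increments: one
inequality is \<open>integral_shift_increment_le\<close>, the other the construction of a weak gradient with norm
at most the energy, and uniqueness of weak gradients makes the two norms agree.\<close>

lemma H1_iff: "u \<in> H1 \<longleftrightarrow> u \<in> L2 UNIV \<and> energy u < \<infinity>"
proof
  assume "u \<in> H1"
  then obtain g where u: "u \<in> L2 UNIV" and g: "is_weak_gradient u g" by (auto simp: H1_def)
  have "(\<integral>\<^sup>+x. ennreal ((norm (g x))\<^sup>2) \<partial>lebesgue) < \<infinity>"
    using g by (auto simp: is_weak_gradient_def integrable_iff_bounded)
  then show "u \<in> L2 UNIV \<and> energy u < \<infinity>"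
    using u energy_le_weak_gradient[OF u g] by (auto intro: le_less_trans)
next
  assume u: "u \<in> L2 UNIV \<and> energy u < \<infinity>"
  then obtain g where "is_weak_gradient u g"
    using weak_gradient_exists[of u] by blast
  then show "u \<in> H1" using u unfolding H1_def by blast
qed

lemma dirichlet_eq_energy:
  assumes "u \<in> H1"
  shows "dirichlet u = energy u"
proof -
  have u: "u \<in> L2 UNIV" "energy u < \<infinity>" using assms by (auto simp: H1_iff)
  obtain g where g: "is_weak_gradient u g" "(\<integral>\<^sup>+x. ennreal ((norm (g x))\<^sup>2) \<partial>lebesgue) \<le> energy u"
    using weak_gradient_exists[OF u] by blast
  have wg: "is_weak_gradient u (weak_gradient u)"
    unfolding weak_gradient_def by (rule someI[of _ g]) (rule g)
  have "dirichlet u = (\<integral>\<^sup>+x. ennreal ((norm (g x))\<^sup>2) \<partial>lebesgue)"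
    unfolding dirichlet_def using weak_gradient_unique[OF wg g(1)]
    by (intro nn_integral_cong_AE) (auto elim: eventually_mono)
  moreover have "energy u \<le> dirichlet u"
    unfolding dirichlet_def by (rule energy_le_weak_gradient[OF u(1) wg])
  ultimately show ?thesis using g(2) by (intro antisym) simp_all
qed

lemma sq_norm_increment_le_energy:
  fixes u :: "'a::euclidean_space \<Rightarrow> real"
  assumes "u \<in> H1"
  shows "sq_norm (\<lambda>x. u (x + y) - u x) \<le> ennreal ((norm y)\<^sup>2) * energy u"
proof -
  have u: "u \<in> L2 UNIV" "energy u < \<infinity>" using assms by (auto simp: H1_iff)
  obtain g where g: "is_weak_gradient u g" "(\<integral>\<^sup>+x. ennreal ((norm (g x))\<^sup>2) \<partial>lebesgue) \<le> energy u"
    using weak_gradient_exists[OF u] by blast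
  have [measurable]: "g \<in> borel_measurable lebesgue" using g by (auto simp: is_weak_gradient_def)
  have "sq_norm (\<lambda>x. u (x + y) - u x) \<le> sq_norm (\<lambda>x. g x \<bullet> y)"
    using integral_shift_increment_le[OF u(1) g(1), of y]
      sq_norm_eq_integral[OF weak_gradient_inner_L2[OF g(1), of y]]
      sq_norm_eq_integral[OF L2_diff[OF L2_shift[OF u(1)] u(1)], of y]
    by (simp add: ennreal_leI)
  also have "\<dots> \<le> (\<integral>\<^sup>+x. ennreal ((norm y)\<^sup>2) * ennreal ((norm (g x))\<^sup>2) \<partial>lebesgue)"
    unfolding sq_norm_def
  proof (rule nn_integral_mono)
    fix x
    have "\<bar>g x \<bullet> y\<bar>\<^sup>2 \<le> (norm (g x) * norm y)\<^sup>2"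
      by (intro power_mono Cauchy_Schwarz_ineq2) auto
    then show "ennreal ((g x \<bullet> y)\<^sup>2) \<le> ennreal ((norm y)\<^sup>2) * ennreal ((norm (g x))\<^sup>2)"
      by (simp add: power_mult_distrib mult.commute ennreal_mult[symmetric] ennreal_leI)
  qed
  also have "\<dots> = ennreal ((norm y)\<^sup>2) * (\<integral>\<^sup>+x. ennreal ((norm (g x))\<^sup>2) \<partial>lebesgue)"
    by (rule nn_integral_cmult) measurable
  also have "\<dots> \<le> ennreal ((norm y)\<^sup>2) * energy u"
    by (intro mult_left_mono g(2)) simp
  finally show ?thesis .
qed

lemma energy_cong_AE:
  fixes u v :: "'a::euclidean_space \<Rightarrow> real"
  assumes "AE x in lebesgue. u x = v x"
  shows "energy u = energy v"
proof -
  have "sq_norm (\<lambda>x. u (x + h) - u x) = sq_norm (\<lambda>x. v (x + h) - v x)" for h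
  proof (rule sq_norm_cong_AE)
    show "AE x in lebesgue. u (x + h) - u x = v (x + h) - v x"
      using assms AE_shift[OF assms, of h] by eventually_elim simp
  qed
  then show ?thesis by (simp add: energy_def quotient_energy_def)
qed

lemma energy_contraction:
  assumes "\<And>x y. \<bar>v x - v y\<bar> \<le> \<bar>u x - u y\<bar>"
  shows "energy v \<le> energy u"
  unfolding energy_def quotient_energy_def
  by (intro SUP_mono' sum_mono mult_left_mono sq_norm_mono assms) simp

lemma energy_cmult:
  fixes u :: "'a::euclidean_space \<Rightarrow> real"
  assumes [measurable]: "u \<in> borel_measurable lebesgue"
  shows "energy (\<lambda>x. c * u x) = ennreal (c\<^sup>2) * energy u"
proof -
  have "sq_norm (\<lambda>x. c * u (x + h) - c * u x) = ennreal (c\<^sup>2) * sq_norm (\<lambda>x. u (x + h) - u x)" for h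
    using sq_norm_cmult[OF borel_measurable_diff[OF measurable_shift_comp[OF assms] assms]]
    by (simp add: right_diff_distrib)
  then have "quotient_energy k (\<lambda>x. c * u x) = ennreal (c\<^sup>2) * quotient_energy k u" for k
    by (simp add: quotient_energy_def sum_distrib_left mult.left_commute)
  then show ?thesis by (simp add: energy_def SUP_mult_left_ennreal)
qed

lemma energy_parallelogram:
  fixes u v :: "'a::euclidean_space \<Rightarrow> real"
  assumes u: "u \<in> borel_measurable lebesgue" and v: "v \<in> borel_measurable lebesgue"
  shows "energy (\<lambda>x. u x + v x) + energy (\<lambda>x. u x - v x) = 2 * energy u + 2 * energy v"
proof -
  have "sq_norm (\<lambda>x. u (x + h) + v (x + h) - (u x + v x)) + sq_norm (\<lambda>x. u (x + h) - v (x + h) - (u x - v x))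
      = 2 * sq_norm (\<lambda>x. u (x + h) - u x) + 2 * sq_norm (\<lambda>x. v (x + h) - v x)" for h
    using sq_norm_parallelogram[of "\<lambda>x. u (x + h) - u x" "\<lambda>x. v (x + h) - v x"]
      borel_measurable_diff[OF measurable_shift_comp[OF u] u, of h] borel_measurable_diff[OF measurable_shift_comp[OF v] v, of h]
    by (simp add: algebra_simps)
  from arg_cong[OF this, of "\<lambda>z. c * z" for c]
  have "c * sq_norm (\<lambda>x. u (x + h) + v (x + h) - (u x + v x)) + c * sq_norm (\<lambda>x. u (x + h) - v (x + h) - (u x - v x))
      = 2 * (c * sq_norm (\<lambda>x. u (x + h) - u x)) + 2 * (c * sq_norm (\<lambda>x. v (x + h) - v x))" for c h
    by (simp only: distrib_left mult.left_commute[of c 2])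
  then have q: "quotient_energy k (\<lambda>x. u x + v x) + quotient_energy k (\<lambda>x. u x - v x)
      = 2 * quotient_energy k u + 2 * quotient_energy k v" for k
    unfolding quotient_energy_def sum_distrib_left sum.distrib[symmetric]
    by (intro sum.cong refl)
  have "energy (\<lambda>x. u x + v x) + energy (\<lambda>x. u x - v x)
      = (SUP k. quotient_energy k (\<lambda>x. u x + v x) + quotient_energy k (\<lambda>x. u x - v x))"
    unfolding energy_def using u v
    by (intro ennreal_SUP_add[symmetric] incseq_quotient_energy borel_measurable_add borel_measurable_diff)
  also have "\<dots> = (SUP k. 2 * quotient_energy k u + 2 * quotient_energy k v)"
    by (simp only: q)
  also have "\<dots> = (SUP k. 2 * quotient_energy k u) + (SUP k. 2 * quotient_energy k v)"
    using incseq_quotient_energy[OF u] incseq_quotient_energy[OF v]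
    by (intro ennreal_SUP_add) (auto simp: incseq_def intro!: mult_left_mono)
  finally show ?thesis by (simp add: energy_def SUP_mult_left_ennreal)
qed

lemma energy_add_le:
  fixes u v :: "'a::euclidean_space \<Rightarrow> real"
  assumes "u \<in> borel_measurable lebesgue" "v \<in> borel_measurable lebesgue"
  shows "energy (\<lambda>x. u x + v x) \<le> 2 * energy u + 2 * energy v"
  using energy_parallelogram[OF assms] by (metis le_iff_add)

text \<open>For a fixed step the quotient is continuous in \<open>L\<^sup>2\<close>, and a supremum of continuous functionals is
lower semicontinuous.\<close>

lemma energy_lower_semicontinuous:
  fixes u :: "'a::euclidean_space \<Rightarrow> real"
  assumes f: "\<And>n. f n \<in> L2 UNIV" and u: "u \<in> L2 UNIV"
    and lim: "(\<lambda>n. \<integral>x. (f n x - u x)\<^sup>2 \<partial>lebesgue) \<longlonglongrightarrow> 0"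
  shows "energy u \<le> liminf (\<lambda>n. energy (f n))"
  unfolding energy_def[of u]
proof (rule SUP_least)
  fix k
  have "(\<lambda>n. sq_norm (\<lambda>x. f n (x + h) - f n x)) \<longlonglongrightarrow> sq_norm (\<lambda>x. u (x + h) - u x)" for h
  proof -
    let ?g = "\<lambda>n x. f n (x + h) - f n x" and ?v = "\<lambda>x. u (x + h) - u x"
    have L2: "?g n \<in> L2 UNIV" "?v \<in> L2 UNIV" for n
      by (intro L2_diff L2_shift f u)+
    have "(\<lambda>n. \<integral>x. (?g n x - ?v x)\<^sup>2 \<partial>lebesgue) \<longlonglongrightarrow> 0"
    proof (rule tendsto_sandwich[OF _ _ tendsto_const])
      show "(\<lambda>n. 4 * (\<integral>x. (f n x - u x)\<^sup>2 \<partial>lebesgue)) \<longlonglongrightarrow> 0"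
        using tendsto_mult[OF tendsto_const lim, of 4] by simp
      have "(\<integral>x. (?g n x - ?v x)\<^sup>2 \<partial>lebesgue) \<le> 4 * (\<integral>x. (f n x - u x)\<^sup>2 \<partial>lebesgue)" for n
      proof -
        let ?d = "\<lambda>x. f n x - u x"
        have d: "?d \<in> L2 UNIV" by (intro L2_diff f u)
        have "(\<integral>x. (?g n x - ?v x)\<^sup>2 \<partial>lebesgue) = (\<integral>x. (?d (x + h) - ?d x)\<^sup>2 \<partial>lebesgue)"
          by (simp add: algebra_simps)
        also have "\<dots> \<le> 2 * (\<integral>x. (?d (x + h))\<^sup>2 \<partial>lebesgue) + 2 * (\<integral>x. (?d x)\<^sup>2 \<partial>lebesgue)"
          using integral_square_parallelogram[OF L2_shift[OF d] d, of h] by simp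
        also have "(\<integral>x. (?d (x + h))\<^sup>2 \<partial>lebesgue) = (\<integral>x. (?d x)\<^sup>2 \<partial>lebesgue)"
          by (rule integral_shift[of "\<lambda>x. (?d x)\<^sup>2"]) (intro borel_measurable_power L2_measurable d)
        finally show ?thesis by simp
      qed
      then show "\<forall>\<^sub>F n in sequentially. (\<integral>x. (?g n x - ?v x)\<^sup>2 \<partial>lebesgue) \<le> 4 * (\<integral>x. (f n x - u x)\<^sup>2 \<partial>lebesgue)"
        by simp
    qed simp
    then have "(\<lambda>n. \<integral>x. (?g n x)\<^sup>2 \<partial>lebesgue) \<longlonglongrightarrow> (\<integral>x. (?v x)\<^sup>2 \<partial>lebesgue)"
      by (rule L2_integral_square_tendsto[OF L2])
    then show ?thesis
      unfolding sq_norm_eq_integral[OF L2(1)] sq_norm_eq_integral[OF L2(2)] by (rule tendsto_ennrealI)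
  qed
  then have "(\<lambda>n. quotient_energy k (f n)) \<longlonglongrightarrow> quotient_energy k u"
    unfolding quotient_energy_def by (intro tendsto_sum ennreal_tendsto_cmult) auto
  then have "quotient_energy k u = liminf (\<lambda>n. quotient_energy k (f n))"
    by (intro lim_imp_Liminf[symmetric]) auto
  also have "\<dots> \<le> liminf (\<lambda>n. energy (f n))"
    by (intro Liminf_mono always_eventually allI) (auto simp: energy_def intro: SUP_upper)
  finally show "quotient_energy k u \<le> liminf (\<lambda>n. energy (f n))" .
qed


section \<open>The Sobolev norm\<close>

definition H1_sq_norm :: "('a::euclidean_space \<Rightarrow> real) \<Rightarrow> ennreal" where
  "H1_sq_norm u = sq_norm u + energy u"

lemma H1_iff_sq_norm: "u \<in> H1 \<longleftrightarrow> u \<in> borel_measurable lebesgue \<and> H1_sq_norm u < \<infinity>"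
  by (auto simp: H1_iff L2_UNIV_iff H1_sq_norm_def)

lemma H1_measurable: "u \<in> H1 \<Longrightarrow> u \<in> borel_measurable lebesgue"
  by (simp add: H1_iff_sq_norm)

lemma H1_L2: "u \<in> H1 \<Longrightarrow> u \<in> L2 UNIV"
  by (simp add: H1_iff)

lemma H1_energy_finite: "u \<in> H1 \<Longrightarrow> energy u < \<infinity>"
  by (simp add: H1_iff)

lemma H1_sq_norm_cong_AE:
  "AE x in lebesgue. u x = v x \<Longrightarrow> H1_sq_norm u = H1_sq_norm v"
  unfolding H1_sq_norm_def by (simp cong: sq_norm_cong_AE energy_cong_AE)

lemma H1_sq_norm_contraction:
  assumes "\<And>x y. \<bar>v x - v y\<bar> \<le> \<bar>u x - u y\<bar>" "\<And>x. \<bar>v x\<bar> \<le> \<bar>u x\<bar>"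
  shows "H1_sq_norm v \<le> H1_sq_norm u"
  unfolding H1_sq_norm_def by (intro add_mono energy_contraction sq_norm_mono assms)

lemma H1_sq_norm_cmult:
  "u \<in> borel_measurable lebesgue \<Longrightarrow> H1_sq_norm (\<lambda>x. c * u x) = ennreal (c\<^sup>2) * H1_sq_norm u"
  by (simp add: H1_sq_norm_def sq_norm_cmult energy_cmult distrib_left)

lemma H1_sq_norm_add_le:
  assumes "u \<in> borel_measurable lebesgue" "v \<in> borel_measurable lebesgue"
  shows "H1_sq_norm (\<lambda>x. u x + v x) \<le> 2 * H1_sq_norm u + 2 * H1_sq_norm v"
proof -
  have "H1_sq_norm (\<lambda>x. u x + v x) \<le> (2 * sq_norm u + 2 * sq_norm v) + (2 * energy u + 2 * energy v)"
    unfolding H1_sq_norm_def by (intro add_mono sq_norm_add_le energy_add_le assms)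
  then show ?thesis by (simp add: H1_sq_norm_def distrib_left ac_simps)
qed

lemma H1_contraction:
  assumes "u \<in> H1" "v \<in> borel_measurable lebesgue"
    "\<And>x y. \<bar>v x - v y\<bar> \<le> \<bar>u x - u y\<bar>" "\<And>x. \<bar>v x\<bar> \<le> \<bar>u x\<bar>"
  shows "v \<in> H1"
proof -
  have "H1_sq_norm v \<le> H1_sq_norm u" by (rule H1_sq_norm_contraction[OF assms(3,4)])
  then show ?thesis using assms(1,2) by (auto simp: H1_iff_sq_norm intro: le_less_trans)
qed

lemma H1_cmult: "u \<in> H1 \<Longrightarrow> (\<lambda>x. c * u x) \<in> H1"
  by (auto simp: H1_iff_sq_norm H1_sq_norm_cmult ennreal_mult_less_top)

lemma H1_add:
  assumes "u \<in> H1" "v \<in> H1"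
  shows "(\<lambda>x. u x + v x) \<in> H1"
proof -
  have "2 * H1_sq_norm u + 2 * H1_sq_norm v < \<infinity>"
    using assms by (simp add: H1_iff_sq_norm ennreal_mult_less_top)
  then show ?thesis
    using assms H1_sq_norm_add_le[of u v] by (auto simp: H1_iff_sq_norm intro: le_less_trans)
qed

lemma H1_diff: "u \<in> H1 \<Longrightarrow> v \<in> H1 \<Longrightarrow> (\<lambda>x. u x - v x) \<in> H1"
  using H1_add[OF _ H1_cmult[of v "-1"]] by simp

lemma H1_midpoint: "u \<in> H1 \<Longrightarrow> v \<in> H1 \<Longrightarrow> (\<lambda>x. (u x + v x) / 2) \<in> H1"
  using H1_cmult[OF H1_add, of u v "1/2"] by simp

lemma H1_cong_AE:
  assumes "u \<in> H1" "v \<in> borel_measurable lebesgue" "AE x in lebesgue. u x = v x"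
  shows "v \<in> H1"
  using assms(1,2) H1_sq_norm_cong_AE[OF assms(3)] by (simp add: H1_iff_sq_norm)

lemma ennreal_tendsto_0I:
  fixes f :: "'b \<Rightarrow> ennreal"
  assumes "\<And>e. 0 < e \<Longrightarrow> eventually (\<lambda>n. f n \<le> ennreal e) F"
  shows "(f \<longlongrightarrow> 0) F"
proof (rule order_tendstoI)
  fix a :: ennreal assume "0 < a"
  then obtain b where b: "0 < b" "b < a" using dense by blast
  then have "b < \<infinity>" by (auto intro: less_le_trans)
  then obtain e where e: "b = ennreal e" "0 < e" using b(1) by (cases b) (auto simp: ennreal_less_zero_iff)
  show "eventually (\<lambda>n. f n < a) F"
    using assms[OF e(2)] by eventually_elim (use b e in auto)
qed simp

lemma liminf_ennreal_le:
  fixes f :: "nat \<Rightarrow> ennreal"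
  assumes "eventually (\<lambda>n. f n \<le> c) sequentially"
  shows "liminf f \<le> c"
  using assms by (intro order_trans[OF Liminf_le_Limsup Limsup_bounded]) auto

lemma H1_energy_parallelogram:
  fixes u v :: "'a::euclidean_space \<Rightarrow> real"
  assumes "u \<in> H1" "v \<in> H1"
  shows "enn2real (energy (\<lambda>x. u x - v x)) = 2 * enn2real (energy u) + 2 * enn2real (energy v)
    - 4 * enn2real (energy (\<lambda>x. (u x + v x) / 2))"
proof -
  note m = assms[THEN H1_measurable]
  have fin: "energy (\<lambda>x. u x + v x) < top" "energy (\<lambda>x. u x - v x) < top" "energy u < top" "energy v < top"
    using assms H1_add H1_diff H1_energy_finite by fastforce+
  have "energy (\<lambda>x. 1/2 * (u x + v x)) = ennreal ((1/2)\<^sup>2) * energy (\<lambda>x. u x + v x)"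
    by (intro energy_cmult borel_measurable_add m)
  then have "enn2real (energy (\<lambda>x. (u x + v x) / 2)) = 1/4 * enn2real (energy (\<lambda>x. u x + v x))"
    by (simp add: enn2real_mult power2_eq_square)
  moreover have "enn2real (energy (\<lambda>x. u x + v x)) + enn2real (energy (\<lambda>x. u x - v x))
      = 2 * enn2real (energy u) + 2 * enn2real (energy v)"
    using arg_cong[OF energy_parallelogram[OF m], of enn2real] fin
    by (simp add: enn2real_plus enn2real_mult ennreal_mult_less_top)
  ultimately show ?thesis by simp
qed

text \<open>A form of Mazur's lemma. The midpoints stay close to \<open>u\<close> in \<open>L\<^sup>2\<close> because balls around \<open>u\<close> are
midpoint-convex. They are Cauchy for the energy, and lower semicontinuity turns the bound on
\<open>energy (y n - y m)\<close> for large \<open>m\<close> into one on \<open>energy (y n - u)\<close>.\<close>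

lemma H1_strong_midpoints:
  fixes u :: "'a::euclidean_space \<Rightarrow> real"
  assumes f: "\<And>n. f n \<in> H1" and bound: "\<And>n. energy (f n) \<le> ennreal C" and u: "u \<in> L2 UNIV"
    and lim: "(\<lambda>n. \<integral>x. (f n x - u x)\<^sup>2 \<partial>lebesgue) \<longlonglongrightarrow> 0"
  obtains y where "\<And>n. y n \<in> midpoint_hull (range f)" "\<And>n. y n \<in> H1" "u \<in> H1"
    "(\<lambda>n. H1_sq_norm (\<lambda>x. y n x - u x)) \<longlonglongrightarrow> 0"
proof -
  have "energy u \<le> liminf (\<lambda>n. energy (f n))"
    using f by (intro energy_lower_semicontinuous u lim H1_L2)
  also have "\<dots> \<le> ennreal C" by (rule liminf_ennreal_le) (simp add: bound)
  finally have uH1: "u \<in> H1" using u by (auto simp: H1_iff intro: le_less_trans)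
  have closed: "midpoint_closed (H1 :: ('a \<Rightarrow> real) set)"
    by (auto simp: midpoint_closed_def intro: H1_midpoint)
  have bound': "enn2real (energy (f n)) \<le> \<bar>C\<bar>" for n
  proof -
    have "enn2real (energy (f n)) \<le> enn2real (ennreal C)"
      by (rule enn2real_mono[OF bound]) simp
    also have "\<dots> \<le> \<bar>C\<bar>" by (cases "0 \<le> C") (auto simp: ennreal_neg)
    finally show ?thesis .
  qed
  obtain y where y: "\<And>n. y n \<in> midpoint_hull (f ` {n..})" "\<And>n. y n \<in> H1"
    "\<And>n. enn2real (energy (y n)) \<le> \<bar>C\<bar> + 1 / Suc n"
    "\<And>\<epsilon>. 0 < \<epsilon> \<Longrightarrow> \<exists>N. \<forall>m\<ge>N. \<forall>n\<ge>N. enn2real (energy (\<lambda>x. y m x - y n x)) < \<epsilon>"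
  proof (rule forward_midpoints_Cauchy[of "\<lambda>f. enn2real (energy f)" f H1 "\<bar>C\<bar>"], goal_cases)
    case (6 y)
    show ?case by (rule 6(1)[OF 6(2-5)])
  qed (rule enn2real_nonneg f closed bound' | rule H1_energy_parallelogram, assumption, assumption)+
  have L2: "y n \<in> L2 UNIV" "f n \<in> L2 UNIV" for n using y(2) f by (auto intro: H1_L2)
  have near: "\<exists>N. \<forall>n\<ge>N. (\<integral>x. (y n x - u x)\<^sup>2 \<partial>lebesgue) \<le> e" if e: "0 < e" for e
  proof -
    obtain N where N: "\<And>n. n \<ge> N \<Longrightarrow> (\<integral>x. (f n x - u x)\<^sup>2 \<partial>lebesgue) < e"
      using LIMSEQ_D[OF lim e] by auto
    define S where "S = {g \<in> L2 UNIV. (\<integral>x. (g x - u x)\<^sup>2 \<partial>lebesgue) \<le> e}"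
    have "midpoint_closed S"
    proof (unfold midpoint_closed_def, intro ballI)
      fix g h assume gh: "g \<in> S" "h \<in> S"
      then have gh_L2: "g \<in> L2 UNIV" "h \<in> L2 UNIV" by (auto simp: S_def)
      let ?I = "\<lambda>w. \<integral>x. (w x)\<^sup>2 \<partial>(lebesgue :: 'a measure)"
      have "4 * ?I (\<lambda>x. ((g x - u x) + (h x - u x)) / 2) \<le> 2 * ?I (\<lambda>x. g x - u x) + 2 * ?I (\<lambda>x. h x - u x)"
      proof -
        have "0 \<le> ?I (\<lambda>x. (g x - u x) - (h x - u x))" by simp
        then show ?thesis
          unfolding integral_square_parallelogram[OF L2_diff[OF gh_L2(1) u] L2_diff[OF gh_L2(2) u]]
            diff_ge_0_iff_ge .
      qed
      moreover have "((g x - u x) + (h x - u x)) / 2 = (g x + h x) / 2 - u x" for x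
        by (simp add: field_simps)
      ultimately have "4 * ?I (\<lambda>x. (g x + h x) / 2 - u x) \<le> 2 * ?I (\<lambda>x. g x - u x) + 2 * ?I (\<lambda>x. h x - u x)"
        by (simp only:)
      moreover have "?I (\<lambda>x. g x - u x) \<le> e" "?I (\<lambda>x. h x - u x) \<le> e" using gh by (auto simp: S_def)
      moreover have "t \<le> e" if "4 * t \<le> 2 * a + 2 * b" "a \<le> e" "b \<le> e" for t a b
        using that by linarith
      ultimately have "?I (\<lambda>x. (g x + h x) / 2 - u x) \<le> e" by blast
      then show "(\<lambda>x. (g x + h x) / 2) \<in> S"
        using L2_midpoint[OF gh_L2] unfolding S_def by blast
    qed
    moreover have "f ` {N..} \<subseteq> S" using N L2 by (auto simp: S_def intro: less_imp_le)
    ultimately have "midpoint_hull (f ` {N..}) \<subseteq> S" by (intro midpoint_hull_minimal)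
    moreover have "y n \<in> midpoint_hull (f ` {N..})" if "n \<ge> N" for n
    proof -
      have "f ` {n..} \<subseteq> f ` {N..}" using that by (intro image_mono) auto
      then show ?thesis using y(1)[of n] midpoint_hull_mono by blast
    qed
    ultimately have "\<forall>n\<ge>N. (\<integral>x. (y n x - u x)\<^sup>2 \<partial>lebesgue) \<le> e" by (auto simp: S_def)
    then show ?thesis by blast
  qed
  have y_lim: "(\<lambda>n. \<integral>x. (y n x - u x)\<^sup>2 \<partial>lebesgue) \<longlonglongrightarrow> 0"
  proof (rule LIMSEQ_I)
    fix r :: real assume "0 < r"
    then obtain N where "\<And>n. n \<ge> N \<Longrightarrow> (\<integral>x. (y n x - u x)\<^sup>2 \<partial>lebesgue) \<le> r / 2"
      using near[of "r/2"] by auto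
    then have "norm ((\<integral>x. (y n x - u x)\<^sup>2 \<partial>lebesgue) - 0) < r" if "n \<ge> N" for n
      using that \<open>0 < r\<close> by (force intro: le_less_trans)
    then show "\<exists>N. \<forall>n\<ge>N. norm ((\<integral>x. (y n x - u x)\<^sup>2 \<partial>lebesgue) - 0) < r" by blast
  qed
  have "(\<lambda>n. sq_norm (\<lambda>x. y n x - u x)) \<longlonglongrightarrow> 0"
    unfolding sq_norm_eq_integral[OF L2_diff[OF L2(1) u]]
    using tendsto_ennrealI[OF y_lim] by simp
  moreover have "(\<lambda>n. energy (\<lambda>x. y n x - u x)) \<longlonglongrightarrow> 0"
  proof (rule ennreal_tendsto_0I)
    fix e :: real assume "0 < e"
    then obtain N where N: "\<And>m n. m \<ge> N \<Longrightarrow> n \<ge> N \<Longrightarrow> enn2real (energy (\<lambda>x. y m x - y n x)) < e"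
      using y(4) by blast
    have "energy (\<lambda>x. y n x - u x) \<le> ennreal e" if n: "n \<ge> N" for n
    proof -
      have "energy (\<lambda>x. y n x - u x) \<le> liminf (\<lambda>m. energy (\<lambda>x. y n x - y m x))"
      proof (rule energy_lower_semicontinuous)
        have "(\<lambda>m. \<integral>x. (y m x - u x)\<^sup>2 \<partial>lebesgue) = (\<lambda>m. \<integral>x. (y n x - y m x - (y n x - u x))\<^sup>2 \<partial>lebesgue)"
          by (simp add: power2_commute)
        then show "(\<lambda>m. \<integral>x. (y n x - y m x - (y n x - u x))\<^sup>2 \<partial>lebesgue) \<longlonglongrightarrow> 0"
          using y_lim by simp
      qed (intro L2_diff L2 u)+
      also have "\<dots> \<le> ennreal e"
      proof (rule liminf_ennreal_le, rule eventually_sequentiallyI)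
        fix m assume m: "N \<le> m"
        have "energy (\<lambda>x. y n x - y m x) < top"
          using H1_energy_finite[OF H1_diff[OF y(2) y(2)]] by simp
        then show "energy (\<lambda>x. y n x - y m x) \<le> ennreal e"
          using N[OF n m] by (cases "energy (\<lambda>x. y n x - y m x)") (auto intro: ennreal_leI)
      qed
      finally show ?thesis .
    qed
    then show "\<forall>\<^sub>F n in sequentially. energy (\<lambda>x. y n x - u x) \<le> ennreal e"
      by (rule eventually_sequentiallyI)
  qed
  ultimately have "(\<lambda>n. H1_sq_norm (\<lambda>x. y n x - u x)) \<longlonglongrightarrow> 0"
    unfolding H1_sq_norm_def using tendsto_add[of _ 0 sequentially _ 0] by simp
  moreover have "y n \<in> midpoint_hull (range f)" for n
    using y(1)[of n] midpoint_hull_mono[of "f ` {n..}" "range f"] by blast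
  ultimately show thesis using that y(2) uH1 by blast
qed

section \<open>Density of continuous functions\<close>

definition ball_average :: "real \<Rightarrow> ('a::euclidean_space \<Rightarrow> real) \<Rightarrow> 'a \<Rightarrow> real" where
  "ball_average r w x = (\<integral>z. w z * indicator (ball x r) z \<partial>lebesgue) / measure lebesgue (ball (0::'a) r)"

lemma indicator_ball_L2: "(indicator (ball x r) :: 'a::euclidean_space \<Rightarrow> real) \<in> L2 UNIV"
  by (intro indicator_L2) (use emeasure_lborel_ball_finite[of x r] in auto)

lemma measure_ball_pos: "0 < r \<Longrightarrow> 0 < measure lebesgue (ball (x::'a::euclidean_space) r)"
  using content_ball_pos[of r x] by simp

lemma measure_ball_shift: "measure lebesgue (ball (x::'a::euclidean_space) r) = measure lebesgue (ball (0::'a) r)"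
  using measure_translation[of x "ball (0::'a) r"] by simp

text \<open>As the centre moves, the indicator functions of the balls converge off the boundary sphere, which
is a null set.\<close>

lemma continuous_ball_average:
  fixes w :: "'a::euclidean_space \<Rightarrow> real"
  assumes w: "w \<in> L2 UNIV"
  shows "continuous_on UNIV (ball_average r w)"
proof -
  have "(\<lambda>n. \<integral>z. w z * indicator (ball (X n) r) z \<partial>lebesgue) \<longlonglongrightarrow> (\<integral>z. w z * indicator (ball x r) z \<partial>lebesgue)"
    if X: "X \<longlonglongrightarrow> x" and M: "\<And>n. norm (X n) \<le> M" for X x M
  proof (rule integral_dominated_convergence)
    show "integrable lebesgue (\<lambda>z. \<bar>w z * indicator (ball 0 (r + M)) z\<bar>)"
      by (intro integrable_abs L2_mult_integrable w indicator_ball_L2)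
    show "(\<lambda>z. w z * indicator (ball y r) z) \<in> borel_measurable lebesgue" for y
      by (intro borel_measurable_times L2_measurable[OF w] L2_measurable[OF indicator_ball_L2])
    then show "(\<lambda>z. w z * indicator (ball (X n) r) z) \<in> borel_measurable lebesgue" for n .
    show "AE z in lebesgue. norm (w z * indicator (ball (X n) r) z) \<le> \<bar>w z * indicator (ball 0 (r + M)) z\<bar>" for n
    proof (rule AE_I2)
      fix z
      have "z \<in> ball 0 (r + M)" if "z \<in> ball (X n) r"
        using that M[of n] norm_triangle_ineq2[of z "X n"] by (simp add: dist_norm norm_minus_commute)
      then show "norm (w z * indicator (ball (X n) r) z) \<le> \<bar>w z * indicator (ball 0 (r + M)) z\<bar>"
        by (cases "z \<in> ball (X n) r") auto
    qed
    have "sphere x r \<in> null_sets lebesgue"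
      using negligible_sphere[of x r] by (simp add: negligible_iff_null_sets)
    then have "AE z in lebesgue. z \<notin> sphere x r" by (rule AE_not_in)
    then show "AE z in lebesgue. (\<lambda>n. w z * indicator (ball (X n) r) z) \<longlonglongrightarrow> w z * indicator (ball x r) z"
    proof eventually_elim
      fix z assume z: "z \<notin> sphere x r"
      have lim: "(\<lambda>n. dist (X n) z) \<longlonglongrightarrow> dist x z" by (intro tendsto_intros X)
      consider "dist x z < r" | "dist x z > r" using z by fastforce
      then have "eventually (\<lambda>n. indicator (ball (X n) r) z = (indicator (ball x r) z :: real)) sequentially"
      proof cases
        case 1
        with order_tendstoD(2)[OF lim 1] show ?thesis by (auto elim!: eventually_mono)
      next
        case 2
        with order_tendstoD(1)[OF lim 2] show ?thesis by (auto elim!: eventually_mono)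
      qed
      then have "(\<lambda>n. indicator (ball (X n) r) z) \<longlonglongrightarrow> (indicator (ball x r) z :: real)"
        by (rule tendsto_eventually)
      then show "(\<lambda>n. w z * indicator (ball (X n) r) z) \<longlonglongrightarrow> w z * indicator (ball x r) z"
        by (intro tendsto_mult tendsto_const)
    qed
  qed
  moreover have "\<exists>M. \<forall>n. norm (X n) \<le> M" if "X \<longlonglongrightarrow> x" for X and x :: 'a
    using convergent_imp_bounded[OF that] by (auto simp: bounded_iff)
  ultimately have lim: "(\<lambda>n. \<integral>z. w z * indicator (ball (X n) r) z \<partial>lebesgue)
      \<longlonglongrightarrow> (\<integral>z. w z * indicator (ball x r) z \<partial>lebesgue)" if "X \<longlonglongrightarrow> x" for X x
    using that by blast
  have "(\<lambda>n. ball_average r w (X n)) \<longlonglongrightarrow> ball_average r w x" if "X \<longlonglongrightarrow> x" for X x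
    unfolding ball_average_def divide_inverse by (intro tendsto_mult tendsto_const lim that)
  then show ?thesis
    by (auto simp: continuous_on_sequentially comp_def)
qed

lemma ball_average_Jensen:
  fixes h :: "'a::euclidean_space \<Rightarrow> real"
  assumes r: "0 < r" and h: "(\<lambda>z. h z * indicator (ball x r) z) \<in> L2 UNIV"
  shows "ennreal ((ball_average r h x)\<^sup>2)
    \<le> ennreal (1 / measure lebesgue (ball (0::'a) r)) * (\<integral>\<^sup>+z. ennreal ((h z)\<^sup>2) * indicator (ball x r) z \<partial>lebesgue)"
proof -
  define m where "m = measure lebesgue (ball (0::'a) r)"
  have m: "0 < m" using measure_ball_pos[OF r] by (simp add: m_def)
  let ?I = "indicator (ball x r) :: 'a \<Rightarrow> real"
  have "(\<integral>z. h z * ?I z \<partial>lebesgue) = (\<integral>z. (h z * ?I z) * ?I z \<partial>lebesgue)"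
    by (intro Bochner_Integration.integral_cong) (auto simp: indicator_def)
  then have "(\<integral>z. h z * ?I z \<partial>lebesgue)\<^sup>2 \<le> (\<integral>z. (h z * ?I z)\<^sup>2 \<partial>lebesgue) * (\<integral>z. (?I z)\<^sup>2 \<partial>lebesgue)"
    using L2_Cauchy_Schwarz[OF h indicator_ball_L2[of x r]] by simp
  also have "(\<integral>z. (?I z)\<^sup>2 \<partial>lebesgue) = (\<integral>z. ?I z \<partial>lebesgue)"
    by (intro Bochner_Integration.integral_cong) (auto simp: indicator_def)
  also have "\<dots> = m"
    using measure_ball_shift[of x r] by (simp add: m_def)
  finally have "(ball_average r h x)\<^sup>2 \<le> 1 / m * (\<integral>z. (h z * ?I z)\<^sup>2 \<partial>lebesgue)"
    using m unfolding ball_average_def m_def[symmetric] by (simp add: power_divide power2_eq_square field_simps)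
  then have "ennreal ((ball_average r h x)\<^sup>2) \<le> ennreal (1 / m * (\<integral>z. (h z * ?I z)\<^sup>2 \<partial>lebesgue))"
    by (rule ennreal_leI)
  also have "\<dots> = ennreal (1 / m) * sq_norm (\<lambda>z. h z * ?I z)"
    unfolding sq_norm_eq_integral[OF h] using m by (intro ennreal_mult) auto
  also have "sq_norm (\<lambda>z. h z * ?I z) = (\<integral>\<^sup>+z. ennreal ((h z)\<^sup>2) * indicator (ball x r) z \<partial>lebesgue)"
    unfolding sq_norm_def by (intro nn_integral_cong) (simp add: indicator_def)
  finally show ?thesis by (simp add: m_def)
qed

lemma L2_mult_indicator_ball:
  fixes w :: "'a::euclidean_space \<Rightarrow> real"
  assumes "w \<in> L2 UNIV"
  shows "(\<lambda>z. w z * indicator (ball x r) z) \<in> L2 UNIV"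
proof -
  have "sq_norm (\<lambda>z. w z * indicator (ball x r) z) \<le> sq_norm w"
    by (rule sq_norm_mono) (simp add: indicator_def)
  then show ?thesis
    using assms L2_measurable[OF indicator_ball_L2[of x r]]
    by (auto simp: L2_UNIV_iff intro: le_less_trans)
qed

lemma emeasure_ball_eq:
  "emeasure lborel (ball (x::'a::euclidean_space) r) = ennreal (measure lebesgue (ball (0::'a) r))"
proof -
  have "emeasure lebesgue (ball x r) = ennreal (measure lebesgue (ball x r))"
    using emeasure_lborel_ball_finite[of x r] by (intro emeasure_eq_ennreal_measure) auto
  then show ?thesis by (simp add: measure_ball_shift[of x])
qed

lemma ball_average_cong_AE:
  fixes v w :: "'a::euclidean_space \<Rightarrow> real"
  assumes "v \<in> L2 UNIV" "w \<in> L2 UNIV" "AE x in lebesgue. v x = w x"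
  shows "ball_average r v = ball_average r w"
proof
  fix x
  have "(\<integral>z. v z * indicator (ball x r) z \<partial>lebesgue) = (\<integral>z. w z * indicator (ball x r) z \<partial>lebesgue)"
    using assms(3) by (intro integral_cong_AE L2_measurable L2_mult_indicator_ball assms) (auto elim: eventually_mono)
  then show "ball_average r v x = ball_average r w x" by (simp add: ball_average_def)
qed

lemma L2_borel_representative:
  assumes "u \<in> L2 UNIV"
  obtains w where "w \<in> borel_measurable borel" "w \<in> L2 UNIV" "AE x in lebesgue. u x = w x"
proof -
  obtain w where w: "w \<in> borel_measurable lborel" "AE x in lborel. u x = w x"
    using completion_ex_borel_measurable_real[OF L2_measurable[OF assms]] by blast
  have ae: "AE x in lebesgue. u x = w x" using w(2) by (rule AE_completion)
  have "w \<in> borel_measurable lebesgue" using w(1) by (rule measurable_completion)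
  then have "w \<in> L2 UNIV"
    using assms sq_norm_cong_AE[OF ae] by (simp add: L2_UNIV_iff)
  then show thesis using that w(1) ae by simp
qed

lemma sq_norm_ball_average_le:
  fixes u :: "'a::euclidean_space \<Rightarrow> real"
  assumes r: "0 < r" and u: "u \<in> L2 UNIV"
  shows "sq_norm (ball_average r u) \<le> sq_norm u"
proof -
  define m where "m = measure lebesgue (ball (0::'a) r)"
  have m: "0 < m" using measure_ball_pos[OF r] by (simp add: m_def)
  obtain w where w [measurable]: "w \<in> borel_measurable borel" and wL2: "w \<in> L2 UNIV"
    and uw: "AE x in lebesgue. u x = w x"
    by (rule L2_borel_representative[OF u])
  have [measurable]: "ball x r \<in> sets borel" for x :: 'a by simp
  have "sq_norm (ball_average r w)
      \<le> (\<integral>\<^sup>+x. ennreal (1 / m) * (\<integral>\<^sup>+z. ennreal ((w z)\<^sup>2) * indicator (ball x r) z \<partial>lebesgue) \<partial>lebesgue)"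
    unfolding sq_norm_def m_def by (intro nn_integral_mono ball_average_Jensen r L2_mult_indicator_ball wL2)
  also have "\<dots> = (\<integral>\<^sup>+x. (\<integral>\<^sup>+z. ennreal (1 / m) * (ennreal ((w z)\<^sup>2) * (if dist x z < r then 1 else 0)) \<partial>lborel) \<partial>lborel)"
  proof -
    have "(\<integral>\<^sup>+z. ennreal (1 / m) * (ennreal ((w z)\<^sup>2) * (if dist x z < r then 1 else 0)) \<partial>lborel)
        = (\<integral>\<^sup>+z. ennreal (1 / m) * (ennreal ((w z)\<^sup>2) * indicator (ball x r) z) \<partial>lborel)" for x
      by (intro nn_integral_cong) (simp add: indicator_def of_bool_def)
    moreover have "(\<integral>\<^sup>+z. ennreal (1 / m) * (ennreal ((w z)\<^sup>2) * indicator (ball x r) z) \<partial>lborel)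
        = ennreal (1 / m) * (\<integral>\<^sup>+z. ennreal ((w z)\<^sup>2) * indicator (ball x r) z \<partial>lborel)" for x
      by (rule nn_integral_cmult) measurable
    ultimately show ?thesis
      by (simp add: nn_integral_completion)
  qed
  also have "\<dots> = (\<integral>\<^sup>+z. (\<integral>\<^sup>+x. ennreal (1 / m) * (ennreal ((w z)\<^sup>2) * (if dist x z < r then 1 else 0)) \<partial>lborel) \<partial>lborel)"
    by (rule lborel_pair.Fubini'[symmetric]) measurable
  also have "\<dots> = (\<integral>\<^sup>+z. (\<integral>\<^sup>+x. (ennreal (1 / m) * ennreal ((w z)\<^sup>2)) * indicator (ball z r) x \<partial>lborel) \<partial>lborel)"
    by (intro nn_integral_cong) (simp add: indicator_def of_bool_def dist_commute mult.assoc)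
  also have "\<dots> = (\<integral>\<^sup>+z. (ennreal (1 / m) * ennreal ((w z)\<^sup>2)) * ennreal m \<partial>lborel)"
    by (simp add: nn_integral_cmult_indicator emeasure_ball_eq m_def)
  also have "\<dots> = (\<integral>\<^sup>+z. ennreal ((w z)\<^sup>2) \<partial>lborel)"
  proof (intro nn_integral_cong)
    fix z
    have "ennreal (1 / m) * ennreal ((w z)\<^sup>2) * ennreal m = (ennreal (1 / m) * ennreal m) * ennreal ((w z)\<^sup>2)"
      by (simp only: ac_simps)
    also have "ennreal (1 / m) * ennreal m = 1"
      using m by (subst ennreal_mult[symmetric]) auto
    finally show "ennreal (1 / m) * ennreal ((w z)\<^sup>2) * ennreal m = ennreal ((w z)\<^sup>2)" by simp
  qed
  also have "\<dots> = sq_norm w" by (simp add: sq_norm_def nn_integral_completion)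
  finally show ?thesis
    using sq_norm_cong_AE[OF uw] ball_average_cong_AE[OF u wL2 uw] by simp
qed

lemma ball_average_shift:
  fixes w :: "'a::euclidean_space \<Rightarrow> real"
  assumes w: "w \<in> L2 UNIV"
  shows "ball_average r w (x + h) = ball_average r (\<lambda>x. w (x + h)) x"
proof -
  have "(\<integral>z. w (z + h) * indicator (ball (x + h) r) (z + h) \<partial>lebesgue) = (\<integral>z. w z * indicator (ball (x + h) r) z \<partial>lebesgue)"
    by (rule integral_shift[of "\<lambda>z. w z * indicator (ball (x + h) r) z"])
      (intro L2_measurable L2_mult_indicator_ball w)
  moreover have "indicator (ball (x + h) r) (z + h) = (indicator (ball x r) z :: real)" for z
    by (simp add: indicator_def dist_norm)
  ultimately show ?thesis by (simp add: ball_average_def)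
qed

lemma ball_average_diff:
  fixes v w :: "'a::euclidean_space \<Rightarrow> real"
  assumes "v \<in> L2 UNIV" "w \<in> L2 UNIV"
  shows "ball_average r (\<lambda>x. v x - w x) x = ball_average r v x - ball_average r w x"
proof -
  have "integrable lebesgue (\<lambda>z. v z * indicator (ball x r) z)" "integrable lebesgue (\<lambda>z. w z * indicator (ball x r) z)"
    by (intro L2_mult_integrable assms indicator_ball_L2)+
  then show ?thesis by (simp add: ball_average_def left_diff_distrib diff_divide_distrib)
qed

lemma energy_ball_average_le:
  fixes w :: "'a::euclidean_space \<Rightarrow> real"
  assumes r: "0 < r" and w: "w \<in> L2 UNIV"
  shows "energy (ball_average r w) \<le> energy w"
proof -
  have "sq_norm (\<lambda>x. ball_average r w (x + h) - ball_average r w x) \<le> sq_norm (\<lambda>x. w (x + h) - w x)" for h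
  proof -
    have "(\<lambda>x. ball_average r w (x + h) - ball_average r w x) = ball_average r (\<lambda>x. w (x + h) - w x)"
      by (simp add: fun_eq_iff ball_average_shift[OF w] ball_average_diff[OF L2_shift[OF w] w])
    then show ?thesis
      using sq_norm_ball_average_le[OF r L2_diff[OF L2_shift[OF w] w], of h] by simp
  qed
  then show ?thesis
    unfolding energy_def quotient_energy_def by (intro SUP_mono' sum_mono mult_left_mono) auto
qed

lemma H1_ball_average:
  fixes w :: "'a::euclidean_space \<Rightarrow> real"
  assumes r: "0 < r" and w: "w \<in> H1"
  shows "ball_average r w \<in> H1"
proof -
  have "H1_sq_norm (ball_average r w) \<le> H1_sq_norm w"
    unfolding H1_sq_norm_def using w H1_L2[OF w]
    by (intro add_mono sq_norm_ball_average_le energy_ball_average_le r)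
  then show ?thesis
    using w continuous_measurable_lebesgue[OF continuous_ball_average[OF H1_L2[OF w]]]
    by (auto simp: H1_iff_sq_norm intro: le_less_trans)
qed

text \<open>By Jensen's inequality and Tonelli's theorem the left side is at most the mean over \<open>\<bar>y\<bar> < r\<close> of the
squared norms of \<open>u (x + y) - u x\<close>, each of which is at most \<open>\<bar>y\<bar>\<^sup>2\<close> times the energy.\<close>

lemma sq_norm_ball_average_diff_le:
  fixes u :: "'a::euclidean_space \<Rightarrow> real"
  assumes r: "0 < r" and u: "u \<in> H1"
  shows "sq_norm (\<lambda>x. ball_average r u x - u x) \<le> ennreal (r\<^sup>2) * energy u"
proof -
  define m where "m = measure lebesgue (ball (0::'a) r)"
  have m: "0 < m" using measure_ball_pos[OF r] by (simp add: m_def)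
  obtain w where w [measurable]: "w \<in> borel_measurable borel" and wL2: "w \<in> L2 UNIV"
    and uw: "AE x in lebesgue. u x = w x"
    by (rule L2_borel_representative[OF H1_L2[OF u]])
  have wH1: "w \<in> H1" by (rule H1_cong_AE[OF u L2_measurable[OF wL2] uw])
  have [measurable]: "ball x r \<in> sets borel" for x :: 'a by simp
  have pointwise: "ennreal ((ball_average r w x - w x)\<^sup>2)
      \<le> ennreal (1 / m) * (\<integral>\<^sup>+y. ennreal ((w (x + y) - w x)\<^sup>2) * indicator (ball 0 r) y \<partial>lebesgue)" for x
  proof -
    have split: "(\<lambda>z. (w z - w x) * indicator (ball x r) z)
        = (\<lambda>z. w z * indicator (ball x r) z - w x * indicator (ball x r) z)"
      by (simp add: left_diff_distrib)
    have L2: "(\<lambda>z. (w z - w x) * indicator (ball x r) z) \<in> L2 UNIV"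
      unfolding split by (intro L2_diff L2_mult_indicator_ball wL2 L2_cmult indicator_ball_L2)
    have "integrable lebesgue (\<lambda>z. w z * indicator (ball x r) z)"
      by (intro L2_mult_integrable wL2 indicator_ball_L2)
    moreover have "integrable lebesgue (indicator (ball x r) :: 'a \<Rightarrow> real)"
      by (intro integrable_real_indicator) (use emeasure_lborel_ball_finite[of x r] in auto)
    ultimately have "ball_average r (\<lambda>z. w z - w x) x = ball_average r w x - w x"
      using m measure_ball_shift[of x r]
      unfolding ball_average_def split m_def[symmetric] by (simp add: diff_divide_distrib)
    then have "ennreal ((ball_average r w x - w x)\<^sup>2)
        \<le> ennreal (1 / m) * (\<integral>\<^sup>+z. ennreal ((w z - w x)\<^sup>2) * indicator (ball x r) z \<partial>lebesgue)"
      using ball_average_Jensen[OF r L2] by (simp add: m_def)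
    also have "(\<integral>\<^sup>+z. ennreal ((w z - w x)\<^sup>2) * indicator (ball x r) z \<partial>lebesgue)
        = (\<integral>\<^sup>+y. ennreal ((w (y + x) - w x)\<^sup>2) * indicator (ball x r) (y + x) \<partial>lebesgue)"
      by (rule nn_integral_shift[symmetric, of "\<lambda>z. ennreal ((w z - w x)\<^sup>2) * indicator (ball x r) z"])
        (rule measurable_completion, simp, measurable)
    also have "\<dots> = (\<integral>\<^sup>+y. ennreal ((w (x + y) - w x)\<^sup>2) * indicator (ball 0 r) y \<partial>lebesgue)"
      by (intro nn_integral_cong) (simp add: indicator_def dist_norm add.commute)
    finally show ?thesis .
  qed
  have "sq_norm (\<lambda>x. ball_average r w x - w x) \<le> (\<integral>\<^sup>+x. ennreal (1 / m) *
      (\<integral>\<^sup>+y. ennreal ((w (x + y) - w x)\<^sup>2) * indicator (ball 0 r) y \<partial>lebesgue) \<partial>lebesgue)"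
    unfolding sq_norm_def by (intro nn_integral_mono pointwise)
  also have "\<dots> = (\<integral>\<^sup>+x. (\<integral>\<^sup>+y. ennreal (1 / m) * (ennreal ((w (x + y) - w x)\<^sup>2) * indicator (ball 0 r) y) \<partial>lborel) \<partial>lborel)"
    by (simp add: nn_integral_completion nn_integral_cmult)
  also have "\<dots> = (\<integral>\<^sup>+y. (\<integral>\<^sup>+x. ennreal (1 / m) * (ennreal ((w (x + y) - w x)\<^sup>2) * indicator (ball 0 r) y) \<partial>lborel) \<partial>lborel)"
    by (rule lborel_pair.Fubini'[symmetric]) measurable
  also have "\<dots> = (\<integral>\<^sup>+y. ennreal (1 / m) * (sq_norm (\<lambda>x. w (x + y) - w x) * indicator (ball 0 r) y) \<partial>lborel)"
    by (simp add: nn_integral_cmult nn_integral_multc sq_norm_def nn_integral_completion)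
  also have "\<dots> \<le> (\<integral>\<^sup>+y. ennreal (1 / m) * (ennreal (r\<^sup>2) * energy w) * indicator (ball (0::'a) r) y \<partial>lborel)"
  proof (rule nn_integral_mono)
    fix y :: 'a
    have "sq_norm (\<lambda>x. w (x + y) - w x) \<le> ennreal (r\<^sup>2) * energy w" if "y \<in> ball 0 r"
    proof -
      have "ennreal ((norm y)\<^sup>2) \<le> ennreal (r\<^sup>2)"
        using that by (intro ennreal_leI power_mono) auto
      then show ?thesis
        using sq_norm_increment_le_energy[OF wH1, of y] by (meson mult_right_mono order_trans zero_le)
    qed
    then show "ennreal (1 / m) * (sq_norm (\<lambda>x. w (x + y) - w x) * indicator (ball 0 r) y)
        \<le> ennreal (1 / m) * (ennreal (r\<^sup>2) * energy w) * indicator (ball 0 r) y"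
      by (cases "y \<in> ball 0 r") (auto intro: mult_left_mono)
  qed
  also have "\<dots> = ennreal (1 / m) * (ennreal (r\<^sup>2) * energy w) * ennreal m"
    by (simp add: nn_integral_cmult_indicator emeasure_ball_eq m_def)
  also have "\<dots> = (ennreal (1 / m) * ennreal m) * (ennreal (r\<^sup>2) * energy w)"
    by (simp only: ac_simps)
  also have "ennreal (1 / m) * ennreal m = 1"
    using m by (subst ennreal_mult[symmetric]) auto
  finally have "sq_norm (\<lambda>x. ball_average r w x - w x) \<le> ennreal (r\<^sup>2) * energy w" by simp
  moreover have "sq_norm (\<lambda>x. ball_average r u x - u x) = sq_norm (\<lambda>x. ball_average r w x - w x)"
    unfolding ball_average_cong_AE[OF H1_L2[OF u] wL2 uw]
    using uw by (intro sq_norm_cong_AE) (auto elim: eventually_mono)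
  ultimately show ?thesis using energy_cong_AE[OF uw] by simp
qed

text \<open>Averages over shrinking balls converge to \<open>u\<close> in \<open>L\<^sup>2\<close> only, but with bounded energy; midpoints of
them are still continuous and converge in \<open>H\<^sup>1\<close>.\<close>

lemma continuous_dense_H1:
  fixes u :: "'a::euclidean_space \<Rightarrow> real"
  assumes u: "u \<in> H1"
  obtains \<phi> where "\<And>n. \<phi> n \<in> H1" "\<And>n. continuous_on UNIV (\<phi> n)" "(\<lambda>n. H1_sq_norm (\<lambda>x. \<phi> n x - u x)) \<longlonglongrightarrow> 0"
proof -
  define f where "f n = ball_average (1 / Suc n) u" for n
  define C where "C = enn2real (energy u)"
  have C: "energy u = ennreal C" "0 \<le> C"
    using H1_energy_finite[OF u] by (auto simp: C_def)
  have f: "f n \<in> H1" for n unfolding f_def by (rule H1_ball_average[OF _ u]) simp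
  have bound: "energy (f n) \<le> ennreal C" for n
    unfolding f_def C(1)[symmetric] by (rule energy_ball_average_le[OF _ H1_L2[OF u]]) simp
  have lim: "(\<lambda>n. \<integral>x. (f n x - u x)\<^sup>2 \<partial>lebesgue) \<longlonglongrightarrow> 0"
  proof (rule tendsto_sandwich[OF _ _ tendsto_const])
    have "(\<integral>x. (f n x - u x)\<^sup>2 \<partial>lebesgue) \<le> (1 / Suc n)\<^sup>2 * C" for n
    proof -
      have "ennreal (\<integral>x. (f n x - u x)\<^sup>2 \<partial>lebesgue) = sq_norm (\<lambda>x. f n x - u x)"
        using sq_norm_eq_integral[OF L2_diff[OF H1_L2[OF f] H1_L2[OF u]]] by simp
      also have "\<dots> \<le> ennreal ((1 / Suc n)\<^sup>2) * ennreal C"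
        unfolding f_def C(1)[symmetric] by (rule sq_norm_ball_average_diff_le[OF _ u]) simp
      finally show ?thesis
        using C(2) by (simp add: ennreal_mult[symmetric] del: of_nat_Suc)
    qed
    then show "\<forall>\<^sub>F n in sequentially. (\<integral>x. (f n x - u x)\<^sup>2 \<partial>lebesgue) \<le> (1 / Suc n)\<^sup>2 * C"
      by simp
    have "(\<lambda>n. (1 / Suc n)\<^sup>2 * C) \<longlonglongrightarrow> 0\<^sup>2 * C"
      by (intro tendsto_intros LIMSEQ_inverse_real_of_nat[unfolded inverse_eq_divide])
    then show "(\<lambda>n. (1 / Suc n)\<^sup>2 * C) \<longlonglongrightarrow> 0" by simp
  qed simp
  obtain y where y: "\<And>n. y n \<in> midpoint_hull (range f)" "\<And>n. y n \<in> H1" "u \<in> H1"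
    "(\<lambda>n. H1_sq_norm (\<lambda>x. y n x - u x)) \<longlonglongrightarrow> 0"
    by (rule H1_strong_midpoints[OF f bound H1_L2[OF u] lim], rule that) blast+
  have "midpoint_hull (range f) \<subseteq> {g. continuous_on UNIV g}"
    by (rule midpoint_hull_minimal)
      (auto simp: midpoint_closed_def f_def intro!: continuous_intros continuous_ball_average H1_L2 u)
  then show thesis using that y by blast
qed


section \<open>Capacity\<close>

lemma cap_le:
  assumes "u \<in> H1" "open U" "E \<subseteq> U" "AE x in lebesgue. x \<in> U \<longrightarrow> 1 \<le> u x"
  shows "cap E \<le> H1_sq_norm u"
proof -
  have "H1_sq_norm u = dirichlet u + (\<integral>\<^sup>+x. ennreal ((u x)\<^sup>2) \<partial>lebesgue)"
    using dirichlet_eq_energy[OF assms(1)] by (simp add: H1_sq_norm_def sq_norm_def add.commute)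
  then show ?thesis
    unfolding cap_def using assms by (intro Inf_lower) blast
qed

text \<open>Clipping to \<open>[0, 1]\<close> is a contraction, hence does not increase the Sobolev norm. Bounded competitors
make pointwise suprema of infinitely many of them meaningful.\<close>

lemma cap_obtain:
  fixes E :: "'a::euclidean_space set"
  assumes "cap E < c"
  obtains u U where "u \<in> H1" "\<And>x. 0 \<le> u x" "\<And>x. u x \<le> 1" "open U" "E \<subseteq> U"
    "AE x in lebesgue. x \<in> U \<longrightarrow> 1 \<le> u x" "H1_sq_norm u < c"
proof -
  obtain w U where w: "w \<in> H1" "open U" "E \<subseteq> U" "AE x in lebesgue. x \<in> U \<longrightarrow> 1 \<le> w x"
    "dirichlet w + (\<integral>\<^sup>+x. ennreal ((w x)\<^sup>2) \<partial>lebesgue) < c"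
    using assms unfolding cap_def Inf_less_iff by blast
  have wc: "H1_sq_norm w < c"
    using w(5) dirichlet_eq_energy[OF w(1)] by (simp add: H1_sq_norm_def sq_norm_def add.commute)
  define u where "u x = max 0 (min 1 (w x))" for x
  have contr: "\<bar>u x - u y\<bar> \<le> \<bar>w x - w y\<bar>" "\<bar>u x\<bar> \<le> \<bar>w x\<bar>" for x y
    by (auto simp: u_def max_def min_def)
  have "u \<in> borel_measurable lebesgue"
    unfolding u_def by (intro borel_measurable_max borel_measurable_min borel_measurable_const H1_measurable w)
  then have "u \<in> H1" by (rule H1_contraction[OF w(1) _ contr])
  moreover have "H1_sq_norm u < c" using H1_sq_norm_contraction[OF contr] wc by (rule le_less_trans)
  moreover have "AE x in lebesgue. x \<in> U \<longrightarrow> 1 \<le> u x"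
    using w(4) by eventually_elim (auto simp: u_def)
  ultimately show thesis using that[of u U] w(2,3) by (auto simp: u_def)
qed

text \<open>The supremum is 1-Lipschitz for the supremum distance of sequences, which is at most the \<open>l\<^sup>2\<close>
distance.\<close>

lemma SUP_diff_square_le_suminf:
  fixes a b :: "nat \<Rightarrow> real"
  assumes a: "\<And>n. 0 \<le> a n" "\<And>n. a n \<le> 1" and b: "\<And>n. 0 \<le> b n" "\<And>n. b n \<le> 1"
  shows "ennreal (((SUP n. a n) - (SUP n. b n))\<^sup>2) \<le> (\<Sum>n. ennreal ((a n - b n)\<^sup>2))"
proof (cases "(\<Sum>n. ennreal ((a n - b n)\<^sup>2))")
  case (real s)
  have bdd: "bdd_above (range a)" "bdd_above (range b)"
    using a b by (auto simp: bdd_above_def)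
  have le: "\<bar>a n - b n\<bar> \<le> sqrt s" for n
  proof -
    have "ennreal ((a n - b n)\<^sup>2) \<le> ennreal s"
      using sum_le_suminf[OF summableI, of "{n}" "\<lambda>n. ennreal ((a n - b n)\<^sup>2)"] real by simp
    then have "(a n - b n)\<^sup>2 \<le> s" using real by simp
    then show ?thesis by (metis real_sqrt_abs real_sqrt_le_mono)
  qed
  have "(SUP n. a n) \<le> (SUP n. b n) + sqrt s"
  proof (rule cSUP_least)
    fix n
    show "a n \<le> (SUP n. b n) + sqrt s"
      using cSUP_upper[OF _ bdd(2), of n] le[of n] by simp
  qed simp
  moreover have "(SUP n. b n) \<le> (SUP n. a n) + sqrt s"
  proof (rule cSUP_least)
    fix n
    show "b n \<le> (SUP n. a n) + sqrt s"
      using cSUP_upper[OF _ bdd(1), of n] le[of n] by simp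
  qed simp
  ultimately have "\<bar>(SUP n. a n) - (SUP n. b n)\<bar> \<le> sqrt s" by linarith
  then have "\<bar>(SUP n. a n) - (SUP n. b n)\<bar>\<^sup>2 \<le> (sqrt s)\<^sup>2" by (rule power_mono) simp
  then show ?thesis using real by (simp add: ennreal_leI)
qed simp

lemma sq_norm_le_suminf:
  fixes g :: "nat \<Rightarrow> 'a::euclidean_space \<Rightarrow> real"
  assumes "\<And>n. g n \<in> borel_measurable lebesgue"
    and "\<And>x. ennreal ((f x)\<^sup>2) \<le> (\<Sum>n. ennreal ((g n x)\<^sup>2))"
  shows "sq_norm f \<le> (\<Sum>n. sq_norm (g n))"
proof -
  note [measurable] = assms(1)
  have "sq_norm f \<le> (\<integral>\<^sup>+x. (\<Sum>n. ennreal ((g n x)\<^sup>2)) \<partial>lebesgue)"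
    unfolding sq_norm_def by (intro nn_integral_mono assms(2))
  also have "\<dots> = (\<Sum>n. sq_norm (g n))"
    unfolding sq_norm_def by (rule nn_integral_suminf) measurable
  finally show ?thesis .
qed

lemma H1_sq_norm_le_suminf:
  fixes g :: "nat \<Rightarrow> 'a::euclidean_space \<Rightarrow> real"
  assumes g: "\<And>n. g n \<in> borel_measurable lebesgue"
    and val: "\<And>x. ennreal ((f x)\<^sup>2) \<le> (\<Sum>n. ennreal ((g n x)\<^sup>2))"
    and diff: "\<And>x y. ennreal ((f x - f y)\<^sup>2) \<le> (\<Sum>n. ennreal ((g n x - g n y)\<^sup>2))"
  shows "H1_sq_norm f \<le> (\<Sum>n. H1_sq_norm (g n))"
proof -
  have "quotient_energy k f \<le> (\<Sum>n. energy (g n))" for k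
  proof -
    have "quotient_energy k f \<le> (\<Sum>b\<in>Basis. ennreal (4^k) * (\<Sum>n. sq_norm (\<lambda>x. g n (x + (1/2)^k *\<^sub>R b) - g n x)))"
      unfolding quotient_energy_def
      by (intro sum_mono mult_left_mono sq_norm_le_suminf diff borel_measurable_diff measurable_shift_comp[OF g] g) simp
    also have "\<dots> = (\<Sum>n. quotient_energy k (g n))"
      unfolding quotient_energy_def by (simp add: ennreal_suminf_cmult suminf_sum[OF summableI])
    also have "\<dots> \<le> (\<Sum>n. energy (g n))"
      by (intro suminf_le summableI) (auto simp: energy_def intro: SUP_upper)
    finally show ?thesis .
  qed
  then have "energy f \<le> (\<Sum>n. energy (g n))"
    unfolding energy_def[of f] by (rule SUP_least)
  moreover have "sq_norm f \<le> (\<Sum>n. sq_norm (g n))"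
    by (rule sq_norm_le_suminf[OF g val])
  ultimately have "H1_sq_norm f \<le> (\<Sum>n. sq_norm (g n)) + (\<Sum>n. energy (g n))"
    unfolding H1_sq_norm_def by (rule add_mono[rotated])
  also have "\<dots> = (\<Sum>n. H1_sq_norm (g n))"
    unfolding H1_sq_norm_def by (rule suminf_add[OF summableI summableI])
  finally show ?thesis .
qed

lemma H1_sq_norm_zero [simp]: "H1_sq_norm (\<lambda>x. 0) = 0"
  by (simp add: H1_sq_norm_def energy_def quotient_energy_def)

lemma suminf_two:
  fixes f :: "nat \<Rightarrow> ennreal"
  assumes "\<And>n. 2 \<le> n \<Longrightarrow> f n = 0"
  shows "suminf f = f 0 + f 1"
proof -
  have "suminf f = sum f {0, 1}"
  proof (rule suminf_finite)
    fix n :: nat assume "n \<notin> {0, 1}"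
    then have "2 \<le> n" by auto
    then show "f n = 0" by (rule assms)
  qed simp
  then show ?thesis by simp
qed

lemma H1_sq_norm_max_le:
  fixes u v :: "'a::euclidean_space \<Rightarrow> real"
  assumes u: "u \<in> borel_measurable lebesgue" and v: "v \<in> borel_measurable lebesgue"
  shows "H1_sq_norm (\<lambda>x. max (u x) (v x)) \<le> H1_sq_norm u + H1_sq_norm v"
proof -
  define g where "g n = (if n = 0 then u else if n = 1 then v else (\<lambda>x. 0))" for n :: nat
  have g2: "g n = (\<lambda>x. 0)" if "2 \<le> n" for n using that by (simp add: g_def)
  have g01: "g 0 = u" "g 1 = v" by (auto simp: g_def)
  have max_sq: "(max a b - max c d)\<^sup>2 \<le> (a - c)\<^sup>2 + (b - d)\<^sup>2" for a b c d :: real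
  proof -
    have "\<bar>max a b - max c d\<bar> \<le> max \<bar>a - c\<bar> \<bar>b - d\<bar>" by (auto simp: max_def)
    then have "\<bar>max a b - max c d\<bar>\<^sup>2 \<le> (max \<bar>a - c\<bar> \<bar>b - d\<bar>)\<^sup>2" by (rule power_mono) simp
    also have "\<dots> \<le> (a - c)\<^sup>2 + (b - d)\<^sup>2" by (simp add: max_def)
    finally show ?thesis by simp
  qed
  have two: "(\<Sum>n. ennreal ((h n)\<^sup>2)) = ennreal ((h 0)\<^sup>2 + (h 1)\<^sup>2)" if "\<And>n. 2 \<le> n \<Longrightarrow> h n = 0" for h :: "nat \<Rightarrow> real"
    using that by (subst suminf_two) auto
  have "H1_sq_norm (\<lambda>x. max (u x) (v x)) \<le> (\<Sum>n. H1_sq_norm (g n))"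
  proof (rule H1_sq_norm_le_suminf)
    show "g n \<in> borel_measurable lebesgue" for n using u v by (simp add: g_def)
    show "ennreal ((max (u x) (v x))\<^sup>2) \<le> (\<Sum>n. ennreal ((g n x)\<^sup>2))" for x
    proof (subst two)
      show "ennreal ((max (u x) (v x))\<^sup>2) \<le> ennreal ((g 0 x)\<^sup>2 + (g 1 x)\<^sup>2)"
        unfolding g01 using max_sq[of "u x" "v x" 0 0] by (intro ennreal_leI) simp
    qed (simp add: g2)
    show "ennreal ((max (u x) (v x) - max (u y) (v y))\<^sup>2) \<le> (\<Sum>n. ennreal ((g n x - g n y)\<^sup>2))" for x y
    proof (subst two)
      show "ennreal ((max (u x) (v x) - max (u y) (v y))\<^sup>2) \<le> ennreal ((g 0 x - g 0 y)\<^sup>2 + (g 1 x - g 1 y)\<^sup>2)"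
        unfolding g01 by (intro ennreal_leI max_sq)
    qed (simp add: g2)
  qed
  also have "\<dots> = H1_sq_norm (g 0) + H1_sq_norm (g 1)"
    by (rule suminf_two) (simp add: g2)
  finally show ?thesis unfolding g01 .
qed

lemma cap_mono: "E \<subseteq> F \<Longrightarrow> cap E \<le> cap F"
  unfolding cap_def by (rule Inf_superset_mono) blast

lemma cap_empty [simp]: "cap ({} :: 'a::euclidean_space set) = 0"
proof -
  have "(\<lambda>x. 0) \<in> (H1 :: ('a \<Rightarrow> real) set)" by (simp add: H1_iff_sq_norm)
  then have "cap ({} :: 'a set) \<le> H1_sq_norm (\<lambda>x::'a. 0)"
    by (rule cap_le[where U = "{}"]) auto
  then show ?thesis by simp
qed

text \<open>The supremum of almost optimal competitors for the sets \<open>E n\<close> is a competitor for their union.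
Its increments are dominated by \<open>SUP_diff_square_le_suminf\<close>.\<close>

lemma cap_countably_subadditive:
  fixes E :: "nat \<Rightarrow> 'a::euclidean_space set"
  shows "cap (\<Union>n. E n) \<le> (\<Sum>n. cap (E n))"
proof (rule ennreal_le_epsilon)
  fix e :: real assume fin: "(\<Sum>n. cap (E n)) < top" and e: "0 < e"
  define d where "d n = ennreal (e * (1/2)^Suc n)" for n
  have "cap (E n) < cap (E n) + d n" for n
  proof -
    have "cap (E n) \<le> (\<Sum>n. cap (E n))"
      using sum_le_suminf[OF summableI, of "{n}" "\<lambda>n. cap (E n)"] by simp
    then have "cap (E n) < top" using fin by (rule le_less_trans)
    moreover have "0 < d n" using e by (simp add: d_def)
    ultimately show ?thesis by (simp add: ennreal_add_left_cancel_less[of _ 0, simplified] less_top)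
  qed
  note less = this
  \<comment> \<open>Competitors are chosen with errors \<open>e 2\<^sup>-\<^sup>n\<^sup>-\<^sup>1\<close>, whose sum is \<open>e\<close>.\<close>
  define P where "P n u U \<longleftrightarrow> u \<in> H1 \<and> (\<forall>x. 0 \<le> u x \<and> u x \<le> 1) \<and> open U \<and> E n \<subseteq> U \<and>
      (AE x in lebesgue. x \<in> U \<longrightarrow> 1 \<le> u x) \<and> H1_sq_norm u < cap (E n) + d n" for n u U
  have "\<exists>u U. P n u U" for n
  proof (rule cap_obtain[OF less, of n], goal_cases)
    case (1 u U)
    then show ?case unfolding P_def by blast
  qed
  then obtain g U where "\<And>n. P n (g n) (U n)" by metis
  then have g: "\<And>n. g n \<in> H1" "\<And>n x. 0 \<le> g n x" "\<And>n x. g n x \<le> 1"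
    and U: "\<And>n. open (U n)" "\<And>n. E n \<subseteq> U n" "\<And>n. AE x in lebesgue. x \<in> U n \<longrightarrow> 1 \<le> g n x"
    and le: "\<And>n. H1_sq_norm (g n) < cap (E n) + d n"
    unfolding P_def by blast+
  define f where "f x = (SUP n. g n x)" for x
  have bdd: "bdd_above (range (\<lambda>n. g n x))" for x
    using g(3) by (auto simp: bdd_above_def)
  have "H1_sq_norm f \<le> (\<Sum>n. H1_sq_norm (g n))"
  proof (rule H1_sq_norm_le_suminf)
    show "g n \<in> borel_measurable lebesgue" for n by (rule H1_measurable[OF g(1)])
    show "ennreal ((f x - f y)\<^sup>2) \<le> (\<Sum>n. ennreal ((g n x - g n y)\<^sup>2))" for x y
      unfolding f_def by (intro SUP_diff_square_le_suminf g)
    have "(SUP n::nat. (0::real)) = 0" by simp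
    then show "ennreal ((f x)\<^sup>2) \<le> (\<Sum>n. ennreal ((g n x)\<^sup>2))" for x
      using SUP_diff_square_le_suminf[of "\<lambda>n. g n x" "\<lambda>n. 0", OF g(2,3) order_refl zero_le_one]
      by (simp only: f_def diff_0_right)
  qed
  also have "\<dots> \<le> (\<Sum>n. cap (E n) + d n)"
    by (intro suminf_le summableI less_imp_le le)
  also have "\<dots> = (\<Sum>n. cap (E n)) + (\<Sum>n. d n)"
    by (rule suminf_add[OF summableI summableI, symmetric])
  also have "(\<Sum>n. d n) = ennreal e"
    unfolding d_def using e sums_mult[OF power_half_series, of e]
    by (intro suminf_ennreal_eq) auto
  finally have f_le: "H1_sq_norm f \<le> (\<Sum>n. cap (E n)) + ennreal e" .
  have "f \<in> borel_measurable lebesgue"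
    unfolding f_def by (rule borel_measurable_cSUP[OF _ H1_measurable[OF g(1)] bdd]) simp
  moreover have "(\<Sum>n. cap (E n)) + ennreal e < top" using fin by simp
  ultimately have "f \<in> H1"
    using f_le by (auto simp: H1_iff_sq_norm intro: le_less_trans)
  moreover have "open (\<Union>n. U n)" using U(1) by blast
  moreover have "(\<Union>n. E n) \<subseteq> (\<Union>n. U n)" using U(2) by blast
  moreover have "AE x in lebesgue. \<forall>n. x \<in> U n \<longrightarrow> 1 \<le> g n x"
    using U(3) unfolding AE_all_countable by blast
  then have "AE x in lebesgue. x \<in> (\<Union>n. U n) \<longrightarrow> 1 \<le> f x"
  proof eventually_elim
    fix x assume *: "\<forall>n. x \<in> U n \<longrightarrow> 1 \<le> g n x"
    show "x \<in> (\<Union>n. U n) \<longrightarrow> 1 \<le> f x"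
      using * cSUP_upper[OF UNIV_I bdd] unfolding f_def by (auto intro: order_trans)
  qed
  ultimately have "cap (\<Union>n. E n) \<le> H1_sq_norm f" by (rule cap_le)
  then show "cap (\<Union>n. E n) \<le> (\<Sum>n. cap (E n)) + ennreal e" using f_le by (rule order_trans)
qed

lemma cap_Un_le: "cap (A \<union> B) \<le> cap A + cap (B :: 'a::euclidean_space set)"
proof -
  define E where "E n = (if n = 0 then A else if n = 1 then B else {})" for n :: nat
  have "(\<Union>n. E n) = A \<union> B"
    by (auto simp: E_def split: if_splits)
  moreover have "(\<Sum>n. cap (E n)) = cap (E 0) + cap (E 1)"
    by (rule suminf_two) (simp add: E_def)
  ultimately show ?thesis
    using cap_countably_subadditive[of E] by (simp add: E_def)
qed

lemma cap_UN_null: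
  fixes E :: "nat \<Rightarrow> 'a::euclidean_space set"
  assumes "\<And>n. cap (E n) = 0"
  shows "cap (\<Union>n. E n) = 0"
  using cap_countably_subadditive[of E] by (simp add: assms)

lemma cap_subset_null: "E \<subseteq> F \<Longrightarrow> cap F = 0 \<Longrightarrow> cap E = 0"
  using cap_mono[of E F] by simp

lemma cap_Un_null: "cap A = 0 \<Longrightarrow> cap B = 0 \<Longrightarrow> cap (A \<union> B) = 0"
  using cap_Un_le[of A B] by simp

lemma emeasure_le_cap:
  fixes E :: "'a::euclidean_space set"
  assumes [measurable]: "E \<in> sets lebesgue"
  shows "emeasure lebesgue E \<le> cap E"
  unfolding cap_def
proof (rule Inf_greatest)
  fix c assume "c \<in> {dirichlet u + (\<integral>\<^sup>+x. ennreal ((u x)\<^sup>2) \<partial>lebesgue) | u.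
     u \<in> H1 \<and> (\<exists>U. open U \<and> E \<subseteq> U \<and> (AE x in lebesgue. x \<in> U \<longrightarrow> 1 \<le> u x))}"
  then obtain u U where c: "c = dirichlet u + (\<integral>\<^sup>+x. ennreal ((u x)\<^sup>2) \<partial>lebesgue)"
    and U: "E \<subseteq> U" and ae: "AE x in lebesgue. x \<in> U \<longrightarrow> 1 \<le> u x" by blast
  have "emeasure lebesgue E = (\<integral>\<^sup>+x. indicator E x \<partial>lebesgue)" by simp
  also have "\<dots> \<le> (\<integral>\<^sup>+x. ennreal ((u x)\<^sup>2) \<partial>lebesgue)"
  proof (rule nn_integral_mono_AE, use ae in eventually_elim)
    fix x assume *: "x \<in> U \<longrightarrow> 1 \<le> u x"
    show "indicator E x \<le> ennreal ((u x)\<^sup>2)"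
    proof (cases "x \<in> E")
      case True
      then have "1 \<le> (u x)\<^sup>2" using * U by (simp add: one_le_power subset_iff)
      then show ?thesis using True by simp
    qed simp
  qed
  also have "\<dots> \<le> dirichlet u + (\<integral>\<^sup>+x. ennreal ((u x)\<^sup>2) \<partial>lebesgue)" by simp
  finally show "emeasure lebesgue E \<le> c" unfolding c .
qed

section \<open>Quasi-continuous representatives\<close>

lemma quasi_continuous_iff:
  "quasi_continuous u \<longleftrightarrow> (\<forall>e>0. \<exists>A. open A \<and> cap A < ennreal e \<and> continuous_on (- A) u)"
proof
  assume *: "\<forall>e>0. \<exists>A. open A \<and> cap A < ennreal e \<and> continuous_on (- A) u"
  show "quasi_continuous u"
    unfolding quasi_continuous_def
  proof (intro allI impI)
    fix \<epsilon> :: ennreal assume "0 < \<epsilon>"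
    then obtain b where b: "0 < b" "b < \<epsilon>" using dense by blast
    then have "b < \<infinity>" by (auto intro: less_le_trans)
    then obtain e where "b = ennreal e" "0 < e" using b(1) by (cases b) (auto simp: ennreal_less_zero_iff)
    then show "\<exists>A. open A \<and> cap A < \<epsilon> \<and> continuous_on (- A) u"
      using * b(2) by (meson less_trans)
  qed
qed (simp add: quasi_continuous_def)

lemma continuous_imp_quasi_continuous:
  "continuous_on UNIV u \<Longrightarrow> quasi_continuous u"
  unfolding quasi_continuous_def by (intro allI impI exI[of _ "{}"]) auto

lemma quasi_continuous_compose2:
  fixes f :: "real \<Rightarrow> real \<Rightarrow> real"
  assumes u: "quasi_continuous u" and v: "quasi_continuous v"
    and f: "continuous_on UNIV (\<lambda>p. f (fst p) (snd p))"
  shows "quasi_continuous (\<lambda>x. f (u x) (v x))"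
  unfolding quasi_continuous_iff
proof (intro allI impI)
  fix e :: real assume "0 < e"
  then have e2: "0 < e / 2" by simp
  obtain A where A: "open A" "cap A < ennreal (e / 2)" "continuous_on (- A) u"
    using u e2 unfolding quasi_continuous_iff by blast
  obtain B where B: "open B" "cap B < ennreal (e / 2)" "continuous_on (- B) v"
    using v e2 unfolding quasi_continuous_iff by blast
  have "cap (A \<union> B) < ennreal (e / 2) + ennreal (e / 2)"
    using cap_Un_le[of A B] add_strict_mono[OF A(2) B(2)] by (rule le_less_trans)
  also have "\<dots> = ennreal e" using e2 by (simp add: ennreal_plus[symmetric] del: ennreal_plus)
  finally have "cap (A \<union> B) < ennreal e" .
  moreover have "continuous_on (- (A \<union> B)) (\<lambda>x. f (fst (u x, v x)) (snd (u x, v x)))"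
    by (rule continuous_on_compose2[OF f, of _ "\<lambda>x. (u x, v x)"])
      (auto intro!: continuous_on_Pair continuous_on_subset[OF A(3)] continuous_on_subset[OF B(3)])
  ultimately show "\<exists>A. open A \<and> cap A < ennreal e \<and> continuous_on (- A) (\<lambda>x. f (u x) (v x))"
    using A(1) B(1) by (intro exI[of _ "A \<union> B"]) auto
qed

lemma quasi_continuous_diff:
  "quasi_continuous u \<Longrightarrow> quasi_continuous v \<Longrightarrow> quasi_continuous (\<lambda>x. u x - v x)"
  by (rule quasi_continuous_compose2) (auto intro!: continuous_intros)

lemma quasi_continuous_midpoint:
  "quasi_continuous u \<Longrightarrow> quasi_continuous v \<Longrightarrow> quasi_continuous (\<lambda>x. (u x + v x) / 2)"
  by (rule quasi_continuous_compose2) (auto intro!: continuous_intros)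

lemma quasi_continuous_compose:
  fixes T :: "real \<Rightarrow> real"
  assumes "quasi_continuous u" "continuous_on UNIV T"
  shows "quasi_continuous (\<lambda>x. T (u x))"
  by (rule quasi_continuous_compose2[OF assms(1) assms(1), of "\<lambda>a b. T a"])
    (auto intro!: continuous_on_compose2[OF assms(2)] continuous_intros)

text \<open>For continuous \<open>v\<close> the function \<open>\<bar>v\<bar> / t\<close> is a competitor, as the set is open. In general the set
becomes open after adjoining a small open set \<open>A\<close> off which \<open>v\<close> is continuous, and taking the maximum with a
competitor for \<open>A\<close> costs only the capacity of \<open>A\<close>.\<close>

lemma cap_Chebyshev:
  fixes v :: "'a::euclidean_space \<Rightarrow> real"
  assumes v: "v \<in> H1" and qc: "quasi_continuous v" and t: "0 < t"
  shows "cap {x. t < \<bar>v x\<bar>} \<le> ennreal ((1 / t)\<^sup>2) * H1_sq_norm v"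
proof (rule ennreal_le_epsilon)
  fix e :: real assume "0 < e"
  then obtain A where A: "open A" "cap A < ennreal e" "continuous_on (- A) v"
    using qc unfolding quasi_continuous_iff by blast
  obtain w U where w: "w \<in> H1" "\<And>x. 0 \<le> w x" "\<And>x. w x \<le> 1" "open U" "A \<subseteq> U"
    "AE x in lebesgue. x \<in> U \<longrightarrow> 1 \<le> w x" "H1_sq_norm w < ennreal e"
    using cap_obtain[OF A(2)] by blast
  have "open ({s. t < \<bar>s\<bar>} :: real set)"
    by (intro open_Collect_less continuous_intros)
  then obtain T where T: "open T" "T \<inter> - A = v -` {s. t < \<bar>s\<bar>} \<inter> - A"
    using A(3) unfolding continuous_on_open_invariant by blast
  define p where "p x = \<bar>v x\<bar> / t" for x
  have p_contr: "\<bar>p x - p y\<bar> \<le> \<bar>1 / t * v x - 1 / t * v y\<bar>" "\<bar>p x\<bar> \<le> \<bar>1 / t * v x\<bar>" for x y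
  proof -
    have "\<bar>p x - p y\<bar> = \<bar>\<bar>v x\<bar> - \<bar>v y\<bar>\<bar> / t"
      using t by (simp add: p_def diff_divide_distrib[symmetric])
    also have "\<dots> \<le> \<bar>v x - v y\<bar> / t" using t by (intro divide_right_mono) auto
    also have "\<dots> = \<bar>1 / t * v x - 1 / t * v y\<bar>" using t by (simp add: diff_divide_distrib[symmetric])
    finally show "\<bar>p x - p y\<bar> \<le> \<bar>1 / t * v x - 1 / t * v y\<bar>" .
    show "\<bar>p x\<bar> \<le> \<bar>1 / t * v x\<bar>" using t by (simp add: p_def abs_divide)
  qed
  have p_m: "p \<in> borel_measurable lebesgue"
    unfolding p_def by (intro borel_measurable_divide borel_measurable_abs borel_measurable_const H1_measurable v)
  have pH1: "p \<in> H1" by (rule H1_contraction[OF H1_cmult[OF v] p_m p_contr])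
  have p_le: "H1_sq_norm p \<le> ennreal ((1 / t)\<^sup>2) * H1_sq_norm v"
    unfolding H1_sq_norm_cmult[OF H1_measurable[OF v], symmetric] by (rule H1_sq_norm_contraction) (rule p_contr)+
  define q where "q x = max (p x) (w x)" for x
  have q_le: "H1_sq_norm q \<le> H1_sq_norm p + H1_sq_norm w"
    unfolding q_def by (rule H1_sq_norm_max_le[OF p_m H1_measurable[OF w(1)]])
  have "H1_sq_norm p + H1_sq_norm w < \<infinity>" using pH1 w(1) by (simp add: H1_iff_sq_norm)
  then have "q \<in> H1"
    using q_le p_m H1_measurable[OF w(1)] unfolding H1_iff_sq_norm
    by (auto simp: q_def[abs_def] intro: le_less_trans)
  moreover have "open (T \<union> A)" using T(1) A(1) by blast
  moreover have "{x. t < \<bar>v x\<bar>} \<subseteq> T \<union> A" using T(2) by auto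
  moreover have "AE x in lebesgue. x \<in> T \<union> A \<longrightarrow> 1 \<le> q x"
    using w(6)
  proof eventually_elim
    fix x assume *: "x \<in> U \<longrightarrow> 1 \<le> w x"
    have "1 \<le> p x" if "x \<in> T" "x \<notin> A"
    proof -
      have "t < \<bar>v x\<bar>" using that T(2) by blast
      then show ?thesis using t by (simp add: p_def)
    qed
    then show "x \<in> T \<union> A \<longrightarrow> 1 \<le> q x"
      using * w(5) by (auto simp: q_def le_max_iff_disj)
  qed
  ultimately have "cap {x. t < \<bar>v x\<bar>} \<le> H1_sq_norm q" by (rule cap_le)
  also have "\<dots> \<le> ennreal ((1 / t)\<^sup>2) * H1_sq_norm v + ennreal e"
    using q_le add_mono[OF p_le less_imp_le[OF w(7)]] by (rule order_trans)
  finally show "cap {x. t < \<bar>v x\<bar>} \<le> ennreal ((1 / t)\<^sup>2) * H1_sq_norm v + ennreal e" .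
qed

lemma nonzero_eq_UN: "{x. (v x :: real) \<noteq> 0} = (\<Union>n. {x. 1 / Suc n < \<bar>v x\<bar>})"
proof (intro set_eqI iffI)
  fix x assume "x \<in> {x. v x \<noteq> 0}"
  then obtain n where "1 / Suc n < \<bar>v x\<bar>"
    using nat_approx_posE[of "\<bar>v x\<bar>"] by auto
  then show "x \<in> (\<Union>n. {x. 1 / Suc n < \<bar>v x\<bar>})" by blast
next
  fix x assume "x \<in> (\<Union>n. {x. 1 / Suc n < \<bar>v x\<bar>})"
  then obtain n where "1 / real (Suc n) < \<bar>v x\<bar>" by blast
  then have "0 < \<bar>v x\<bar>" by (rule le_less_trans[rotated]) simp
  then show "x \<in> {x. v x \<noteq> 0}" by simp
qed

lemma quasi_continuous_AE_eq_imp_qe: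
  fixes u v :: "'a::euclidean_space \<Rightarrow> real"
  assumes qc: "quasi_continuous u" "quasi_continuous v"
    and m: "u \<in> borel_measurable borel" "v \<in> borel_measurable borel"
    and ae: "AE x in lebesgue. u x = v x"
  shows "cap {x. u x \<noteq> v x} = 0"
proof -
  define d where "d x = u x - v x" for x
  have "AE x in lebesgue. d x = 0" using ae by eventually_elim (simp add: d_def)
  then have d0: "H1_sq_norm d = 0" using H1_sq_norm_cong_AE[of d "\<lambda>x. 0"] by simp
  have "d \<in> borel_measurable borel" unfolding d_def by (intro borel_measurable_diff m)
  then have "d \<in> borel_measurable lebesgue" by (simp add: measurable_completion)
  then have dH1: "d \<in> H1" using d0 by (simp add: H1_iff_sq_norm)
  have dqc: "quasi_continuous d" unfolding d_def by (rule quasi_continuous_diff[OF qc])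
  have "cap {x. 1 / Suc n < \<bar>d x\<bar>} = 0" for n
    using cap_Chebyshev[OF dH1 dqc, of "1 / Suc n"] by (simp add: d0)
  then have "cap (\<Union>n. {x. 1 / Suc n < \<bar>d x\<bar>}) = 0" by (rule cap_UN_null)
  then show ?thesis unfolding nonzero_eq_UN[symmetric] by (simp add: d_def)
qed

lemma H1_sq_norm_minus_commute:
  "H1_sq_norm (\<lambda>x. u x - v x) = H1_sq_norm (\<lambda>x. v x - u x)"
  by (intro antisym H1_sq_norm_contraction) auto

text \<open>A sequence of continuous functions converging fast in \<open>H\<^sup>1\<close> converges uniformly off the sets \<open>A m\<close>,
whose capacity tends to zero by the Chebyshev inequality. The rate \<open>8\<^sup>-\<^sup>k\<close> beats the factor \<open>4\<^sup>k\<close> that the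
inequality contributes at the threshold \<open>2\<^sup>-\<^sup>k\<close>.\<close>

lemma quasi_continuous_representative_exists:
  fixes u :: "'a::euclidean_space \<Rightarrow> real"
  assumes u: "u \<in> H1"
  shows "\<exists>v. quasi_continuous v \<and> v \<in> borel_measurable borel \<and> (AE x in lebesgue. v x = u x)"
proof -
  obtain \<phi> where \<phi>: "\<And>n. \<phi> n \<in> H1" "\<And>n. continuous_on UNIV (\<phi> n)"
    "(\<lambda>n. H1_sq_norm (\<lambda>x. \<phi> n x - u x)) \<longlonglongrightarrow> 0"
    using continuous_dense_H1[OF u] by blast
  have "\<exists>n. H1_sq_norm (\<lambda>x. \<phi> n x - u x) < ennreal ((1/8)^k)" for k
    using order_tendstoD(2)[OF \<phi>(3), of "ennreal ((1/8)^k)"] by (auto simp: eventually_sequentially)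
  then obtain r where r: "\<And>k. H1_sq_norm (\<lambda>x. \<phi> (r k) x - u x) < ennreal ((1/8)^k)" by metis
  define \<psi> where "\<psi> k = \<phi> (r k)" for k
  have \<psi>: "\<psi> k \<in> H1" "continuous_on UNIV (\<psi> k)" "H1_sq_norm (\<lambda>x. \<psi> k x - u x) \<le> ennreal ((1/8)^k)" for k
    using \<phi> r by (auto simp: \<psi>_def intro: less_imp_le)
  have \<psi>_m: "\<psi> k \<in> borel_measurable borel" for k
    by (rule borel_measurable_continuous_onI[OF \<psi>(2)])
  define d where "d k x = \<psi> (Suc k) x - \<psi> k x" for k x
  have d_H1: "d k \<in> H1" for k unfolding d_def by (intro H1_diff \<psi>)
  have d_cont: "continuous_on UNIV (d k)" for k unfolding d_def by (intro continuous_intros \<psi>)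
  have d_le: "H1_sq_norm (d k) \<le> ennreal (4 * (1/8)^k)" for k
  proof -
    have "d k = (\<lambda>x. (\<psi> (Suc k) x - u x) + (u x - \<psi> k x))" by (simp add: d_def fun_eq_iff)
    then have "H1_sq_norm (d k) \<le> 2 * H1_sq_norm (\<lambda>x. \<psi> (Suc k) x - u x) + 2 * H1_sq_norm (\<lambda>x. u x - \<psi> k x)"
      using H1_sq_norm_add_le[OF H1_measurable[OF H1_diff[OF \<psi>(1) u]] H1_measurable[OF H1_diff[OF u \<psi>(1)]]]
      by simp
    also have "\<dots> \<le> 2 * ennreal ((1/8)^Suc k) + 2 * ennreal ((1/8)^k)"
      using \<psi>(3)[of k] \<psi>(3)[of "Suc k"] H1_sq_norm_minus_commute[of u "\<psi> k"]
      by (intro add_mono mult_left_mono) (simp_all del: power_Suc)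
    also have "\<dots> \<le> 2 * ennreal ((1/8)^k) + 2 * ennreal ((1/8)^k)"
      by (intro add_mono mult_left_mono ennreal_leI) auto
    also have "\<dots> = ennreal (4 * (1/8)^k)"
      by (simp add: distrib_right[symmetric] ennreal_mult)
    finally show ?thesis .
  qed
  define G where "G k = {x. (1/2)^k < \<bar>d k x\<bar>}" for k
  have G_open: "open (G k)" for k
    unfolding G_def by (intro open_Collect_less continuous_intros d_cont)
  have G_cap: "cap (G k) \<le> ennreal (4 * (1/2)^k)" for k
  proof -
    have "cap (G k) \<le> ennreal ((1 / (1/2)^k)\<^sup>2) * H1_sq_norm (d k)"
      unfolding G_def
      by (rule cap_Chebyshev[OF d_H1 continuous_imp_quasi_continuous[OF d_cont]]) simp
    also have "\<dots> \<le> ennreal ((1 / (1/2)^k)\<^sup>2) * ennreal (4 * (1/8)^k)"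
      by (intro mult_left_mono d_le) simp
    also have "\<dots> = ennreal ((1 / (1/2)^k)\<^sup>2 * (4 * (1/8)^k))"
      by (rule ennreal_mult[symmetric]) auto
    also have "(1 / (1/2)^k)\<^sup>2 * (4 * (1/8)^k) = 4 * (1/2::real)^k"
    proof -
      have "(1 / (1/2)^k)\<^sup>2 * (1/8)^k = (2 * 2 * (1/8::real))^k"
        by (simp only: power_mult_distrib power2_eq_square power_one_over[symmetric] power_divide)
          (simp add: field_simps power_mult_distrib[symmetric])
      then show ?thesis by simp
    qed
    finally show ?thesis .
  qed
  define A where "A m = (\<Union>n. G (m + n))" for m
  have A_open: "open (A m)" for m unfolding A_def using G_open by blast
  have A_cap: "cap (A m) \<le> ennreal (8 * (1/2)^m)" for m
  proof -
    have "cap (A m) \<le> (\<Sum>n. cap (G (m + n)))" unfolding A_def by (rule cap_countably_subadditive)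
    also have "\<dots> \<le> (\<Sum>n. ennreal (4 * (1/2)^(m + n)))" by (intro suminf_le summableI G_cap)
    also have "\<dots> = ennreal (8 * (1/2)^m)"
      using sums_mult[OF power_half_series, of "8 * (1/2)^m"]
      by (intro suminf_ennreal_eq) (auto simp: power_add field_simps)
    finally show ?thesis .
  qed
  define L where "L m x = \<psi> m x + (\<Sum>i. d (m + i) x)" for m x
  have part: "\<psi> m x + (\<Sum>i<n. d (m + i) x) = \<psi> (m + n) x" for m n x
    by (induction n) (auto simp: d_def)
  have unif: "uniform_limit (- A m) (\<lambda>n x. \<psi> (m + n) x) (L m) sequentially" for m
  proof -
    have "uniform_limit (- A m) (\<lambda>n x. \<Sum>i<n. d (m + i) x) (\<lambda>x. \<Sum>i. d (m + i) x) sequentially"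
    proof (rule Weierstrass_m_test)
      show "norm (d (m + n) x) \<le> (1/2)^(m + n)" if "x \<in> - A m" for n x
        using that by (auto simp: A_def G_def not_less)
      show "summable (\<lambda>n. (1/2::real)^(m + n))"
        by (simp add: power_add summable_mult summable_geometric)
    qed
    then have "uniform_limit (- A m) (\<lambda>n x. \<psi> m x + (\<Sum>i<n. d (m + i) x)) (L m) sequentially"
      unfolding L_def by (intro uniform_limit_add uniform_limit_const)
    then show ?thesis by (simp add: part)
  qed
  define v where "v x = lim (\<lambda>n. \<psi> n x)" for x
  have conv: "(\<lambda>n. \<psi> n x) \<longlonglongrightarrow> L m x" if "x \<notin> A m" for m x
  proof -
    have "(\<lambda>n. \<psi> (m + n) x) \<longlonglongrightarrow> L m x"
      using tendsto_uniform_limitI[OF unif] that by auto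
    then have "(\<lambda>n. \<psi> (n + m) x) \<longlonglongrightarrow> L m x" by (simp add: add.commute)
    then show ?thesis by (rule LIMSEQ_offset)
  qed
  have vL: "v x = L m x" if "x \<notin> A m" for m x
    unfolding v_def using conv[OF that] by (rule limI)
  have v_m: "v \<in> borel_measurable borel"
    unfolding v_def by (intro borel_measurable_lim_metric \<psi>_m)
  have small: "\<exists>m. 8 * (1/2)^m < e" if "0 < e" for e :: real
    using real_arch_pow_inv[of "e / 8" "1/2"] that by (auto simp: field_simps)
  have "quasi_continuous v"
    unfolding quasi_continuous_iff
  proof (intro allI impI)
    fix e :: real assume "0 < e"
    then obtain m where m: "8 * (1/2)^m < e" using small by blast
    have "cap (A m) < ennreal e"
      using A_cap by (rule le_less_trans) (use m in \<open>simp add: ennreal_lessI \<open>0 < e\<close>\<close>)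
    moreover have "continuous_on (- A m) (L m)"
      by (rule uniform_limit_theorem[OF _ unif])
        (auto intro!: always_eventually continuous_on_subset[OF \<psi>(2)])
    then have "continuous_on (- A m) v"
      by (rule continuous_on_eq) (simp add: vL)
    ultimately show "\<exists>A. open A \<and> cap A < ennreal e \<and> continuous_on (- A) v"
      using A_open by blast
  qed
  moreover have "AE x in lebesgue. v x = u x"
  proof -
    define N where "N = (\<Inter>m. A m)"
    have A_sets: "A m \<in> sets lebesgue" for m
      using A_open[of m] by (intro sets_completionI_sets) (simp add: borel_open)
    have N_sets: "N \<in> sets lebesgue" unfolding N_def using A_sets by blast
    have "emeasure lebesgue N \<le> 0"
    proof (rule ennreal_le_epsilon)
      fix e :: real assume "0 < e"
      then obtain m where m: "8 * (1/2)^m < e" using small by blast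
      have "emeasure lebesgue N \<le> emeasure lebesgue (A m)"
        by (rule emeasure_mono) (auto simp: N_def A_sets)
      also have "\<dots> \<le> cap (A m)" by (rule emeasure_le_cap[OF A_sets])
      also have "\<dots> \<le> ennreal (8 * (1/2)^m)" by (rule A_cap)
      also have "\<dots> \<le> ennreal e" using m by (intro ennreal_leI) simp
      finally show "emeasure lebesgue N \<le> 0 + ennreal e" by simp
    qed
    then have "N \<in> null_sets lebesgue" using N_sets by auto
    then have ae: "AE x in lebesgue. (\<lambda>n. \<psi> n x) \<longlonglongrightarrow> v x"
    proof (rule AE_I')
      show "{x \<in> space lebesgue. \<not> (\<lambda>n. \<psi> n x) \<longlonglongrightarrow> v x} \<subseteq> N"
        using conv vL by (force simp: N_def)
    qed
    have "sq_norm (\<lambda>x. v x - u x) \<le> liminf (\<lambda>n. sq_norm (\<lambda>x. \<psi> n x - u x))"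
    proof (rule sq_norm_Fatou)
      show "(\<lambda>x. \<psi> n x - u x) \<in> borel_measurable lebesgue" for n
        by (rule H1_measurable[OF H1_diff[OF \<psi>(1) u]])
      show "AE x in lebesgue. (\<lambda>n. \<psi> n x - u x) \<longlonglongrightarrow> v x - u x"
        using ae by eventually_elim (intro tendsto_intros)
    qed
    also have "\<dots> \<le> liminf (\<lambda>n. ennreal ((1/8)^n))"
    proof (intro Liminf_mono always_eventually allI)
      fix n
      have "sq_norm (\<lambda>x. \<psi> n x - u x) \<le> H1_sq_norm (\<lambda>x. \<psi> n x - u x)" by (simp add: H1_sq_norm_def)
      then show "sq_norm (\<lambda>x. \<psi> n x - u x) \<le> ennreal ((1/8)^n)" using \<psi>(3) by (rule order_trans)
    qed
    also have "\<dots> = 0"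
    proof (rule lim_imp_Liminf)
      have "(\<lambda>n. (1/8::real)^n) \<longlonglongrightarrow> 0" by (rule LIMSEQ_power_zero) simp
      from tendsto_ennrealI[OF this] show "(\<lambda>n. ennreal ((1/8)^n)) \<longlonglongrightarrow> 0" by simp
    qed simp
    finally have "sq_norm (\<lambda>x. v x - u x) = 0" by simp
    moreover have "(\<lambda>x. ennreal ((v x - u x)\<^sup>2)) \<in> borel_measurable lebesgue"
    proof -
      have [measurable]: "v \<in> borel_measurable lebesgue" using v_m by (simp add: measurable_completion)
      have [measurable]: "u \<in> borel_measurable lebesgue" by (rule H1_measurable[OF u])
      show ?thesis by measurable
    qed
    ultimately have "AE x in lebesgue. ennreal ((v x - u x)\<^sup>2) = 0"
      unfolding sq_norm_def using nn_integral_0_iff_AE by blast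
    then show ?thesis by eventually_elim simp
  qed
  ultimately show ?thesis using v_m by blast
qed

lemma qc_rep:
  assumes "u \<in> H1"
  shows "quasi_continuous (qc_rep u)" "qc_rep u \<in> borel_measurable borel"
    "AE x in lebesgue. qc_rep u x = u x"
  using someI_ex[OF quasi_continuous_representative_exists[OF assms]] unfolding qc_rep_def by blast+

section \<open>Functions vanishing quasi-everywhere outside a set\<close>

text \<open>The space \<open>H\<^sup>1\<^sub>0(\<Omega>)\<close>. Asking for some Borel quasi-continuous representative instead of the chosen one
makes stability under operations immediate; \<open>H10_iff_qc_rep\<close> shows that the choice does not matter.\<close>

definition H10 :: "'a::euclidean_space set \<Rightarrow> ('a \<Rightarrow> real) set" where
  "H10 \<Omega> = {u \<in> H1. \<exists>v. quasi_continuous v \<and> v \<in> borel_measurable borel \<and>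
     (AE x in lebesgue. v x = u x) \<and> cap ({x. v x \<noteq> 0} - \<Omega>) = 0}"

lemma H10_H1: "u \<in> H10 \<Omega> \<Longrightarrow> u \<in> H1"
  by (simp add: H10_def)

lemma H10_iff_qc_rep:
  assumes u: "u \<in> H1"
  shows "u \<in> H10 \<Omega> \<longleftrightarrow> cap ({x. qc_rep u x \<noteq> 0} - \<Omega>) = 0"
proof
  assume "u \<in> H10 \<Omega>"
  then obtain v where v: "quasi_continuous v" "v \<in> borel_measurable borel"
    "AE x in lebesgue. v x = u x" "cap ({x. v x \<noteq> 0} - \<Omega>) = 0"
    by (auto simp: H10_def)
  have "AE x in lebesgue. v x = qc_rep u x" using v(3) qc_rep(3)[OF u] by eventually_elim simp
  then have "cap {x. v x \<noteq> qc_rep u x} = 0"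
    by (intro quasi_continuous_AE_eq_imp_qe v qc_rep u)
  then have "cap (({x. v x \<noteq> 0} - \<Omega>) \<union> {x. v x \<noteq> qc_rep u x}) = 0" by (intro cap_Un_null v)
  then show "cap ({x. qc_rep u x \<noteq> 0} - \<Omega>) = 0"
    by (rule cap_subset_null[rotated]) auto
next
  assume "cap ({x. qc_rep u x \<noteq> 0} - \<Omega>) = 0"
  then show "u \<in> H10 \<Omega>" using qc_rep[OF u] u by (auto simp: H10_def)
qed

lemma H10_midpoint:
  assumes "u \<in> H10 \<Omega>" "w \<in> H10 \<Omega>"
  shows "(\<lambda>x. (u x + w x) / 2) \<in> H10 \<Omega>"
proof -
  obtain v where v: "quasi_continuous v" "v \<in> borel_measurable borel"
    "AE x in lebesgue. v x = u x" "cap ({x. v x \<noteq> 0} - \<Omega>) = 0"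
    using assms(1) by (auto simp: H10_def)
  obtain z where z: "quasi_continuous z" "z \<in> borel_measurable borel"
    "AE x in lebesgue. z x = w x" "cap ({x. z x \<noteq> 0} - \<Omega>) = 0"
    using assms(2) by (auto simp: H10_def)
  define m where "m x = (v x + z x) / 2" for x
  have "quasi_continuous m" unfolding m_def by (rule quasi_continuous_midpoint[OF v(1) z(1)])
  moreover have "m \<in> borel_measurable borel"
    unfolding m_def by (intro borel_measurable_divide borel_measurable_add borel_measurable_const v z)
  moreover have "AE x in lebesgue. m x = (u x + w x) / 2"
    using v(3) z(3) by eventually_elim (simp add: m_def)
  moreover have "cap ({x. m x \<noteq> 0} - \<Omega>) = 0"
    using cap_Un_null[OF v(4) z(4)] by (rule cap_subset_null[rotated]) (auto simp: m_def)
  ultimately show ?thesis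
    using H1_midpoint[OF assms[THEN H10_H1]] unfolding H10_def by blast
qed

lemma H10_contraction:
  fixes T :: "real \<Rightarrow> real"
  assumes u: "u \<in> H10 \<Omega>" and T: "\<And>a b. \<bar>T a - T b\<bar> \<le> \<bar>a - b\<bar>" "T 0 = 0"
  shows "(\<lambda>x. T (u x)) \<in> H10 \<Omega>"
proof -
  have T_cont: "continuous_on UNIV T"
    by (rule lipschitz_on_continuous_on[of 1]) (use T in \<open>auto simp: lipschitz_on_def dist_real_def\<close>)
  have T_m: "T \<in> borel_measurable borel" by (rule borel_measurable_continuous_onI[OF T_cont])
  obtain v where v: "quasi_continuous v" "v \<in> borel_measurable borel"
    "AE x in lebesgue. v x = u x" "cap ({x. v x \<noteq> 0} - \<Omega>) = 0"
    using u by (auto simp: H10_def)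
  have "(\<lambda>x. T (u x)) \<in> borel_measurable lebesgue"
    by (rule measurable_compose[OF H1_measurable[OF H10_H1[OF u]] T_m])
  then have "(\<lambda>x. T (u x)) \<in> H1"
    using T T(1)[of _ 0] by (intro H1_contraction[OF H10_H1[OF u]]) auto
  moreover have "quasi_continuous (\<lambda>x. T (v x))" by (rule quasi_continuous_compose[OF v(1) T_cont])
  moreover have "(\<lambda>x. T (v x)) \<in> borel_measurable borel" by (rule measurable_compose[OF v(2) T_m])
  moreover have "AE x in lebesgue. T (v x) = T (u x)" using v(3) by eventually_elim simp
  moreover have "cap ({x. T (v x) \<noteq> 0} - \<Omega>) = 0"
    using v(4) by (rule cap_subset_null[rotated]) (use T in auto)
  ultimately show ?thesis unfolding H10_def by blast
qed

text \<open>Where the representative of \<open>u\<close> exceeds \<open>t\<close> outside \<open>\<Omega>\<close>, it differs from that of \<open>y n\<close> by more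
than \<open>t\<close> up to a set of zero capacity, and the Chebyshev inequality applies to the difference.\<close>

lemma H10_strongly_closed:
  fixes u :: "'a::euclidean_space \<Rightarrow> real"
  assumes y: "\<And>n. y n \<in> H10 \<Omega>" and u: "u \<in> H1" and lim: "(\<lambda>n. H1_sq_norm (\<lambda>x. y n x - u x)) \<longlonglongrightarrow> 0"
  shows "u \<in> H10 \<Omega>"
  unfolding H10_iff_qc_rep[OF u]
proof -
  let ?v = "qc_rep u"
  have "cap ({x. 1 / Suc j < \<bar>?v x\<bar>} - \<Omega>) = 0" for j
  proof -
    define t where "t = 1 / real (Suc j)"
    have t: "0 < t" by (simp add: t_def)
    have "cap ({x. t < \<bar>?v x\<bar>} - \<Omega>) \<le> ennreal ((1 / t)\<^sup>2) * H1_sq_norm (\<lambda>x. y n x - u x)" for n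
    proof -
      have yH1: "y n \<in> H1" by (rule H10_H1[OF y])
      let ?w = "qc_rep (y n)"
      define d where "d x = ?v x - ?w x" for x
      have ae: "AE x in lebesgue. u x - y n x = d x"
        using qc_rep(3)[OF u] qc_rep(3)[OF yH1] by eventually_elim (simp add: d_def)
      have "d \<in> borel_measurable borel"
        unfolding d_def by (intro borel_measurable_diff qc_rep u yH1)
      then have "d \<in> borel_measurable lebesgue" by (simp add: measurable_completion)
      then have dH1: "d \<in> H1" by (rule H1_cong_AE[OF H1_diff[OF u yH1] _ ae])
      have "quasi_continuous d" unfolding d_def by (intro quasi_continuous_diff qc_rep u yH1)
      then have "cap {x. t < \<bar>d x\<bar>} \<le> ennreal ((1 / t)\<^sup>2) * H1_sq_norm d"
        by (rule cap_Chebyshev[OF dH1 _ t])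
      also have "H1_sq_norm d = H1_sq_norm (\<lambda>x. y n x - u x)"
        using H1_sq_norm_cong_AE[OF ae] H1_sq_norm_minus_commute[of u "y n"] by simp
      finally have 1: "cap {x. t < \<bar>d x\<bar>} \<le> ennreal ((1 / t)\<^sup>2) * H1_sq_norm (\<lambda>x. y n x - u x)" .
      have 2: "cap ({x. ?w x \<noteq> 0} - \<Omega>) = 0" using y[of n] H10_iff_qc_rep[OF yH1] by blast
      have "cap ({x. t < \<bar>?v x\<bar>} - \<Omega>) \<le> cap ({x. t < \<bar>d x\<bar>} \<union> ({x. ?w x \<noteq> 0} - \<Omega>))"
        by (rule cap_mono) (auto simp: d_def)
      also have "\<dots> \<le> cap {x. t < \<bar>d x\<bar>} + cap ({x. ?w x \<noteq> 0} - \<Omega>)" by (rule cap_Un_le)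
      finally show ?thesis using 1 2 by simp
    qed
    moreover have "(\<lambda>n. ennreal ((1 / t)\<^sup>2) * H1_sq_norm (\<lambda>x. y n x - u x)) \<longlonglongrightarrow> ennreal ((1 / t)\<^sup>2) * 0"
      by (intro ennreal_tendsto_cmult lim) simp
    ultimately have "cap ({x. t < \<bar>?v x\<bar>} - \<Omega>) \<le> 0"
      by (intro LIMSEQ_le_const[of _ 0]) auto
    then show ?thesis by (simp add: t_def)
  qed
  then have "cap (\<Union>j. {x. 1 / Suc j < \<bar>?v x\<bar>} - \<Omega>) = 0" by (rule cap_UN_null)
  moreover have "(\<Union>j. S j) - \<Omega> = (\<Union>j. S j - \<Omega>)" for S :: "nat \<Rightarrow> 'a set" by blast
  ultimately show "cap ({x. ?v x \<noteq> 0} - \<Omega>) = 0"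
    unfolding nonzero_eq_UN by (simp only:)
qed

text \<open>\<open>H10\<close> is midpoint-convex, so strongly convergent midpoints reduce this to strong closedness.\<close>

lemma H10_weakly_closed:
  fixes u :: "'a::euclidean_space \<Rightarrow> real"
  assumes f: "\<And>n. f n \<in> H10 \<Omega>" and bound: "\<And>n. energy (f n) \<le> ennreal C" and u: "u \<in> L2 UNIV"
    and lim: "(\<lambda>n. \<integral>x. (f n x - u x)\<^sup>2 \<partial>lebesgue) \<longlonglongrightarrow> 0"
  shows "u \<in> H10 \<Omega>"
proof (rule H1_strong_midpoints[OF H10_H1[OF f] bound u lim])
  fix y assume y: "\<And>n. y n \<in> midpoint_hull (range f)" and uH1: "u \<in> H1"
    and lim: "(\<lambda>n. H1_sq_norm (\<lambda>x. y n x - u x)) \<longlonglongrightarrow> 0"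
  have "range f \<subseteq> H10 \<Omega>" using f by blast
  moreover have "midpoint_closed (H10 \<Omega>)"
    unfolding midpoint_closed_def by (intro ballI H10_midpoint)
  ultimately have "midpoint_hull (range f) \<subseteq> H10 \<Omega>"
    by (rule midpoint_hull_minimal)
  then have "y n \<in> H10 \<Omega>" for n using y by blast
  then show "u \<in> H10 \<Omega>" by (rule H10_strongly_closed[OF _ uH1 lim])
qed


section \<open>The measures \<open>V dx\<close>\<close>

definition potential_density :: "'a::euclidean_space set \<Rightarrow> ('a \<Rightarrow> ennreal) \<Rightarrow> 'a \<Rightarrow> ennreal" where
  "potential_density \<Omega> V x = V x * indicator \<Omega> x"

lemma borel_imp_lebesgue: "E \<in> sets borel \<Longrightarrow> E \<in> sets lebesgue"
  by (simp add: sets_completionI_sets)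

context
  fixes \<Omega> :: "'a::euclidean_space set" and V :: "'a \<Rightarrow> ennreal"
  assumes V: "potential_density \<Omega> V \<in> borel_measurable lebesgue"
begin

lemma sets_potential_measure: "sets (potential_measure \<Omega> V) = sets borel"
  unfolding potential_measure_def
  using sets.sigma_sets_eq[of "borel :: 'a measure"] by (subst sets_measure_of) auto

text \<open>The singular part is countably additive because a countable union of sets has zero capacity outside \<open>\<Omega>\<close>
exactly if each of them has.\<close>

lemma emeasure_potential_measure:
  assumes E: "E \<in> sets borel"
  shows "emeasure (potential_measure \<Omega> V) E
    = emeasure (density lebesgue (potential_density \<Omega> V)) E + (if cap (E - \<Omega>) = 0 then 0 else \<infinity>)"
proof -
  define \<nu> where "\<nu> = density lebesgue (potential_density \<Omega> V)"
  define c where "c E = (if cap (E - \<Omega>) = 0 then 0 else \<infinity> :: ennreal)" for E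
  define \<mu> where "\<mu> E = (\<integral>\<^sup>+x\<in>E \<inter> \<Omega>. V x \<partial>lebesgue) + c E" for E
  have \<mu>: "\<mu> E = emeasure \<nu> E + c E" if "E \<in> sets borel" for E
  proof -
    have "emeasure \<nu> E = (\<integral>\<^sup>+x. potential_density \<Omega> V x * indicator E x \<partial>lebesgue)"
      unfolding \<nu>_def by (rule emeasure_density[OF V borel_imp_lebesgue[OF that]])
    also have "\<dots> = (\<integral>\<^sup>+x\<in>E \<inter> \<Omega>. V x \<partial>lebesgue)"
      by (intro nn_integral_cong) (auto simp: potential_density_def split: split_indicator)
    finally show ?thesis by (simp add: \<mu>_def)
  qed
  have "emeasure (potential_measure \<Omega> V) E = \<mu> E"
  proof (rule emeasure_measure_of)
    show "potential_measure \<Omega> V = measure_of UNIV (sets borel) \<mu>"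
      unfolding potential_measure_def \<mu>_def c_def ..
    show "sets (borel :: 'a measure) \<subseteq> Pow UNIV" by simp
    show "E \<in> sets (potential_measure \<Omega> V)" using E by (simp add: sets_potential_measure)
    show "positive (sets (potential_measure \<Omega> V)) \<mu>"
      unfolding positive_def \<mu>_def c_def by simp
    show "countably_additive (sets (potential_measure \<Omega> V)) \<mu>"
      unfolding sets_potential_measure
    proof (rule countably_additiveI)
      fix A :: "nat \<Rightarrow> 'a set"
      assume A: "range A \<subseteq> sets borel" and disj: "disjoint_family A" and U: "(\<Union>i. A i) \<in> sets borel"
      have A': "A i \<in> sets borel" for i using A by auto
      have "range A \<subseteq> sets \<nu>" using A' borel_imp_lebesgue by (auto simp: \<nu>_def)
      then have 1: "(\<Sum>i. emeasure \<nu> (A i)) = emeasure \<nu> (\<Union>i. A i)"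
        using disj by (rule suminf_emeasure)
      have 2: "(\<Sum>i. c (A i)) = c (\<Union>i. A i)"
      proof (cases "\<forall>i. cap (A i - \<Omega>) = 0")
        case True
        then have "cap (\<Union>i. A i - \<Omega>) = 0" by (intro cap_UN_null) auto
        moreover have "(\<Union>i. A i) - \<Omega> = (\<Union>i. A i - \<Omega>)" by blast
        ultimately have "cap ((\<Union>i. A i) - \<Omega>) = 0" by (simp only:)
        then show ?thesis using True by (simp add: c_def)
      next
        case False
        then obtain i where i: "cap (A i - \<Omega>) \<noteq> 0" by blast
        have "c (A i) \<le> (\<Sum>i. c (A i))"
          using sum_le_suminf[OF summableI, of "{i}" "\<lambda>i. c (A i)"] by simp
        moreover have "cap ((\<Union>i. A i) - \<Omega>) \<noteq> 0"
          using i cap_subset_null[of "A i - \<Omega>" "(\<Union>i. A i) - \<Omega>"] by blast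
        ultimately show ?thesis using i by (simp add: c_def top_unique)
      qed
      have "(\<Sum>i. \<mu> (A i)) = (\<Sum>i. emeasure \<nu> (A i) + c (A i))" by (simp add: \<mu>[OF A'])
      also have "\<dots> = (\<Sum>i. emeasure \<nu> (A i)) + (\<Sum>i. c (A i))"
        by (rule suminf_add[OF summableI summableI, symmetric])
      finally show "(\<Sum>i. \<mu> (A i)) = \<mu> (\<Union>i. A i)" by (simp add: 1 2 \<mu>[OF U])
    qed
  qed
  then show ?thesis using \<mu>[OF E] by (simp add: \<nu>_def c_def)
qed

lemma potential_measure_in_M_cap: "potential_measure \<Omega> V \<in> M_cap \<Omega>"
  unfolding M_cap_def capacitary_measure_def mem_Collect_eq
proof (intro conjI ballI impI)
  show "sets (potential_measure \<Omega> V) = sets borel" by (rule sets_potential_measure)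
next
  fix E :: "'a set" assume E: "E \<in> sets borel" and cap: "cap E = 0"
  have "emeasure lebesgue E \<le> 0"
    using emeasure_le_cap[OF borel_imp_lebesgue[OF E]] cap by simp
  then have "E \<in> null_sets lebesgue"
    using borel_imp_lebesgue[OF E] by (intro null_setsI) (auto simp only: le_zero_eq)
  then have "AE x in lebesgue. x \<notin> E" by (rule AE_not_in)
  then have "emeasure (density lebesgue (potential_density \<Omega> V)) E = 0"
    unfolding emeasure_density[OF V borel_imp_lebesgue[OF E]]
    by (subst nn_integral_cong_AE[where v = "\<lambda>x. 0"]) (auto elim!: eventually_mono)
  moreover have "cap (E - \<Omega>) = 0" by (rule cap_subset_null[OF _ cap]) blast
  ultimately show "emeasure (potential_measure \<Omega> V) E = 0"
    by (simp add: emeasure_potential_measure[OF E])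
next
  fix E :: "'a set" assume E: "E \<in> sets borel" and cap: "0 < cap (E - \<Omega>)"
  from cap have "cap (E - \<Omega>) \<noteq> 0" by simp
  then show "emeasure (potential_measure \<Omega> V) E = \<infinity>"
    by (simp add: emeasure_potential_measure[OF E])
qed

text \<open>If \<open>g\<close> vanishes quasi-everywhere outside \<open>\<Omega>\<close>, then on subsets of \<open>{g \<noteq> 0}\<close> the measure has no singular
part. Otherwise some level set \<open>{g \<ge> 1 / n}\<close> has infinite measure.\<close>

lemma nn_integral_potential_measure:
  assumes g [measurable]: "g \<in> borel_measurable borel"
  shows "(\<integral>\<^sup>+x. g x \<partial>potential_measure \<Omega> V)
    = (\<integral>\<^sup>+x. potential_density \<Omega> V x * g x \<partial>lebesgue) + (if cap ({x. g x \<noteq> 0} - \<Omega>) = 0 then 0 else \<infinity>)"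
proof -
  define \<mu> where "\<mu> = potential_measure \<Omega> V"
  have sets_\<mu> [measurable_cong]: "sets \<mu> = sets borel" by (simp add: \<mu>_def sets_potential_measure)
  define N where "N = {x. g x \<noteq> 0}"
  have N [measurable]: "N \<in> sets borel" unfolding N_def by measurable
  show ?thesis
  proof (cases "cap (N - \<Omega>) = 0")
    case True
    define \<nu> where "\<nu> = distr (density lebesgue (potential_density \<Omega> V)) borel (\<lambda>x. x)"
    have id: "(\<lambda>x. x) \<in> density lebesgue (potential_density \<Omega> V) \<rightarrow>\<^sub>M borel"
      by (simp add: measurable_completion)
    have sets_\<nu> [measurable_cong]: "sets \<nu> = sets borel" by (simp add: \<nu>_def)
    have "density \<mu> (indicator N) = density \<nu> (indicator N)"
    proof (rule measure_eqI)
      fix A assume "A \<in> sets (density \<mu> (indicator N))"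
      then have A: "A \<in> sets borel" by (simp add: sets_\<mu>)
      have NA: "N \<inter> A \<in> sets borel" using A by simp
      have "cap (N \<inter> A - \<Omega>) = 0" by (rule cap_subset_null[OF _ True]) blast
      then have "emeasure \<mu> (N \<inter> A) = emeasure \<nu> (N \<inter> A)"
        unfolding \<mu>_def \<nu>_def emeasure_potential_measure[OF NA] emeasure_distr[OF id NA] by simp
      moreover have "emeasure (density M (indicator N)) A = emeasure M (N \<inter> A)" if "sets M = sets borel" for M
      proof -
        have "emeasure (density M (indicator N)) A = (\<integral>\<^sup>+x. indicator N x * indicator A x \<partial>M)"
          using A N that by (intro emeasure_density borel_measurable_indicator) simp_all
        also have "\<dots> = (\<integral>\<^sup>+x. indicator (N \<inter> A) x \<partial>M)"
          by (intro nn_integral_cong) (simp add: indicator_def)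
        finally show ?thesis using NA that by simp
      qed
      ultimately show "emeasure (density \<mu> (indicator N)) A = emeasure (density \<nu> (indicator N)) A"
        by (simp add: sets_\<mu> sets_\<nu>)
    qed (simp add: sets_\<mu> sets_\<nu>)
    then have "(\<integral>\<^sup>+x. g x \<partial>density \<mu> (indicator N)) = (\<integral>\<^sup>+x. g x \<partial>density \<nu> (indicator N))" by simp
    moreover have "(\<integral>\<^sup>+x. g x \<partial>density M (indicator N)) = (\<integral>\<^sup>+x. g x \<partial>M)" if [measurable_cong]: "sets M = sets borel" for M
    proof -
      have "(\<integral>\<^sup>+x. g x \<partial>density M (indicator N)) = (\<integral>\<^sup>+x. indicator N x * g x \<partial>M)"
        by (rule nn_integral_density) measurable
      also have "\<dots> = (\<integral>\<^sup>+x. g x \<partial>M)"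
        by (intro nn_integral_cong) (simp add: N_def indicator_def)
      finally show ?thesis .
    qed
    ultimately have "(\<integral>\<^sup>+x. g x \<partial>\<mu>) = (\<integral>\<^sup>+x. g x \<partial>\<nu>)" by (simp add: sets_\<mu> sets_\<nu>)
    also have "\<dots> = (\<integral>\<^sup>+x. g x \<partial>density lebesgue (potential_density \<Omega> V))"
      unfolding \<nu>_def by (rule nn_integral_distr[OF id]) simp
    also have "\<dots> = (\<integral>\<^sup>+x. potential_density \<Omega> V x * g x \<partial>lebesgue)"
      by (rule nn_integral_density[OF V]) (simp add: measurable_completion)
    finally show ?thesis using True by (simp add: \<mu>_def N_def)
  next
    case False
    define G where "G n = {x. ennreal (1 / Suc n) \<le> g x}" for n
    have N_eq: "N = (\<Union>n. G n)"
    proof (intro set_eqI iffI)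
      fix x assume "x \<in> N"
      then have "0 < g x" by (simp add: N_def zero_less_iff_neq_zero)
      then obtain b where b: "0 < b" "b < g x" using dense by blast
      then have "b < \<infinity>" by (auto intro: less_le_trans)
      then obtain e where e: "b = ennreal e" "0 < e" using b(1) by (cases b) (auto simp: ennreal_less_zero_iff)
      obtain n where "1 / Suc n < e" using nat_approx_posE[OF e(2)] by auto
      then have "ennreal (1 / Suc n) \<le> b" unfolding e(1) by (intro ennreal_leI) simp
      then have "ennreal (1 / Suc n) \<le> g x" using b(2) by simp
      then show "x \<in> (\<Union>n. G n)" by (auto simp: G_def)
    next
      fix x assume "x \<in> (\<Union>n. G n)"
      then obtain n where "ennreal (1 / Suc n) \<le> g x" by (auto simp: G_def)
      moreover have "0 < ennreal (1 / Suc n)" by simp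
      ultimately have "0 < g x" by (rule less_le_trans[rotated])
      then show "x \<in> N" by (auto simp: N_def)
    qed
    have G [measurable]: "G n \<in> sets borel" for n unfolding G_def by measurable
    have "\<exists>n. cap (G n - \<Omega>) \<noteq> 0"
    proof (rule ccontr)
      assume "\<not> ?thesis"
      then have "cap (\<Union>n. G n - \<Omega>) = 0" by (intro cap_UN_null) auto
      moreover have "(\<Union>n. G n) - \<Omega> = (\<Union>n. G n - \<Omega>)" by blast
      ultimately show False using False unfolding N_eq by (simp only: simp_thms)
    qed
    then obtain n where n: "cap (G n - \<Omega>) \<noteq> 0" by blast
    have "emeasure \<mu> (G n) = \<infinity>" using n by (simp add: \<mu>_def emeasure_potential_measure[OF G])
    then have "\<infinity> = ennreal (1 / Suc n) * emeasure \<mu> (G n)"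
      by (simp add: ennreal_mult_top del: of_nat_Suc)
    also have "\<dots> = (\<integral>\<^sup>+x. ennreal (1 / Suc n) * indicator (G n) x \<partial>\<mu>)"
      by (rule nn_integral_cmult_indicator[symmetric]) simp
    also have "\<dots> \<le> (\<integral>\<^sup>+x. g x \<partial>\<mu>)"
      by (intro nn_integral_mono) (simp add: G_def indicator_def del: of_nat_Suc)
    finally have "(\<integral>\<^sup>+x. g x \<partial>\<mu>) = \<infinity>" by (simp add: top_unique)
    then show ?thesis using False by (simp add: \<mu>_def N_def)
  qed
qed

lemma Q_potential_measure:
  "Q \<Omega> (potential_measure \<Omega> V) u = (if zero_ext \<Omega> u \<in> H10 \<Omega>
     then energy (zero_ext \<Omega> u) + (\<integral>\<^sup>+x. potential_density \<Omega> V x * ennreal ((zero_ext \<Omega> u x)\<^sup>2) \<partial>lebesgue)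
     else \<infinity>)"
proof (cases "zero_ext \<Omega> u \<in> H1")
  case False
  then show ?thesis using H10_H1 by (auto simp: Q_def)
next
  case True
  define w where "w = zero_ext \<Omega> u"
  define I where "I = (\<integral>\<^sup>+x. ennreal ((qc_rep w x)\<^sup>2) \<partial>potential_measure \<Omega> V)"
  have w: "w \<in> H1" using True by (simp add: w_def)
  have [measurable]: "qc_rep w \<in> borel_measurable borel" by (rule qc_rep(2)[OF w])
  have "{x. ennreal ((qc_rep w x)\<^sup>2) \<noteq> 0} = {x. qc_rep w x \<noteq> 0}"
    by (auto simp: ennreal_eq_0_iff)
  then have I: "I = (\<integral>\<^sup>+x. potential_density \<Omega> V x * ennreal ((qc_rep w x)\<^sup>2) \<partial>lebesgue)
      + (if w \<in> H10 \<Omega> then 0 else \<infinity>)"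
    unfolding I_def using H10_iff_qc_rep[OF w, of \<Omega>] by (subst nn_integral_potential_measure) auto
  have ae: "(\<integral>\<^sup>+x. potential_density \<Omega> V x * ennreal ((qc_rep w x)\<^sup>2) \<partial>lebesgue)
      = (\<integral>\<^sup>+x. potential_density \<Omega> V x * ennreal ((w x)\<^sup>2) \<partial>lebesgue)"
    using qc_rep(3)[OF w] by (intro nn_integral_cong_AE) (auto elim: eventually_mono)
  have "Q \<Omega> (potential_measure \<Omega> V) u = (if I < \<infinity> then energy w + I else \<infinity>)"
    using w dirichlet_eq_energy[OF w] by (simp add: Q_def w_def[symmetric] I_def[symmetric])
  also have "\<dots> = energy w + I" by (auto simp: less_top[symmetric])
  finally show ?thesis using I ae by (simp add: w_def)
qed

end


section \<open>Sequences in weakly compact sets of potentials\<close>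

definition sequence_cluster_point :: "'b topology \<Rightarrow> (nat \<Rightarrow> 'b) \<Rightarrow> 'b \<Rightarrow> bool" where
  "sequence_cluster_point X x a \<longleftrightarrow> (\<forall>U N. openin X U \<longrightarrow> a \<in> U \<longrightarrow> (\<exists>n\<ge>N. x n \<in> U))"

lemma sequence_cluster_pointD:
  "sequence_cluster_point X x a \<Longrightarrow> openin X U \<Longrightarrow> a \<in> U \<Longrightarrow> \<exists>n\<ge>N. x n \<in> U"
  by (simp add: sequence_cluster_point_def)

lemma compactin_sequence_cluster_point:
  assumes K: "compactin X K" and x: "\<And>n. x n \<in> K"
  shows "\<exists>a\<in>K. sequence_cluster_point X x a"
proof (rule ccontr)
  assume none: "\<not> ?thesis"
  define P where "P a U N \<longleftrightarrow> openin X U \<and> a \<in> U \<and> (\<forall>n\<ge>N. x n \<notin> U)" for a U N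
  have "\<exists>U N. P a U N" if "a \<in> K" for a
  proof -
    have "\<not> sequence_cluster_point X x a" using none that by blast
    then show ?thesis unfolding sequence_cluster_point_def P_def not_all not_imp by simp
  qed
  then obtain U N where "\<And>a. a \<in> K \<Longrightarrow> P a (U a) (N a)" by metis
  then have U: "\<And>a. a \<in> K \<Longrightarrow> openin X (U a)" "\<And>a. a \<in> K \<Longrightarrow> a \<in> U a"
    and N: "\<And>a n. a \<in> K \<Longrightarrow> N a \<le> n \<Longrightarrow> x n \<notin> U a"
    unfolding P_def by blast+
  have "\<forall>u\<in>U ` K. openin X u" "K \<subseteq> \<Union>(U ` K)" using U by blast+
  with K have "\<exists>F. finite F \<and> F \<subseteq> U ` K \<and> K \<subseteq> \<Union>F"
    unfolding compactin_def by simp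
  then obtain F where F: "finite F" "F \<subseteq> U ` K" "K \<subseteq> \<Union>F" by blast
  then obtain C where C: "finite C" "C \<subseteq> K" "F = U ` C" by (meson finite_subset_image)
  define m where "m = Max (N ` C)"
  have "x m \<in> K" by (rule x)
  then obtain a where a: "a \<in> C" "x m \<in> U a" using F C by blast
  have "N a \<le> m" unfolding m_def using a C by (intro Max_ge) auto
  then show False using N[of a m] a C by blast
qed

lemma strict_mono_selection:
  assumes "\<And>k N. \<exists>n\<ge>N. P k (n :: nat)"
  obtains r :: "nat \<Rightarrow> nat" where "strict_mono r" "\<And>k. P k (r k)"
proof -
  have "\<exists>r. \<forall>k. P k (r k) \<and> r k < r (Suc k)"
  proof (rule dependent_nat_choice)
    show "\<exists>n. P 0 n" using assms by blast
    show "\<exists>n'. P (Suc k) n' \<and> n < n'" for n k using assms[where k = "Suc k" and N = "Suc n"] by (auto simp: Suc_le_eq)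
  qed
  then show thesis using that by (auto simp: strict_mono_Suc_iff)
qed

lemma level_set_approximation:
  fixes t :: real
  assumes "0 \<le> t" "t \<le> real n"
  shows "\<bar>t - (\<Sum>j\<in>{1..n}. if real j \<le> t then 1 else 0)\<bar> \<le> 1"
proof -
  have "{j \<in> {1..n}. real j \<le> t} = {1..nat \<lfloor>t\<rfloor>}"
    using assms by (auto simp: le_nat_iff le_floor_iff)
  then have "(\<Sum>j\<in>{1..n}. if real j \<le> t then 1 else 0 :: real) = real (nat \<lfloor>t\<rfloor>)"
    by (simp add: sum.If_cases Int_def conj_commute)
  then show ?thesis using assms by linarith
qed

definition mass :: "'a::euclidean_space set \<Rightarrow> 'a set \<Rightarrow> ('a \<Rightarrow> real) \<Rightarrow> real" where
  "mass \<Omega> A f = (\<integral>x. indicator A x * f x \<partial>lebesgue_on \<Omega>)"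

text \<open>The trace of weak \<open>L\<^sup>1\<close> convergence that is used below: the masses of all measurable sets converge.
The weakly compact set \<open>K\<close> is part of the notion because its uniform integrability is what makes setwise
convergence effective.\<close>

definition converges_on_sets ::
    "'a::euclidean_space set \<Rightarrow> ('a \<Rightarrow> real) set \<Rightarrow> (nat \<Rightarrow> 'a \<Rightarrow> real) \<Rightarrow> ('a \<Rightarrow> real) \<Rightarrow> bool" where
  "converges_on_sets \<Omega> K W V \<longleftrightarrow> (\<forall>n. W n \<in> K) \<and> V \<in> K \<and>
     (\<forall>A\<in>sets lebesgue. (\<lambda>n. mass \<Omega> A (W n)) \<longlonglongrightarrow> mass \<Omega> A V)"

context
  fixes \<Omega> :: "'a::euclidean_space set"
  assumes \<Omega>: "\<Omega> \<in> sets lebesgue"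
begin

lemma L1_integrable_bounded_mult:
  fixes f \<phi> :: "'a \<Rightarrow> real"
  assumes f: "f \<in> L1 \<Omega>" and \<phi>: "\<phi> \<in> borel_measurable lebesgue" and M: "\<And>x. \<bar>\<phi> x\<bar> \<le> M"
  shows "integrable (lebesgue_on \<Omega>) (\<lambda>x. \<phi> x * f x)"
proof (rule Bochner_Integration.integrable_bound)
  show "integrable (lebesgue_on \<Omega>) (\<lambda>x. M * f x)" using f by (simp add: L1_def)
  show "(\<lambda>x. \<phi> x * f x) \<in> borel_measurable (lebesgue_on \<Omega>)"
    using f by (intro borel_measurable_times measurable_restrict_space1[OF \<phi>]) (auto simp: L1_def)
  show "AE x in lebesgue_on \<Omega>. norm (\<phi> x * f x) \<le> norm (M * f x)"
  proof (rule AE_I2)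
    fix x
    have "\<bar>\<phi> x\<bar> * \<bar>f x\<bar> \<le> \<bar>M\<bar> * \<bar>f x\<bar>" using M[of x] by (intro mult_right_mono) auto
    then show "norm (\<phi> x * f x) \<le> norm (M * f x)" by (simp add: abs_mult)
  qed
qed

lemma mass_integrable:
  "f \<in> L1 \<Omega> \<Longrightarrow> A \<in> sets lebesgue \<Longrightarrow> integrable (lebesgue_on \<Omega>) (\<lambda>x. indicator A x * f x)"
  by (rule L1_integrable_bounded_mult[of _ _ 1]) (auto simp: indicator_def)

lemma mass_in_L1_dual:
  assumes A: "A \<in> sets lebesgue"
  shows "mass \<Omega> A \<in> L1_dual \<Omega>"
proof -
  have "mass \<Omega> A (\<lambda>x. f x + g x) = mass \<Omega> A f + mass \<Omega> A g" if "f \<in> L1 \<Omega>" "g \<in> L1 \<Omega>" for f g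
    using mass_integrable[OF that(1) A] mass_integrable[OF that(2) A]
    by (simp add: mass_def distrib_left)
  moreover have "mass \<Omega> A (\<lambda>x. c * f x) = c * mass \<Omega> A f" for c f
    unfolding mass_def by (simp add: mult.left_commute)
  moreover have "\<bar>mass \<Omega> A f\<bar> \<le> 1 * (\<integral>x. \<bar>f x\<bar> \<partial>lebesgue_on \<Omega>)" if "f \<in> L1 \<Omega>" for f
  proof -
    have "\<bar>mass \<Omega> A f\<bar> \<le> (\<integral>x. \<bar>indicator A x * f x\<bar> \<partial>lebesgue_on \<Omega>)"
      unfolding mass_def by (rule integral_abs_bound)
    also have "\<dots> \<le> (\<integral>x. \<bar>f x\<bar> \<partial>lebesgue_on \<Omega>)"
      using that mass_integrable[OF that A]
      by (intro integral_mono integrable_abs) (auto simp: L1_def indicator_def)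
    finally show ?thesis by simp
  qed
  ultimately show ?thesis unfolding L1_dual_def mem_Collect_eq by blast
qed

lemma openin_weak_L1_mass:
  assumes "A \<in> sets lebesgue" "open U"
  shows "openin (weak_L1 \<Omega>) {f \<in> L1 \<Omega>. mass \<Omega> A f \<in> U}"
  unfolding weak_L1_def using mass_in_L1_dual[OF assms(1)] assms(2)
  by (intro topology_generated_by_Basis) blast

lemma L1_pos_L1: "f \<in> L1_pos \<Omega> \<Longrightarrow> f \<in> L1 \<Omega>"
  by (simp add: L1_pos_def)

lemma mass_mono:
  assumes f: "f \<in> L1_pos \<Omega>" and AB: "A \<subseteq> B" "A \<in> sets lebesgue" "B \<in> sets lebesgue"
  shows "mass \<Omega> A f \<le> mass \<Omega> B f"
  unfolding mass_def
proof (rule integral_mono_AE)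
  have "AE x in lebesgue_on \<Omega>. 0 \<le> f x" using f by (simp add: L1_pos_def)
  then show "AE x in lebesgue_on \<Omega>. indicator A x * f x \<le> indicator B x * f x"
    by eventually_elim (use AB(1) in \<open>auto simp: indicator_def\<close>)
qed (intro mass_integrable L1_pos_L1 f AB)+

lemma mass_nonneg: "f \<in> L1_pos \<Omega> \<Longrightarrow> 0 \<le> mass \<Omega> A f"
  unfolding mass_def L1_pos_def by (intro integral_nonneg_AE) (auto elim!: eventually_mono)

lemma mass_decreasing_tendsto_0:
  assumes f: "f \<in> L1 \<Omega>" and T: "\<And>m. T m \<in> sets lebesgue"
    and null: "AE x in lebesgue. eventually (\<lambda>m. x \<notin> T m) sequentially"
  shows "(\<lambda>m. mass \<Omega> (T m) f) \<longlonglongrightarrow> 0"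
proof -
  have "(\<lambda>m. \<integral>x. indicator (T m) x * f x \<partial>lebesgue_on \<Omega>) \<longlonglongrightarrow> (\<integral>x. 0 \<partial>lebesgue_on \<Omega>)"
  proof (rule integral_dominated_convergence)
    show "integrable (lebesgue_on \<Omega>) (\<lambda>x. \<bar>f x\<bar>)" using f by (simp add: L1_def)
    show "(\<lambda>x. indicator (T m) x * f x) \<in> borel_measurable (lebesgue_on \<Omega>)" for m
      using mass_integrable[OF f T] by (rule borel_measurable_integrable)
    have "AE x in lebesgue_on \<Omega>. eventually (\<lambda>m. x \<notin> T m) sequentially"
      using null \<Omega> by (simp add: AE_restrict_space_iff) (auto elim: eventually_mono)
    then show "AE x in lebesgue_on \<Omega>. (\<lambda>m. indicator (T m) x * f x) \<longlonglongrightarrow> 0"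
    proof eventually_elim
      fix x assume "eventually (\<lambda>m. x \<notin> T m) sequentially"
      then have "eventually (\<lambda>m. indicator (T m) x * f x = 0) sequentially"
        by (rule eventually_mono) simp
      then show "(\<lambda>m. indicator (T m) x * f x) \<longlonglongrightarrow> 0" by (rule tendsto_eventually)
    qed
    show "AE x in lebesgue_on \<Omega>. norm (indicator (T m) x * f x) \<le> \<bar>f x\<bar>" for m
      by (rule AE_I2) (simp add: indicator_def)
  qed simp
  then show ?thesis by (simp add: mass_def)
qed

context
  fixes K :: "('a \<Rightarrow> real) set"
  assumes K: "compactin (weak_L1 \<Omega>) K" and K_pos: "K \<subseteq> L1_pos \<Omega>"
begin

lemma cluster_point_mass_ge:
  assumes a: "a \<in> K" "sequence_cluster_point (weak_L1 \<Omega>) x a"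
    and A: "A \<in> sets lebesgue" and ge: "\<And>n. n \<ge> m \<Longrightarrow> c \<le> mass \<Omega> A (x n)"
  shows "c \<le> mass \<Omega> A a"
proof (rule ccontr)
  assume "\<not> ?thesis"
  moreover have "a \<in> L1 \<Omega>" using a(1) K_pos L1_pos_L1 by blast
  ultimately have "a \<in> {f \<in> L1 \<Omega>. mass \<Omega> A f \<in> {..<c}}" by simp
  from sequence_cluster_pointD[OF a(2) openin_weak_L1_mass[OF A open_lessThan] this]
  obtain n where "n \<ge> m" "x n \<in> {f \<in> L1 \<Omega>. mass \<Omega> A f \<in> {..<c}}" by metis
  then show False using ge[of n] by simp
qed

lemma weakly_compact_mass_bounded:
  obtains C where "\<And>f. f \<in> K \<Longrightarrow> mass \<Omega> UNIV f \<le> C" "0 \<le> C"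
proof -
  have U: "UNIV \<in> sets (lebesgue :: 'a measure)" by simp
  have "\<exists>n::nat. \<forall>f\<in>K. mass \<Omega> UNIV f \<le> real n"
  proof (rule ccontr)
    assume "\<not> ?thesis"
    then have "\<forall>n. \<exists>f\<in>K. real n \<le> mass \<Omega> UNIV f" by (meson less_imp_le not_le)
    then obtain x where x: "\<And>n. x n \<in> K" "\<And>n. real n \<le> mass \<Omega> UNIV (x n)" by metis
    from compactin_sequence_cluster_point[OF K x(1)]
    obtain a where a: "a \<in> K" "sequence_cluster_point (weak_L1 \<Omega>) x a" ..
    have "real m \<le> mass \<Omega> UNIV a" for m
    proof (rule cluster_point_mass_ge[OF a U])
      fix n assume "m \<le> n"
      then have "real m \<le> real n" by simp
      then show "real m \<le> mass \<Omega> UNIV (x n)" using x(2) by (rule order_trans)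
    qed
    moreover obtain m :: nat where "mass \<Omega> UNIV a < real m" using reals_Archimedean2 by blast
    ultimately show False by (meson not_le)
  qed
  then obtain n :: nat where "\<forall>f\<in>K. mass \<Omega> UNIV f \<le> real n" by blast
  then show thesis using that[of "real n"] by auto
qed

text \<open>Choose \<open>x n\<close> with mass at least \<open>e\<close> on \<open>T n\<close>. As the potentials are nonnegative and the sets
decrease, \<open>x n\<close> has mass at least \<open>e\<close> on \<open>T m\<close> for all \<open>n \<ge> m\<close>. The mass of \<open>T m\<close> is weakly
continuous, so a cluster point has mass at least \<open>e\<close> on every \<open>T m\<close>, although these masses tend to zero.\<close>

lemma weakly_compact_uniformly_small:
  assumes T: "\<And>m. T m \<in> sets lebesgue" and dec: "\<And>m n. m \<le> n \<Longrightarrow> T n \<subseteq> T m"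
    and null: "AE x in lebesgue. eventually (\<lambda>m. x \<notin> T m) sequentially" and e: "0 < e"
  obtains m where "\<And>f. f \<in> K \<Longrightarrow> mass \<Omega> (T m) f \<le> e"
proof -
  have "\<exists>m. \<forall>f\<in>K. mass \<Omega> (T m) f \<le> e"
  proof (rule ccontr)
    assume "\<not> ?thesis"
    then have "\<forall>m. \<exists>f\<in>K. e \<le> mass \<Omega> (T m) f" by (meson less_imp_le not_le)
    then obtain x where x: "\<And>n. x n \<in> K" "\<And>n. e \<le> mass \<Omega> (T n) (x n)" by metis
    from compactin_sequence_cluster_point[OF K x(1)]
    obtain a where a: "a \<in> K" "sequence_cluster_point (weak_L1 \<Omega>) x a" ..
    have "e \<le> mass \<Omega> (T m) a" for m
    proof (rule cluster_point_mass_ge[OF a T])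
      fix n assume "m \<le> n"
      then have "mass \<Omega> (T n) (x n) \<le> mass \<Omega> (T m) (x n)"
        using x(1) K_pos by (intro mass_mono dec T) auto
      then show "e \<le> mass \<Omega> (T m) (x n)" using x(2) by (rule order_trans[rotated])
    qed
    moreover have "a \<in> L1 \<Omega>" using a(1) K_pos L1_pos_L1 by blast
    ultimately have "e \<le> 0"
      by (intro LIMSEQ_le_const[OF mass_decreasing_tendsto_0[OF _ T null]]) auto
    then show False using e by simp
  qed
  then show thesis using that by blast
qed

lemma converges_on_sets_subseq:
  "converges_on_sets \<Omega> K W V \<Longrightarrow> strict_mono s \<Longrightarrow> converges_on_sets \<Omega> K (\<lambda>k. W (s k)) V"
  unfolding converges_on_sets_def using LIMSEQ_subseq_LIMSEQ[of _ _ s] by (auto simp: comp_def)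

lemma mass_disjoint_Un:
  assumes "f \<in> L1 \<Omega>" "A \<in> sets lebesgue" "B \<in> sets lebesgue" "A \<inter> B = {}"
  shows "mass \<Omega> (A \<union> B) f = mass \<Omega> A f + mass \<Omega> B f"
proof -
  have "indicator (A \<union> B) x * f x = indicator A x * f x + indicator B x * f x" for x
    using assms(4) by (auto simp: indicator_def)
  then show ?thesis
    using mass_integrable[OF assms(1,2)] mass_integrable[OF assms(1,3)] by (simp add: mass_def)
qed

text \<open>Finite intersections of a countable basis of the topology form a countable \<open>\<pi>\<close>-system \<open>G\<close> that contains
the whole space and generates the Borel sets. A subsequence along which the masses of the members of
\<open>G\<close> converge is selected near a cluster point; the sets with convergent masses form a Dynkin system,
where for countable disjoint unions the tails are uniformly small.\<close>

lemma converging_subsequence_on_sets: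
  fixes x :: "nat \<Rightarrow> 'a \<Rightarrow> real"
  assumes x: "\<And>n. x n \<in> K"
  obtains V r where "strict_mono r" "converges_on_sets \<Omega> K (\<lambda>k. x (r k)) V"
proof -
  obtain B :: "'a set set" where B: "countable B" "topological_basis B"
    using ex_countable_basis by blast
  define G where "G = {\<Inter>F | F. F \<subseteq> B \<and> finite F}"
  have B_open: "open b" if "b \<in> B" for b using topological_basis_open[OF B(2) that] .
  have "countable {F. F \<subseteq> B \<and> finite F}"
    using countable_Collect_finite_subset[OF B(1)] by (simp add: conj_commute)
  then have "countable (Inter ` {F. F \<subseteq> B \<and> finite F})" by (rule countable_image)
  moreover have "G = Inter ` {F. F \<subseteq> B \<and> finite F}" by (auto simp: G_def)
  ultimately have G_count: "countable G" by simp
  have "UNIV = \<Inter>({} :: 'a set set)" by simp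
  then have UNIV_G: "UNIV \<in> G" unfolding G_def by blast
  have G_borel: "A \<in> sets borel" if "A \<in> G" for A
  proof -
    obtain F where F: "F \<subseteq> B" "finite F" "A = \<Inter>F" using \<open>A \<in> G\<close> by (auto simp: G_def)
    then have "open A" using B_open by (auto intro!: open_Inter)
    then show ?thesis by simp
  qed
  have G_stable: "Int_stable G"
    unfolding Int_stable_def
  proof (intro ballI)
    fix a b assume "a \<in> G" "b \<in> G"
    then obtain F H where FH: "F \<subseteq> B" "finite F" "a = \<Inter>F" "H \<subseteq> B" "finite H" "b = \<Inter>H"
      by (auto simp: G_def)
    then have "F \<union> H \<subseteq> B \<and> finite (F \<union> H) \<and> a \<inter> b = \<Inter>(F \<union> H)" by auto
    then show "a \<inter> b \<in> G" unfolding G_def by blast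
  qed
  have "B \<subseteq> G"
  proof
    fix b assume "b \<in> B"
    then have "{b} \<subseteq> B \<and> finite {b} \<and> b = \<Inter>{b}" by simp
    then show "b \<in> G" unfolding G_def by blast
  qed
  then have "sigma_sets UNIV B \<subseteq> sigma_sets UNIV G" by (rule sigma_sets_mono')
  moreover have "sets (borel :: 'a measure) = sigma_sets UNIV B"
    unfolding borel_eq_countable_basis[OF B] by (rule sets_measure_of) simp
  ultimately have borel_G: "sets borel \<subseteq> sigma_sets UNIV G" by simp
  define E where "E = from_nat_into G"
  have E: "range E = G" unfolding E_def using UNIV_G by (intro range_from_nat_into G_count) auto
  have E_sets: "E j \<in> sets lebesgue" for j
    using E G_borel borel_imp_lebesgue by blast
  from compactin_sequence_cluster_point[OF K x]
  obtain V where V: "V \<in> K" "sequence_cluster_point (weak_L1 \<Omega>) x V" ..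
  have KL1: "f \<in> L1 \<Omega>" if "f \<in> K" for f using that K_pos L1_pos_L1 by blast
  define P where "P k n \<longleftrightarrow> (\<forall>j\<le>k. \<bar>mass \<Omega> (E j) (x n) - mass \<Omega> (E j) V\<bar> < 1 / Suc k)" for k n
  have "\<exists>n\<ge>N. P k n" for k N
  proof -
    define U where "U = (\<Inter>j\<in>{..k}. {f \<in> L1 \<Omega>. mass \<Omega> (E j) f \<in> ball (mass \<Omega> (E j) V) (1 / Suc k)})"
    have "openin (weak_L1 \<Omega>) U"
      unfolding U_def by (intro openin_INT2 openin_weak_L1_mass E_sets) auto
    moreover have "V \<in> U" unfolding U_def using KL1[OF V(1)] by (auto simp del: of_nat_Suc)
    ultimately obtain n where n: "n \<ge> N" "x n \<in> U"
      using sequence_cluster_pointD[OF V(2)] by metis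
    then have "P k n"
      unfolding U_def P_def by (auto simp: dist_real_def abs_minus_commute simp del: of_nat_Suc)
    then show ?thesis using n(1) by blast
  qed
  then obtain r where "strict_mono r" "\<And>k. P k (r k)"
    using strict_mono_selection[of P] by blast
  then have r: "strict_mono r"
    "\<And>k. \<forall>j\<le>k. \<bar>mass \<Omega> (E j) (x (r k)) - mass \<Omega> (E j) V\<bar> < 1 / Suc k"
    by (auto simp: P_def)
  define W where "W k = x (r k)" for k
  have W: "W k \<in> K" for k using x by (simp add: W_def)
  have W_lim: "(\<lambda>k. mass \<Omega> (E j) (W k)) \<longlonglongrightarrow> mass \<Omega> (E j) V" for j
  proof (rule Lim_null[THEN iffD2], rule Lim_null_comparison)
    show "\<forall>\<^sub>F k in sequentially. norm (mass \<Omega> (E j) (W k) - mass \<Omega> (E j) V) \<le> 1 / Suc k"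
      using r(2) by (intro eventually_sequentiallyI[of j]) (auto simp: W_def intro: less_imp_le)
    show "(\<lambda>k. 1 / real (Suc k)) \<longlonglongrightarrow> 0" by (rule LIMSEQ_inverse_real_of_nat[unfolded inverse_eq_divide])
  qed
  have borel_lim: "(\<lambda>k. mass \<Omega> A (W k)) \<longlonglongrightarrow> mass \<Omega> A V" if "A \<in> sets borel" for A
  proof -
    have A: "A \<in> sigma_sets UNIV G" using that borel_G by blast
    have "G \<subseteq> Pow UNIV" by simp
    from G_stable this A show ?thesis
    proof (induction rule: sigma_sets_induct_disjoint)
      case (basic A)
      then obtain j where "A = E j" using E by blast
      then show ?case using W_lim by simp
    next
      case empty
      show ?case by (simp add: mass_def)
    next
      case (compl A)
      have "sigma_sets UNIV G \<subseteq> sets borel"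
        using sets.sigma_sets_subset[of G borel] G_borel by auto
      then have A: "A \<in> sets lebesgue" using compl borel_imp_lebesgue by blast
      then have cA: "UNIV - A \<in> sets lebesgue" by auto
      have eq: "mass \<Omega> (UNIV - A) f = mass \<Omega> UNIV f - mass \<Omega> A f" if "f \<in> K" for f
        using mass_disjoint_Un[OF KL1[OF that] A cA] by simp
      obtain j where "E j = UNIV" using E UNIV_G by blast
      then have "(\<lambda>k. mass \<Omega> UNIV (W k)) \<longlonglongrightarrow> mass \<Omega> UNIV V" using W_lim[of j] by simp
      then show ?case unfolding eq[OF W] eq[OF V(1)] using compl by (intro tendsto_diff) auto
    next
      case (union A)
      have "sigma_sets UNIV G \<subseteq> sets borel"
        using sets.sigma_sets_subset[of G borel] G_borel by auto
      then have A: "A i \<in> sets lebesgue" for i using union borel_imp_lebesgue by blast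
      define S where "S m = (\<Union>i\<in>{..<m}. A i)" for m
      define T where "T m = (\<Union>i\<in>{m..}. A i)" for m
      have S: "S m \<in> sets lebesgue" and T: "T m \<in> sets lebesgue" for m
        unfolding S_def T_def using A by auto
      have ST: "(\<Union>i. A i) = S m \<union> T m" "S m \<inter> T m = {}" for m
      proof -
        have "{..<m} \<union> {m..} = UNIV" by auto
        then show "(\<Union>i. A i) = S m \<union> T m" unfolding S_def T_def UN_Un[symmetric] by simp
        show "S m \<inter> T m = {}"
        proof (rule ccontr)
          assume "S m \<inter> T m \<noteq> {}"
          then obtain z i j where "i < m" "m \<le> j" "z \<in> A i" "z \<in> A j" by (auto simp: S_def T_def)
          moreover from this have "A i \<inter> A j = {}"
            using disjoint_family_onD[OF union(1), of i j] by simp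
          ultimately show False by blast
        qed
      qed
      have split: "mass \<Omega> (\<Union>i. A i) f = mass \<Omega> (S m) f + mass \<Omega> (T m) f" if "f \<in> K" for f m
        unfolding ST(1)[of m] by (rule mass_disjoint_Un[OF KL1[OF that] S T ST(2)])
      have S_lim: "(\<lambda>k. mass \<Omega> (S m) (W k)) \<longlonglongrightarrow> mass \<Omega> (S m) V" for m
      proof (induction m)
        case 0
        show ?case by (simp add: S_def mass_def)
      next
        case (Suc m)
        have SSuc: "S (Suc m) = S m \<union> A m" by (auto simp: S_def lessThan_Suc)
        have disj: "S m \<inter> A m = {}" using ST(2)[of m] by (auto simp: T_def)
        have eq: "mass \<Omega> (S (Suc m)) f = mass \<Omega> (S m) f + mass \<Omega> (A m) f" if "f \<in> K" for f
          unfolding SSuc by (rule mass_disjoint_Un[OF KL1[OF that] S A disj])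
        show ?case unfolding eq[OF W] eq[OF V(1)] by (intro tendsto_add Suc union)
      qed
      show ?case
      proof (rule LIMSEQ_I)
        fix e :: real assume "0 < e"
        then have e3: "0 < e / 3" by simp
        have dec: "T n \<subseteq> T m" if "m \<le> n" for m n
          unfolding T_def using that by (intro UN_mono) auto
        have null: "AE z in lebesgue. eventually (\<lambda>m. z \<notin> T m) sequentially"
        proof (rule AE_I2)
          fix z
          show "eventually (\<lambda>m. z \<notin> T m) sequentially"
          proof (cases "z \<in> (\<Union>i. A i)")
            case True
            then obtain i where i: "z \<in> A i" by blast
            have "z \<notin> T (Suc i)"
              using i ST(2)[of "Suc i"] by (auto simp: S_def)
            then show ?thesis using dec by (intro eventually_sequentiallyI[of "Suc i"]) blast
          qed (auto simp: T_def)
        qed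
        obtain m where m: "\<And>f. f \<in> K \<Longrightarrow> mass \<Omega> (T m) f \<le> e / 3"
          using weakly_compact_uniformly_small[OF T dec null e3] by blast
        obtain N where N: "\<And>k. k \<ge> N \<Longrightarrow> \<bar>mass \<Omega> (S m) (W k) - mass \<Omega> (S m) V\<bar> < e / 3"
          using LIMSEQ_D[OF S_lim e3] by auto
        have "norm (mass \<Omega> (\<Union>i. A i) (W k) - mass \<Omega> (\<Union>i. A i) V) < e" if "k \<ge> N" for k
        proof -
          have "0 \<le> mass \<Omega> (T m) (W k)" "0 \<le> mass \<Omega> (T m) V"
            using W V(1) K_pos by (auto intro: mass_nonneg)
          moreover have "\<bar>(a + p) - (b + q)\<bar> < e"
            if "0 \<le> p" "0 \<le> q" "\<bar>a - b\<bar> < e / 3" "p \<le> e / 3" "q \<le> e / 3" for a b p q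
            using that \<open>0 < e\<close> by linarith
          ultimately show ?thesis
            unfolding split[OF W, of _ m] split[OF V(1), of m] real_norm_def
            using N[OF that] m[OF W, of k] m[OF V(1)] by blast
        qed
        then show "\<exists>N. \<forall>k\<ge>N. norm (mass \<Omega> (\<Union>i. A i) (W k) - mass \<Omega> (\<Union>i. A i) V) < e" by blast
      qed
    qed
  qed
  have "(\<lambda>k. mass \<Omega> A (W k)) \<longlonglongrightarrow> mass \<Omega> A V" if A: "A \<in> sets lebesgue" for A
  proof -
    have "(indicator A :: 'a \<Rightarrow> real) \<in> borel_measurable lebesgue" using A by simp
    then obtain g where g: "g \<in> borel_measurable lborel" "AE z in lborel. indicator A z = (g z :: real)"
      using completion_ex_borel_measurable_real[of "indicator A" lborel] by blast
    define A' where "A' = g -` {1}"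
    have A': "A' \<in> sets borel"
      using measurable_sets[OF g(1), of "{1}"] by (simp add: A'_def)
    have "AE z in lebesgue. indicator A z = g z" using g(2) by (rule AE_completion)
    then have "AE z in lebesgue. indicator A z = (indicator A' z :: real)"
    proof eventually_elim
      fix z assume eq: "indicator A z = g z"
      show "indicator A z = (indicator A' z :: real)"
      proof (cases "z \<in> A")
        case True
        then have "g z = 1" using eq by simp
        then show ?thesis using True by (simp add: A'_def)
      next
        case False
        then have "g z = 0" using eq by simp
        then show ?thesis using False by (simp add: A'_def)
      qed
    qed
    then have ae: "AE z in lebesgue_on \<Omega>. indicator A z = (indicator A' z :: real)"
      using \<Omega> by (simp add: AE_restrict_space_iff) (auto elim: eventually_mono)
    have "mass \<Omega> A f = mass \<Omega> A' f" if "f \<in> K" for f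
      unfolding mass_def
    proof (rule integral_cong_AE)
      show "AE z in lebesgue_on \<Omega>. indicator A z * f z = indicator A' z * f z"
        using ae by eventually_elim simp
    qed (intro borel_measurable_integrable mass_integrable KL1 that A borel_imp_lebesgue A')+
    then show ?thesis using borel_lim[OF A'] W V(1) by simp
  qed
  then have "converges_on_sets \<Omega> K W V" using W V(1) by (simp add: converges_on_sets_def)
  then show thesis using that[OF r(1), of V] by (simp add: W_def[abs_def])
qed

text \<open>A bounded function is uniformly approximated by a combination of indicators of its level sets, and the
potentials in \<open>K\<close> have bounded mass.\<close>

lemma converges_on_sets_bounded_function:
  assumes WV: "converges_on_sets \<Omega> K W V" and \<phi>: "\<phi> \<in> borel_measurable lebesgue"
    and M: "\<And>x. 0 \<le> \<phi> x" "\<And>x. \<phi> x \<le> M"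
  shows "(\<lambda>k. \<integral>x. \<phi> x * W k x \<partial>lebesgue_on \<Omega>) \<longlonglongrightarrow> (\<integral>x. \<phi> x * V x \<partial>lebesgue_on \<Omega>)"
proof (rule LIMSEQ_I)
  fix e :: real assume e: "0 < e"
  obtain C where C: "\<And>f. f \<in> K \<Longrightarrow> mass \<Omega> UNIV f \<le> C" "0 \<le> C"
    using weakly_compact_mass_bounded by blast
  \<comment> \<open>Chosen so that an error \<open>h\<close> in the integrand costs at most \<open>e / 4\<close>, also when \<open>C = 0\<close>.\<close>
  define h where "h = e / (4 * (C + 1))"
  have h: "0 < h" "h * C \<le> e / 4"
    using e C(2) by (auto simp: h_def field_simps)
  obtain n :: nat where n: "M / h \<le> real n" using real_arch_simple by blast
  define A where "A j = {x. real j \<le> \<phi> x / h}" for j :: nat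
  have A: "A j \<in> sets lebesgue" for j
  proof -
    have "{x \<in> space lebesgue. real j \<le> \<phi> x / h} \<in> sets lebesgue"
      using \<phi> by (intro borel_measurable_le borel_measurable_const borel_measurable_divide)
    then show ?thesis by (simp add: A_def)
  qed
  define s where "s x = h * (\<Sum>j\<in>{1..n}. indicator (A j) x)" for x
  have s_near: "\<bar>\<phi> x - s x\<bar> \<le> h" for x
  proof -
    have "0 \<le> \<phi> x / h" using M(1) h by simp
    moreover have "\<phi> x / h \<le> real n" using M(2)[of x] n h by (smt (verit) divide_right_mono)
    ultimately have "\<bar>\<phi> x / h - (\<Sum>j\<in>{1..n}. if real j \<le> \<phi> x / h then 1 else 0)\<bar> \<le> 1"
      by (rule level_set_approximation)
    moreover have "(\<Sum>j\<in>{1..n}. if real j \<le> \<phi> x / h then 1 else 0 :: real) = (\<Sum>j\<in>{1..n}. indicator (A j) x)"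
      by (intro sum.cong) (auto simp: A_def)
    ultimately have "h * \<bar>\<phi> x / h - (\<Sum>j\<in>{1..n}. indicator (A j) x)\<bar> \<le> h * 1"
      using h by (intro mult_left_mono) auto
    also have "h * \<bar>\<phi> x / h - (\<Sum>j\<in>{1..n}. indicator (A j) x)\<bar> = \<bar>\<phi> x - s x\<bar>"
      using h by (simp add: s_def abs_mult[symmetric] abs_mult_pos' right_diff_distrib)
    finally show ?thesis by simp
  qed
  have s_int: "integrable (lebesgue_on \<Omega>) (\<lambda>x. s x * f x)"
    and s_eq: "(\<integral>x. s x * f x \<partial>lebesgue_on \<Omega>) = h * (\<Sum>j\<in>{1..n}. mass \<Omega> (A j) f)" if "f \<in> K" for f
  proof -
    have f: "f \<in> L1 \<Omega>" using that K_pos L1_pos_L1 by blast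
    have eq: "s x * f x = h * (\<Sum>j\<in>{1..n}. indicator (A j) x * f x)" for x
      by (simp add: s_def sum_distrib_right mult.assoc)
    show "integrable (lebesgue_on \<Omega>) (\<lambda>x. s x * f x)"
      unfolding eq by (intro integrable_mult_right Bochner_Integration.integrable_sum mass_integrable f A)
    show "(\<integral>x. s x * f x \<partial>lebesgue_on \<Omega>) = h * (\<Sum>j\<in>{1..n}. mass \<Omega> (A j) f)"
      unfolding eq mass_def
      by (subst integral_mult_right_zero, subst Bochner_Integration.integral_sum) (auto intro: mass_integrable f A)
  qed
  have near: "\<bar>(\<integral>x. \<phi> x * f x \<partial>lebesgue_on \<Omega>) - h * (\<Sum>j\<in>{1..n}. mass \<Omega> (A j) f)\<bar> \<le> e / 4" if fK: "f \<in> K" for f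
  proof -
    have f: "f \<in> L1_pos \<Omega>" using fK K_pos by blast
    have f1: "f \<in> L1 \<Omega>" using f by (rule L1_pos_L1)
    have "\<bar>\<phi> x\<bar> \<le> M" for x using M[of x] by simp
    then have \<phi>_int: "integrable (lebesgue_on \<Omega>) (\<lambda>x. \<phi> x * f x)"
      by (rule L1_integrable_bounded_mult[OF f1 \<phi>])
    have "\<bar>(\<integral>x. \<phi> x * f x \<partial>lebesgue_on \<Omega>) - (\<integral>x. s x * f x \<partial>lebesgue_on \<Omega>)\<bar>
        = \<bar>\<integral>x. \<phi> x * f x - s x * f x \<partial>lebesgue_on \<Omega>\<bar>"
      using \<phi>_int s_int[OF fK] by simp
    also have "\<dots> \<le> (\<integral>x. \<bar>\<phi> x * f x - s x * f x\<bar> \<partial>lebesgue_on \<Omega>)" by (rule integral_abs_bound)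
    also have "\<dots> \<le> (\<integral>x. h * (indicator UNIV x * f x) \<partial>lebesgue_on \<Omega>)"
    proof (rule integral_mono_AE)
      show "integrable (lebesgue_on \<Omega>) (\<lambda>x. h * (indicator UNIV x * f x))"
        by (intro integrable_mult_right mass_integrable f1) simp
      have "AE x in lebesgue_on \<Omega>. 0 \<le> f x" using f by (simp add: L1_pos_def)
      then show "AE x in lebesgue_on \<Omega>. \<bar>\<phi> x * f x - s x * f x\<bar> \<le> h * (indicator UNIV x * f x)"
      proof eventually_elim
        fix x assume "0 \<le> f x"
        then have "\<bar>\<phi> x - s x\<bar> * f x \<le> h * f x" using s_near by (rule mult_right_mono[rotated])
        moreover have "\<bar>\<phi> x * f x - s x * f x\<bar> = \<bar>\<phi> x - s x\<bar> * f x"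
          using \<open>0 \<le> f x\<close> by (simp add: left_diff_distrib[symmetric] abs_mult)
        ultimately show "\<bar>\<phi> x * f x - s x * f x\<bar> \<le> h * (indicator UNIV x * f x)" by simp
      qed
    qed (intro integrable_abs Bochner_Integration.integrable_diff \<phi>_int s_int fK)
    also have "\<dots> = h * mass \<Omega> UNIV f" by (simp add: mass_def)
    also have "\<dots> \<le> h * C" using h C(1)[OF fK] by (intro mult_left_mono) auto
    also have "\<dots> \<le> e / 4" by (rule h)
    finally show ?thesis by (simp add: s_eq[OF fK])
  qed
  have W: "W k \<in> K" and V: "V \<in> K" for k using WV by (auto simp: converges_on_sets_def)
  have "(\<lambda>k. h * (\<Sum>j\<in>{1..n}. mass \<Omega> (A j) (W k))) \<longlonglongrightarrow> h * (\<Sum>j\<in>{1..n}. mass \<Omega> (A j) V)"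
    using WV A by (intro tendsto_mult tendsto_const tendsto_sum) (auto simp: converges_on_sets_def)
  then obtain N where N: "\<And>k. k \<ge> N \<Longrightarrow>
      \<bar>h * (\<Sum>j\<in>{1..n}. mass \<Omega> (A j) (W k)) - h * (\<Sum>j\<in>{1..n}. mass \<Omega> (A j) V)\<bar> < e / 4"
    using LIMSEQ_D[of _ _ "e / 4"] e by fastforce
  have triangle: "\<bar>a - d\<bar> < e" if "\<bar>a - b\<bar> \<le> e / 4" "\<bar>b - c\<bar> < e / 4" "\<bar>d - c\<bar> \<le> e / 4" for a b c d
    using that e by (simp add: abs_if split: if_splits)
  have "norm ((\<integral>x. \<phi> x * W k x \<partial>lebesgue_on \<Omega>) - (\<integral>x. \<phi> x * V x \<partial>lebesgue_on \<Omega>)) < e" if "k \<ge> N" for k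
    unfolding real_norm_def by (rule triangle[OF near[OF W] N[OF that] near[OF V]])
  then show "\<exists>N. \<forall>k\<ge>N. norm ((\<integral>x. \<phi> x * W k x \<partial>lebesgue_on \<Omega>) - (\<integral>x. \<phi> x * V x \<partial>lebesgue_on \<Omega>)) < e" by blast
qed

text \<open>An Egorov argument with the uniform smallness in place of a finite measure: \<open>T m\<close> is the set where
some \<open>\<phi> k\<close> with \<open>k \<ge> m\<close> is further than \<open>h\<close> from the limit.\<close>

lemma converges_on_sets_AE_convergent_functions:
  assumes WV: "converges_on_sets \<Omega> K W V" and \<phi>: "\<And>k. \<phi> k \<in> borel_measurable lebesgue" "\<phi>0 \<in> borel_measurable lebesgue"
    and M: "\<And>k x. 0 \<le> \<phi> k x" "\<And>k x. \<phi> k x \<le> M" "\<And>x. 0 \<le> \<phi>0 x" "\<And>x. \<phi>0 x \<le> M"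
    and ae: "AE x in lebesgue. (\<lambda>k. \<phi> k x) \<longlonglongrightarrow> \<phi>0 x"
  shows "(\<lambda>k. \<integral>x. \<phi> k x * W k x \<partial>lebesgue_on \<Omega>) \<longlonglongrightarrow> (\<integral>x. \<phi>0 x * V x \<partial>lebesgue_on \<Omega>)"
proof -
  have W: "W k \<in> K" for k using WV by (auto simp: converges_on_sets_def)
  obtain C where C: "\<And>f. f \<in> K \<Longrightarrow> mass \<Omega> UNIV f \<le> C" "0 \<le> C"
    using weakly_compact_mass_bounded by blast
  have M0: "0 \<le> M" using M(3,4) order_trans by blast
  have bd: "\<bar>\<phi> k x\<bar> \<le> M" "\<bar>\<phi>0 x\<bar> \<le> M" for k x using M(1,2)[of k x] M(3,4)[of x] by auto
  have "(\<lambda>k. (\<integral>x. \<phi> k x * W k x \<partial>lebesgue_on \<Omega>) - (\<integral>x. \<phi>0 x * W k x \<partial>lebesgue_on \<Omega>)) \<longlonglongrightarrow> 0"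
  proof (rule LIMSEQ_I)
    fix e :: real assume e: "0 < e"
    \<comment> \<open>Chosen so that an error \<open>h\<close> in the integrand costs at most \<open>e / 4\<close>, also when \<open>C = 0\<close>.\<close>
    define h where "h = e / (4 * (C + 1))"
    have h: "0 < h" "h * C \<le> e / 4" using e C(2) by (auto simp: h_def field_simps)
    define e' where "e' = e / (4 * (M + 1))"
    have e': "0 < e'" "M * e' \<le> e / 4" using e M0 by (auto simp: e'_def field_simps)
    define T where "T m = (\<Union>k\<in>{m..}. {x. h < \<bar>\<phi> k x - \<phi>0 x\<bar>})" for m :: nat
    have "{x \<in> space lebesgue. h < \<bar>\<phi> k x - \<phi>0 x\<bar>} \<in> sets lebesgue" for k
      using \<phi> by (intro borel_measurable_less borel_measurable_const borel_measurable_abs borel_measurable_diff)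
    then have T: "T m \<in> sets lebesgue" for m unfolding T_def by (intro sets.countable_UN') auto
    have dec: "T n \<subseteq> T m" if "m \<le> n" for m n
      unfolding T_def using that by (intro UN_mono) auto
    have null: "AE x in lebesgue. eventually (\<lambda>m. x \<notin> T m) sequentially"
      using ae
    proof eventually_elim
      fix x assume "(\<lambda>k. \<phi> k x) \<longlonglongrightarrow> \<phi>0 x"
      then obtain N where N: "\<And>k. k \<ge> N \<Longrightarrow> \<bar>\<phi> k x - \<phi>0 x\<bar> < h"
        using LIMSEQ_D[of _ _ h] h(1) by fastforce
      show "eventually (\<lambda>m. x \<notin> T m) sequentially"
      proof (rule eventually_sequentiallyI[of N], rule notI)
        fix m assume "N \<le> m" "x \<in> T m"
        then obtain k where "N \<le> k" "h < \<bar>\<phi> k x - \<phi>0 x\<bar>" unfolding T_def using order_trans by blast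
        then show False using N[of k] by simp
      qed
    qed
    obtain m where m: "\<And>f. f \<in> K \<Longrightarrow> mass \<Omega> (T m) f \<le> e'"
      using weakly_compact_uniformly_small[OF T dec null e'(1)] by blast
    have "norm ((\<integral>x. \<phi> k x * W k x \<partial>lebesgue_on \<Omega>) - (\<integral>x. \<phi>0 x * W k x \<partial>lebesgue_on \<Omega>) - 0) < e" if k: "k \<ge> m" for k
    proof -
      have f: "W k \<in> L1_pos \<Omega>" using W K_pos by blast
      have f1: "W k \<in> L1 \<Omega>" using f by (rule L1_pos_L1)
      have i1: "integrable (lebesgue_on \<Omega>) (\<lambda>x. \<phi> k x * W k x)" "integrable (lebesgue_on \<Omega>) (\<lambda>x. \<phi>0 x * W k x)"
        by (rule L1_integrable_bounded_mult[OF f1 \<phi>(1) bd(1)], rule L1_integrable_bounded_mult[OF f1 \<phi>(2) bd(2)])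
      have i2: "integrable (lebesgue_on \<Omega>) (\<lambda>x. h * (indicator UNIV x * W k x) + M * (indicator (T m) x * W k x))"
        by (intro Bochner_Integration.integrable_add integrable_mult_right mass_integrable f1 T) simp
      have "\<bar>(\<integral>x. \<phi> k x * W k x \<partial>lebesgue_on \<Omega>) - (\<integral>x. \<phi>0 x * W k x \<partial>lebesgue_on \<Omega>)\<bar>
          = \<bar>\<integral>x. \<phi> k x * W k x - \<phi>0 x * W k x \<partial>lebesgue_on \<Omega>\<bar>" using i1 by simp
      also have "\<dots> \<le> (\<integral>x. \<bar>\<phi> k x * W k x - \<phi>0 x * W k x\<bar> \<partial>lebesgue_on \<Omega>)" by (rule integral_abs_bound)
      also have "\<dots> \<le> (\<integral>x. h * (indicator UNIV x * W k x) + M * (indicator (T m) x * W k x) \<partial>lebesgue_on \<Omega>)"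
      proof (rule integral_mono_AE)
        have "AE x in lebesgue_on \<Omega>. 0 \<le> W k x" using f by (simp add: L1_pos_def)
        then show "AE x in lebesgue_on \<Omega>. \<bar>\<phi> k x * W k x - \<phi>0 x * W k x\<bar>
            \<le> h * (indicator UNIV x * W k x) + M * (indicator (T m) x * W k x)"
        proof eventually_elim
          fix x assume pos: "0 \<le> W k x"
          have "\<bar>\<phi> k x - \<phi>0 x\<bar> \<le> h + M * indicator (T m) x"
          proof (cases "x \<in> T m")
            case True
            have "\<bar>\<phi> k x - \<phi>0 x\<bar> \<le> M" using M(1,2)[of k x] M(3,4)[of x] by (auto simp: abs_le_iff)
            then show ?thesis using True h(1) by simp
          next
            case False
            then show ?thesis using k by (auto simp: T_def not_less)
          qed
          then have "\<bar>\<phi> k x - \<phi>0 x\<bar> * W k x \<le> (h + M * indicator (T m) x) * W k x"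
            using pos by (rule mult_right_mono)
          moreover have "\<bar>\<phi> k x * W k x - \<phi>0 x * W k x\<bar> = \<bar>\<phi> k x - \<phi>0 x\<bar> * W k x"
            using pos by (simp add: left_diff_distrib[symmetric] abs_mult)
          ultimately show "\<bar>\<phi> k x * W k x - \<phi>0 x * W k x\<bar>
              \<le> h * (indicator UNIV x * W k x) + M * (indicator (T m) x * W k x)"
            by (simp add: distrib_right)
        qed
      qed (intro integrable_abs Bochner_Integration.integrable_diff i1 i2)+
      also have "\<dots> = h * mass \<Omega> UNIV (W k) + M * mass \<Omega> (T m) (W k)"
        unfolding mass_def using mass_integrable[OF f1 T] mass_integrable[OF f1, of UNIV] by simp
      also have "\<dots> \<le> h * C + M * e'"
        using h(1) M0 C(1)[OF W] m[OF W] by (intro add_mono mult_left_mono) auto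
      also have "\<dots> < e" using h(2) e'(2) e by linarith
      finally show ?thesis by simp
    qed
    then show "\<exists>N. \<forall>k\<ge>N. norm ((\<integral>x. \<phi> k x * W k x \<partial>lebesgue_on \<Omega>) - (\<integral>x. \<phi>0 x * W k x \<partial>lebesgue_on \<Omega>) - 0) < e" by blast
  qed
  from tendsto_add[OF this converges_on_sets_bounded_function[OF WV \<phi>(2) M(3,4)]]
  show ?thesis by simp
qed

end

end


section \<open>\<open>\<gamma>\<close>-convergence\<close>

abbreviation potential :: "'a::euclidean_space set \<Rightarrow> ('a \<Rightarrow> real) \<Rightarrow> 'a measure" where
  "potential \<Omega> V \<equiv> potential_measure \<Omega> (\<lambda>x. ennreal (V x))"

abbreviation real_density :: "'a::euclidean_space set \<Rightarrow> ('a \<Rightarrow> real) \<Rightarrow> 'a \<Rightarrow> ennreal" where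
  "real_density \<Omega> V \<equiv> potential_density \<Omega> (\<lambda>x. ennreal (V x))"

definition truncate :: "nat \<Rightarrow> real \<Rightarrow> real" where
  "truncate k a = max (- real k) (min (real k) a)"

lemma truncate_contraction: "\<bar>truncate k a - truncate k b\<bar> \<le> \<bar>a - b\<bar>"
  by (auto simp: truncate_def max_def min_def)

lemma truncate_zero [simp]: "truncate k 0 = 0" "truncate 0 a = 0"
  by (auto simp: truncate_def)

lemma abs_truncate_le: "\<bar>truncate k a\<bar> \<le> real k" "\<bar>truncate k a\<bar> \<le> \<bar>a\<bar>"
  by (auto simp: truncate_def max_def min_def)

lemma truncate_square_le: "(truncate k a)\<^sup>2 \<le> (real k)\<^sup>2" "(truncate k a)\<^sup>2 \<le> a\<^sup>2"
  using power_mono[OF abs_truncate_le(1), of k a 2] power_mono[OF abs_truncate_le(2), of k a 2] by auto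

lemma truncate_eq: "\<bar>a\<bar> \<le> real k \<Longrightarrow> truncate k a = a"
  by (auto simp: truncate_def max_def min_def)

lemma truncate_diff_square_le: "(truncate k a - a)\<^sup>2 \<le> a\<^sup>2"
proof -
  have "\<bar>truncate k a - a\<bar> \<le> \<bar>a\<bar>" by (auto simp: truncate_def max_def min_def)
  then have "\<bar>truncate k a - a\<bar>\<^sup>2 \<le> \<bar>a\<bar>\<^sup>2" by (rule power_mono) simp
  then show ?thesis by simp
qed

lemma truncate_measurable: "truncate k \<in> borel_measurable borel"
  unfolding truncate_def[abs_def] by measurable

text \<open>\<open>\<kappa> n\<close> is the largest index \<open>k \<le> n\<close> for which \<open>P k\<close> holds from \<open>n\<close> on.\<close>

lemma diagonal_selection:
  assumes P0: "\<And>n. P 0 n" and ev: "\<And>k. eventually (P k) sequentially"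
  obtains \<kappa> :: "nat \<Rightarrow> nat" where "filterlim \<kappa> at_top sequentially" "\<And>n. P (\<kappa> n) n"
proof -
  define S where "S n = {k. k \<le> n \<and> (\<forall>m\<ge>n. P k m)}" for n
  have S: "finite (S n)" "S n \<noteq> {}" for n
    using P0 by (auto simp: S_def)
  define \<kappa> where "\<kappa> n = Max (S n)" for n
  have "\<kappa> n \<in> S n" for n unfolding \<kappa>_def using S by (rule Max_in)
  then have P: "P (\<kappa> n) n" for n unfolding S_def by blast
  have "eventually (\<lambda>n. k \<le> \<kappa> n) sequentially" for k
  proof -
    obtain N where N: "\<And>m. m \<ge> N \<Longrightarrow> P k m" using ev[of k] by (auto simp: eventually_sequentially)
    show ?thesis
    proof (rule eventually_sequentiallyI[of "max k N"])
      fix n assume n: "max k N \<le> n"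
      then have "k \<in> S n" using N by (auto simp: S_def)
      then show "k \<le> \<kappa> n" unfolding \<kappa>_def using S(1) by (intro Max_ge)
    qed
  qed
  then have "filterlim \<kappa> at_top sequentially" by (simp add: filterlim_at_top)
  then show thesis using that P by blast
qed

context
  fixes \<Omega> :: "'a::euclidean_space set"
  assumes \<Omega>: "\<Omega> \<in> sets lebesgue"
begin

lemma \<Omega>_space: "\<Omega> \<inter> space lebesgue \<in> sets lebesgue"
  using \<Omega> by simp

lemma potential_density_measurable:
  assumes "V \<in> L1 \<Omega>"
  shows "real_density \<Omega> V \<in> borel_measurable lebesgue"
proof -
  have "V \<in> borel_measurable (lebesgue_on \<Omega>)" using assms by (auto simp: L1_def)
  then have "(\<lambda>x. ennreal (V x)) \<in> borel_measurable (lebesgue_on \<Omega>)" by measurable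
  then show ?thesis
    unfolding potential_density_def[abs_def] borel_measurable_restrict_space_iff_ennreal[OF \<Omega>_space] .
qed

lemma nn_integral_potential_density:
  assumes V: "V \<in> L1_pos \<Omega>" and \<phi>: "\<phi> \<in> borel_measurable lebesgue" and M: "\<And>x. 0 \<le> \<phi> x" "\<And>x. \<phi> x \<le> M"
  shows "(\<integral>\<^sup>+x. real_density \<Omega> V x * ennreal (\<phi> x) \<partial>lebesgue) = ennreal (\<integral>x. \<phi> x * V x \<partial>lebesgue_on \<Omega>)"
proof -
  have pos: "AE x in lebesgue_on \<Omega>. 0 \<le> V x" using V by (simp add: L1_pos_def)
  have "\<bar>\<phi> x\<bar> \<le> M" for x using M[of x] by simp
  then have int: "integrable (lebesgue_on \<Omega>) (\<lambda>x. \<phi> x * V x)"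
    using V by (intro L1_integrable_bounded_mult[OF \<Omega> _ \<phi>]) (auto simp: L1_pos_def)
  have "(\<integral>\<^sup>+x. real_density \<Omega> V x * ennreal (\<phi> x) \<partial>lebesgue) = (\<integral>\<^sup>+x. (ennreal (V x) * ennreal (\<phi> x)) * indicator \<Omega> x \<partial>lebesgue)"
    by (intro nn_integral_cong) (simp add: potential_density_def ac_simps)
  also have "\<dots> = (\<integral>\<^sup>+x. ennreal (V x) * ennreal (\<phi> x) \<partial>lebesgue_on \<Omega>)"
    by (rule nn_integral_restrict_space[OF \<Omega>_space, symmetric])
  also have "\<dots> = (\<integral>\<^sup>+x. ennreal (\<phi> x * V x) \<partial>lebesgue_on \<Omega>)"
    using pos M by (intro nn_integral_cong_AE) (auto elim!: eventually_mono simp: ennreal_mult mult.commute)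
  also have "\<dots> = ennreal (\<integral>x. \<phi> x * V x \<partial>lebesgue_on \<Omega>)"
    using pos M by (intro nn_integral_eq_integral int) (auto elim!: eventually_mono)
  finally show ?thesis .
qed

lemma zero_ext_eq: "zero_ext \<Omega> u = (\<lambda>x. indicator \<Omega> x *\<^sub>R u x)"
  by (auto simp: zero_ext_def indicator_def)

lemma zero_ext_L2:
  assumes "u \<in> L2 \<Omega>"
  shows "zero_ext \<Omega> u \<in> L2 UNIV"
proof -
  have "zero_ext \<Omega> u \<in> borel_measurable lebesgue"
    using assms unfolding L2_def zero_ext_eq by (simp add: borel_measurable_restrict_space_iff[OF \<Omega>_space])
  moreover have "integrable lebesgue (\<lambda>x. indicator \<Omega> x *\<^sub>R (u x)\<^sup>2)"
    using assms unfolding L2_def by (simp add: integrable_restrict_space[OF \<Omega>_space])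
  moreover have "(\<lambda>x. indicator \<Omega> x *\<^sub>R (u x)\<^sup>2) = (\<lambda>x. (zero_ext \<Omega> u x)\<^sup>2)"
    by (auto simp: zero_ext_def indicator_def)
  ultimately show ?thesis by (simp add: L2_def lebesgue_on_UNIV_eq)
qed

lemma integral_zero_ext_diff:
  "(\<integral>x. (zero_ext \<Omega> v x - zero_ext \<Omega> u x)\<^sup>2 \<partial>lebesgue) = (\<integral>x. (v x - u x)\<^sup>2 \<partial>lebesgue_on \<Omega>)"
  unfolding integral_restrict_space[OF \<Omega>_space]
  by (intro Bochner_Integration.integral_cong) (auto simp: zero_ext_def indicator_def)

lemma zero_ext_truncate: "zero_ext \<Omega> (\<lambda>x. truncate k (u x)) = (\<lambda>x. truncate k (zero_ext \<Omega> u x))"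
  by (auto simp: zero_ext_def)

lemma L2_truncate:
  assumes "u \<in> L2 \<Omega>"
  shows "(\<lambda>x. truncate k (u x)) \<in> L2 \<Omega>"
proof -
  have u: "u \<in> borel_measurable (lebesgue_on \<Omega>)" "integrable (lebesgue_on \<Omega>) (\<lambda>x. (u x)\<^sup>2)"
    using assms by (auto simp: L2_def)
  have m: "(\<lambda>x. truncate k (u x)) \<in> borel_measurable (lebesgue_on \<Omega>)"
    by (rule measurable_compose[OF u(1) truncate_measurable])
  have "integrable (lebesgue_on \<Omega>) (\<lambda>x. (truncate k (u x))\<^sup>2)"
    using u(2) by (rule Bochner_Integration.integrable_bound)
      (use m truncate_square_le in auto)
  then show ?thesis using m by (simp add: L2_def)
qed

lemma L2_converges_subseq:
  assumes "L2_converges \<Omega> us u" "strict_mono s"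
  shows "L2_converges \<Omega> (\<lambda>k. us (s k)) u"
  using assms LIMSEQ_subseq_LIMSEQ[of "\<lambda>n. \<integral>x. (us n x - u x)\<^sup>2 \<partial>lebesgue_on \<Omega>" 0 s]
  unfolding L2_converges_def by (simp add: comp_def)

lemma L2_converges_truncate:
  assumes u: "u \<in> L2 \<Omega>" and \<kappa>: "filterlim \<kappa> at_top sequentially"
  shows "L2_converges \<Omega> (\<lambda>n x. truncate (\<kappa> n) (u x)) u"
proof -
  have um: "u \<in> borel_measurable (lebesgue_on \<Omega>)" using u by (simp add: L2_def)
  have "(\<lambda>n. \<integral>x. (truncate (\<kappa> n) (u x) - u x)\<^sup>2 \<partial>lebesgue_on \<Omega>) \<longlonglongrightarrow> (\<integral>x. 0 \<partial>lebesgue_on \<Omega>)"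
  proof (rule integral_dominated_convergence)
    show "integrable (lebesgue_on \<Omega>) (\<lambda>x. (u x)\<^sup>2)" using u by (simp add: L2_def)
    show "(\<lambda>x. (truncate (\<kappa> n) (u x) - u x)\<^sup>2) \<in> borel_measurable (lebesgue_on \<Omega>)" for n
      by (intro borel_measurable_power borel_measurable_diff measurable_compose[OF um truncate_measurable] um)
    show "AE x in lebesgue_on \<Omega>. norm ((truncate (\<kappa> n) (u x) - u x)\<^sup>2) \<le> (u x)\<^sup>2" for n
      by (rule AE_I2) (simp add: truncate_diff_square_le)
    show "AE x in lebesgue_on \<Omega>. (\<lambda>n. (truncate (\<kappa> n) (u x) - u x)\<^sup>2) \<longlonglongrightarrow> 0"
    proof (rule AE_I2)
      fix x
      obtain K :: nat where K: "\<bar>u x\<bar> \<le> real K" using real_arch_simple by blast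
      have "eventually (\<lambda>n. K \<le> \<kappa> n) sequentially" using \<kappa> by (simp add: filterlim_at_top)
      then have "eventually (\<lambda>n. (truncate (\<kappa> n) (u x) - u x)\<^sup>2 = 0) sequentially"
      proof eventually_elim
        fix n assume "K \<le> \<kappa> n"
        then have "real K \<le> real (\<kappa> n)" by simp
        with K have "\<bar>u x\<bar> \<le> real (\<kappa> n)" by (rule order_trans)
        then show "(truncate (\<kappa> n) (u x) - u x)\<^sup>2 = 0" by (simp add: truncate_eq)
      qed
      then show "(\<lambda>n. (truncate (\<kappa> n) (u x) - u x)\<^sup>2) \<longlonglongrightarrow> 0" by (rule tendsto_eventually)
    qed
  qed simp
  then show ?thesis using u L2_truncate[OF u] by (simp add: L2_converges_def)
qed

lemma L2_UNIV_AE_subseq: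
  fixes w :: "nat \<Rightarrow> 'a \<Rightarrow> real"
  assumes w: "\<And>n. w n \<in> L2 UNIV" "w0 \<in> L2 UNIV"
    and lim: "(\<lambda>n. \<integral>x. (w n x - w0 x)\<^sup>2 \<partial>lebesgue) \<longlonglongrightarrow> 0"
  shows "\<exists>t. strict_mono t \<and> (AE x in lebesgue. (\<lambda>k. w (t k) x) \<longlonglongrightarrow> w0 x)"
proof -
  have "\<exists>t. strict_mono t \<and> (AE x in lebesgue. (\<lambda>k. (w (t k) x - w0 x)\<^sup>2) \<longlonglongrightarrow> 0)"
    by (rule tendsto_L1_AE_subseq) (use L2_integrable_square[OF L2_diff[OF w]] lim in auto)
  then obtain t where t: "strict_mono t" and ae: "AE x in lebesgue. (\<lambda>k. (w (t k) x - w0 x)\<^sup>2) \<longlonglongrightarrow> 0"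
    by blast
  have "AE x in lebesgue. (\<lambda>k. w (t k) x) \<longlonglongrightarrow> w0 x"
    using ae
  proof eventually_elim
    fix x assume "(\<lambda>k. (w (t k) x - w0 x)\<^sup>2) \<longlonglongrightarrow> 0"
    then have "(\<lambda>k. w (t k) x - w0 x) \<longlonglongrightarrow> 0" by (simp add: tendsto_null_power)
    then show "(\<lambda>k. w (t k) x) \<longlonglongrightarrow> w0 x" by (rule LIM_zero_cancel)
  qed
  then show ?thesis using t by blast
qed

lemma Q_potential:
  assumes "V \<in> L1 \<Omega>"
  shows "Q \<Omega> (potential \<Omega> V) u = (if zero_ext \<Omega> u \<in> H10 \<Omega>
     then energy (zero_ext \<Omega> u) + (\<integral>\<^sup>+x. real_density \<Omega> V x * ennreal ((zero_ext \<Omega> u x)\<^sup>2) \<partial>lebesgue)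
     else \<infinity>)"
  by (rule Q_potential_measure[OF potential_density_measurable[OF assms]])

context
  fixes K :: "('a \<Rightarrow> real) set" and W :: "nat \<Rightarrow> 'a \<Rightarrow> real" and V :: "'a \<Rightarrow> real"
  assumes K: "compactin (weak_L1 \<Omega>) K" and K_pos: "K \<subseteq> L1_pos \<Omega>"
    and WV: "converges_on_sets \<Omega> K W V"
begin

lemma limit_L1_pos: "W n \<in> L1_pos \<Omega>" "V \<in> L1_pos \<Omega>" "W n \<in> L1 \<Omega>" "V \<in> L1 \<Omega>"
proof -
  have "W n \<in> K" "V \<in> K" using WV by (auto simp: converges_on_sets_def)
  then show pos: "W n \<in> L1_pos \<Omega>" "V \<in> L1_pos \<Omega>" using K_pos by auto
  then show "W n \<in> L1 \<Omega>" "V \<in> L1 \<Omega>" by (auto simp: L1_pos_def)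
qed

text \<open>Truncating at \<open>M\<close> makes the potential term continuous along the sequence. A further subsequence
along which the energies converge to their lower limit allows the two limits to be added.\<close>

lemma energy_plus_truncated_potential_le:
  fixes w :: "nat \<Rightarrow> 'a \<Rightarrow> real"
  assumes w: "\<And>n. w n \<in> L2 UNIV" and w0: "w0 \<in> L2 UNIV"
    and lim: "(\<lambda>n. \<integral>x. (w n x - w0 x)\<^sup>2 \<partial>lebesgue) \<longlonglongrightarrow> 0"
    and c: "(\<lambda>n. energy (w n) + (\<integral>\<^sup>+x. real_density \<Omega> (W n) x * ennreal ((w n x)\<^sup>2) \<partial>lebesgue)) \<longlonglongrightarrow> c"
  shows "energy w0 + (\<integral>\<^sup>+x. real_density \<Omega> V x * ennreal (min ((w0 x)\<^sup>2) (real M)) \<partial>lebesgue) \<le> c"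
proof -
  obtain t where t: "strict_mono t" and ae: "AE x in lebesgue. (\<lambda>k. w (t k) x) \<longlonglongrightarrow> w0 x"
    using L2_UNIV_AE_subseq[OF w w0 lim] by blast
  define a where "a k = energy (w (t k))" for k
  obtain s where s: "strict_mono s" "(a \<circ> s) \<longlonglongrightarrow> liminf a"
    using liminf_subseq_lim by blast
  define r where "r k = t (s k)" for k
  have r: "strict_mono r" unfolding r_def using strict_mono_o[OF t s(1)] by (simp add: comp_def)
  have "(\<lambda>k. \<integral>x. (w (t k) x - w0 x)\<^sup>2 \<partial>lebesgue) \<longlonglongrightarrow> 0"
    using LIMSEQ_subseq_LIMSEQ[OF lim t] by (simp add: comp_def)
  then have lsc: "energy w0 \<le> liminf a"
    unfolding a_def by (rule energy_lower_semicontinuous[OF w w0])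
  define \<phi> where "\<phi> k x = min ((w (r k) x)\<^sup>2) (real M)" for k x
  define \<phi>0 where "\<phi>0 x = min ((w0 x)\<^sup>2) (real M)" for x
  have \<phi>_m: "\<phi> k \<in> borel_measurable lebesgue" "\<phi>0 \<in> borel_measurable lebesgue" for k
    unfolding \<phi>_def \<phi>0_def
    by (intro borel_measurable_min borel_measurable_power L2_measurable w w0 borel_measurable_const)+
  have \<phi>_bd: "0 \<le> \<phi> k x" "\<phi> k x \<le> real M" "0 \<le> \<phi>0 x" "\<phi>0 x \<le> real M" for k x
    by (auto simp: \<phi>_def \<phi>0_def)
  have "AE x in lebesgue. (\<lambda>k. \<phi> k x) \<longlonglongrightarrow> \<phi>0 x"
    using ae
  proof eventually_elim
    fix x assume "(\<lambda>k. w (t k) x) \<longlonglongrightarrow> w0 x"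
    then have "(\<lambda>k. w (r k) x) \<longlonglongrightarrow> w0 x"
      using LIMSEQ_subseq_LIMSEQ[OF _ s(1)] by (fastforce simp: r_def comp_def)
    then show "(\<lambda>k. \<phi> k x) \<longlonglongrightarrow> \<phi>0 x"
      unfolding \<phi>_def \<phi>0_def by (intro tendsto_min tendsto_power tendsto_const)
  qed
  then have "(\<lambda>k. \<integral>x. \<phi> k x * W (r k) x \<partial>lebesgue_on \<Omega>) \<longlonglongrightarrow> (\<integral>x. \<phi>0 x * V x \<partial>lebesgue_on \<Omega>)"
    by (rule converges_on_sets_AE_convergent_functions[OF \<Omega> K K_pos
        converges_on_sets_subseq[OF \<Omega> K K_pos WV r] \<phi>_m \<phi>_bd])
  from tendsto_ennrealI[OF this]
  have "(\<lambda>k. \<integral>\<^sup>+x. real_density \<Omega> (W (r k)) x * ennreal (\<phi> k x) \<partial>lebesgue)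
      \<longlonglongrightarrow> (\<integral>\<^sup>+x. real_density \<Omega> V x * ennreal (\<phi>0 x) \<partial>lebesgue)"
    unfolding nn_integral_potential_density[OF limit_L1_pos(1) \<phi>_m(1) \<phi>_bd(1,2)]
      nn_integral_potential_density[OF limit_L1_pos(2) \<phi>_m(2) \<phi>_bd(3,4)] .
  from tendsto_add[OF s(2) this]
  have sum: "(\<lambda>k. energy (w (r k)) + (\<integral>\<^sup>+x. real_density \<Omega> (W (r k)) x * ennreal (\<phi> k x) \<partial>lebesgue))
      \<longlonglongrightarrow> liminf a + (\<integral>\<^sup>+x. real_density \<Omega> V x * ennreal (\<phi>0 x) \<partial>lebesgue)"
    by (simp add: a_def r_def comp_def)
  have "liminf a + (\<integral>\<^sup>+x. real_density \<Omega> V x * ennreal (\<phi>0 x) \<partial>lebesgue) \<le> c"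
  proof (rule LIMSEQ_le[OF sum])
    show "(\<lambda>k. energy (w (r k)) + (\<integral>\<^sup>+x. real_density \<Omega> (W (r k)) x * ennreal ((w (r k) x)\<^sup>2) \<partial>lebesgue)) \<longlonglongrightarrow> c"
      using LIMSEQ_subseq_LIMSEQ[OF c r] by (simp add: comp_def)
    have "(\<integral>\<^sup>+x. real_density \<Omega> (W (r k)) x * ennreal (\<phi> k x) \<partial>lebesgue)
        \<le> (\<integral>\<^sup>+x. real_density \<Omega> (W (r k)) x * ennreal ((w (r k) x)\<^sup>2) \<partial>lebesgue)" for k
      by (intro nn_integral_mono mult_left_mono ennreal_leI) (auto simp: \<phi>_def)
    then show "\<exists>N. \<forall>k\<ge>N. energy (w (r k)) + (\<integral>\<^sup>+x. real_density \<Omega> (W (r k)) x * ennreal (\<phi> k x) \<partial>lebesgue)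
        \<le> energy (w (r k)) + (\<integral>\<^sup>+x. real_density \<Omega> (W (r k)) x * ennreal ((w (r k) x)\<^sup>2) \<partial>lebesgue)"
      by (intro exI allI impI add_left_mono)
  qed
  then show ?thesis using add_right_mono[OF lsc] unfolding \<phi>0_def by (rule order_trans[rotated])
qed

lemma Q_le_finite_limit:
  assumes us: "L2_converges \<Omega> us u"
    and lim: "(\<lambda>n. Q \<Omega> (potential \<Omega> (W n)) (us n)) \<longlonglongrightarrow> c"
    and fin: "\<And>n. Q \<Omega> (potential \<Omega> (W n)) (us n) \<le> ennreal C"
  shows "Q \<Omega> (potential \<Omega> V) u \<le> c"
proof -
  define w where "w n = zero_ext \<Omega> (us n)" for n
  define w0 where "w0 = zero_ext \<Omega> u"
  have w: "w n \<in> L2 UNIV" "w0 \<in> L2 UNIV" for n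
    using us by (auto simp: w_def w0_def L2_converges_def intro: zero_ext_L2)
  have w_lim: "(\<lambda>n. \<integral>x. (w n x - w0 x)\<^sup>2 \<partial>lebesgue) \<longlonglongrightarrow> 0"
    using us unfolding w_def w0_def integral_zero_ext_diff L2_converges_def by blast
  have w_H10: "w n \<in> H10 \<Omega>" for n
  proof (rule ccontr)
    assume "w n \<notin> H10 \<Omega>"
    then have "Q \<Omega> (potential \<Omega> (W n)) (us n) = \<infinity>"
      unfolding Q_potential[OF limit_L1_pos(3)] w_def by simp
    then show False using fin[of n] by (simp add: top_unique)
  qed
  then have Q_eq: "Q \<Omega> (potential \<Omega> (W n)) (us n)
      = energy (w n) + (\<integral>\<^sup>+x. real_density \<Omega> (W n) x * ennreal ((w n x)\<^sup>2) \<partial>lebesgue)" for n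
    unfolding Q_potential[OF limit_L1_pos(3)] w_def by simp
  have "energy (w n) \<le> ennreal C" for n
    using fin[of n] unfolding Q_eq by (rule order_trans[rotated]) simp
  then have w0_H10: "w0 \<in> H10 \<Omega>"
    by (rule H10_weakly_closed[OF w_H10 _ w(2) w_lim])
  have le: "energy w0 + (\<integral>\<^sup>+x. real_density \<Omega> V x * ennreal (min ((w0 x)\<^sup>2) (real M)) \<partial>lebesgue) \<le> c" for M
    by (rule energy_plus_truncated_potential_le[OF w w_lim lim[unfolded Q_eq]])
  have "(\<lambda>M. \<integral>\<^sup>+x. real_density \<Omega> V x * ennreal (min ((w0 x)\<^sup>2) (real M)) \<partial>lebesgue)
      \<longlonglongrightarrow> (\<integral>\<^sup>+x. real_density \<Omega> V x * ennreal ((w0 x)\<^sup>2) \<partial>lebesgue)"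
  proof (rule nn_integral_LIMSEQ)
    show "incseq (\<lambda>M x. real_density \<Omega> V x * ennreal (min ((w0 x)\<^sup>2) (real M)))"
      by (auto simp: incseq_def le_fun_def intro!: mult_left_mono ennreal_leI min.mono)
    show "(\<lambda>x. real_density \<Omega> V x * ennreal (min ((w0 x)\<^sup>2) (real M))) \<in> borel_measurable lebesgue" for M
    proof -
      have [measurable]: "real_density \<Omega> V \<in> borel_measurable lebesgue" "w0 \<in> borel_measurable lebesgue"
        by (rule potential_density_measurable[OF limit_L1_pos(4)], rule L2_measurable[OF w(2)])
      show ?thesis by measurable
    qed
    fix x
    obtain K :: nat where K: "(w0 x)\<^sup>2 \<le> real K" using real_arch_simple by blast
    have "eventually (\<lambda>M. real_density \<Omega> V x * ennreal (min ((w0 x)\<^sup>2) (real M)) = real_density \<Omega> V x * ennreal ((w0 x)\<^sup>2)) sequentially"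
    proof (rule eventually_sequentiallyI[of K])
      fix M assume "K \<le> M"
      then have "real K \<le> real M" by simp
      with K have "(w0 x)\<^sup>2 \<le> real M" by (rule order_trans)
      then show "real_density \<Omega> V x * ennreal (min ((w0 x)\<^sup>2) (real M)) = real_density \<Omega> V x * ennreal ((w0 x)\<^sup>2)"
        by (simp add: min_absorb1)
    qed
    then show "(\<lambda>M. real_density \<Omega> V x * ennreal (min ((w0 x)\<^sup>2) (real M))) \<longlonglongrightarrow> real_density \<Omega> V x * ennreal ((w0 x)\<^sup>2)"
      by (rule tendsto_eventually)
  qed
  from tendsto_add[OF tendsto_const this]
  have "energy w0 + (\<integral>\<^sup>+x. real_density \<Omega> V x * ennreal ((w0 x)\<^sup>2) \<partial>lebesgue) \<le> c"
    by (rule LIMSEQ_le_const2) (use le in blast)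
  then show ?thesis
    using w0_H10 unfolding Q_potential[OF limit_L1_pos(4)] w0_def by simp
qed

end

lemma Q_le_liminf:
  assumes K: "compactin (weak_L1 \<Omega>) K" and K_pos: "K \<subseteq> L1_pos \<Omega>"
    and WV: "converges_on_sets \<Omega> K W V" and us: "L2_converges \<Omega> us u"
  shows "Q \<Omega> (potential \<Omega> V) u \<le> liminf (\<lambda>n. Q \<Omega> (potential \<Omega> (W n)) (us n))"
proof -
  define q where "q n = Q \<Omega> (potential \<Omega> (W n)) (us n)" for n
  obtain s where s: "strict_mono s" "(q \<circ> s) \<longlonglongrightarrow> liminf q"
    using liminf_subseq_lim by blast
  have "Q \<Omega> (potential \<Omega> V) u \<le> liminf q"
  proof (cases "liminf q")
    case (real c)
    have "liminf q < ennreal (c + 1)" using real by (simp add: ennreal_less_iff)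
    then have "eventually (\<lambda>k. q (s k) < ennreal (c + 1)) sequentially"
      using order_tendstoD(2)[OF s(2)] by (simp add: comp_def)
    then obtain N where N: "\<And>k. k \<ge> N \<Longrightarrow> q (s k) < ennreal (c + 1)"
      by (auto simp: eventually_sequentially)
    define r where "r k = s (k + N)" for k
    have r: "strict_mono r" using s(1) by (auto simp: r_def strict_mono_def)
    show ?thesis
    proof (rule Q_le_finite_limit[OF K K_pos converges_on_sets_subseq[OF \<Omega> K K_pos WV r] L2_converges_subseq[OF us r]])
      have "(\<lambda>k. q (s (k + N))) \<longlonglongrightarrow> liminf q"
        using LIMSEQ_ignore_initial_segment[OF s(2), of N] by (simp add: comp_def)
      then show "(\<lambda>n. Q \<Omega> (potential \<Omega> (W (r n))) (us (r n))) \<longlonglongrightarrow> liminf q"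
        by (simp add: q_def r_def)
      show "Q \<Omega> (potential \<Omega> (W (r n))) (us (r n)) \<le> ennreal (c + 1)" for n
        using N[of "n + N"] by (simp add: q_def r_def less_imp_le)
    qed
  qed simp
  then show ?thesis unfolding q_def[abs_def] .
qed

text \<open>When \<open>Q u\<close> is infinite the constant sequence works, by the lower bound. Otherwise the truncations of \<open>u\<close> at
height \<open>k\<close> do not increase the form, and for each fixed \<open>k\<close> the forms converge because the truncated
function is bounded; the height is then let grow with \<open>n\<close> by diagonal selection.\<close>

lemma recovery_sequence_exists:
  assumes K: "compactin (weak_L1 \<Omega>) K" and K_pos: "K \<subseteq> L1_pos \<Omega>"
    and WV: "converges_on_sets \<Omega> K W V" and u: "u \<in> L2 \<Omega>"
  shows "\<exists>us. L2_converges \<Omega> us u \<and> (\<lambda>n. Q \<Omega> (potential \<Omega> (W n)) (us n)) \<longlonglongrightarrow> Q \<Omega> (potential \<Omega> V) u"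
proof -
  note pos = limit_L1_pos[OF K K_pos WV]
  define w where "w = zero_ext \<Omega> u"
  have wL2: "w \<in> L2 UNIV" unfolding w_def by (rule zero_ext_L2[OF u])
  have attain: "(\<lambda>n. Q \<Omega> (potential \<Omega> (W n)) (us n)) \<longlonglongrightarrow> Q \<Omega> (potential \<Omega> V) u"
    if us: "L2_converges \<Omega> us u" and le: "limsup (\<lambda>n. Q \<Omega> (potential \<Omega> (W n)) (us n)) \<le> Q \<Omega> (potential \<Omega> V) u" for us
  proof -
    let ?q = "\<lambda>n. Q \<Omega> (potential \<Omega> (W n)) (us n)"
    have 1: "Q \<Omega> (potential \<Omega> V) u \<le> liminf ?q" by (rule Q_le_liminf[OF K K_pos WV us])
    have 2: "liminf ?q \<le> limsup ?q" by (rule Liminf_le_Limsup) simp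
    show ?thesis
    proof (rule Liminf_eq_Limsup)
      show "liminf ?q = Q \<Omega> (potential \<Omega> V) u" using 1 2 le by (meson antisym order_trans)
      show "limsup ?q = Q \<Omega> (potential \<Omega> V) u" using 1 2 le by (meson antisym order_trans)
    qed simp
  qed
  show ?thesis
  proof (cases "Q \<Omega> (potential \<Omega> V) u = \<infinity>")
    case True
    have "L2_converges \<Omega> (\<lambda>n. u) u" using u by (simp add: L2_converges_def)
    then show ?thesis using attain[of "\<lambda>n. u"] True by auto
  next
    case False
    then have wH10: "w \<in> H10 \<Omega>"
      unfolding Q_potential[OF pos(4)] w_def by (auto split: if_splits)
    have QV: "Q \<Omega> (potential \<Omega> V) u = energy w + (\<integral>\<^sup>+x. real_density \<Omega> V x * ennreal ((w x)\<^sup>2) \<partial>lebesgue)"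
      using wH10 unfolding Q_potential[OF pos(4)] w_def by simp
    define v where "v k x = truncate k (w x)" for k x
    have v_H10: "v k \<in> H10 \<Omega>" for k
      unfolding v_def by (rule H10_contraction[OF wH10 truncate_contraction truncate_zero(1)])
    have Q_trunc: "Q \<Omega> (potential \<Omega> (W n)) (\<lambda>x. truncate k (u x))
        = energy (v k) + (\<integral>\<^sup>+x. real_density \<Omega> (W n) x * ennreal ((v k x)\<^sup>2) \<partial>lebesgue)" for n k
      using v_H10[of k] unfolding Q_potential[OF pos(3)] zero_ext_truncate v_def w_def by simp
    have v_m: "(\<lambda>x. (v k x)\<^sup>2) \<in> borel_measurable lebesgue" for k
      by (intro borel_measurable_power H1_measurable H10_H1[OF v_H10])
    have v_bd: "0 \<le> (v k x)\<^sup>2" "(v k x)\<^sup>2 \<le> (real k)\<^sup>2" for k x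
      using truncate_square_le(1) by (auto simp: v_def)
    have v_energy: "energy (v k) \<le> energy w" for k
      unfolding v_def by (rule energy_contraction[OF truncate_contraction])
    define P where "P k n \<longleftrightarrow> Q \<Omega> (potential \<Omega> (W n)) (\<lambda>x. truncate k (u x))
        \<le> Q \<Omega> (potential \<Omega> V) u + ennreal (1 / Suc k)" for k n
    \<comment> \<open>Truncation at height 0 gives the zero function, so the selection always has a candidate.\<close>
    have "P 0 n" for n
    proof -
      have "v 0 = (\<lambda>x. 0)" by (simp add: v_def fun_eq_iff)
      then have "Q \<Omega> (potential \<Omega> (W n)) (\<lambda>x. truncate 0 (u x)) = 0"
        unfolding Q_trunc by (simp add: energy_def quotient_energy_def)
      then show ?thesis by (simp add: P_def)
    qed
    moreover have "eventually (P k) sequentially" for k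
    proof -
      have "(\<lambda>n. \<integral>x. (v k x)\<^sup>2 * W n x \<partial>lebesgue_on \<Omega>) \<longlonglongrightarrow> (\<integral>x. (v k x)\<^sup>2 * V x \<partial>lebesgue_on \<Omega>)"
        by (rule converges_on_sets_bounded_function[OF \<Omega> K K_pos WV v_m v_bd])
      from tendsto_add[OF tendsto_const tendsto_ennrealI[OF this]]
      have lim: "(\<lambda>n. Q \<Omega> (potential \<Omega> (W n)) (\<lambda>x. truncate k (u x)))
          \<longlonglongrightarrow> energy (v k) + (\<integral>\<^sup>+x. real_density \<Omega> V x * ennreal ((v k x)\<^sup>2) \<partial>lebesgue)"
        unfolding Q_trunc nn_integral_potential_density[OF pos(1) v_m v_bd]
          nn_integral_potential_density[OF pos(2) v_m v_bd] .
      have "(\<integral>\<^sup>+x. real_density \<Omega> V x * ennreal ((v k x)\<^sup>2) \<partial>lebesgue)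
          \<le> (\<integral>\<^sup>+x. real_density \<Omega> V x * ennreal ((w x)\<^sup>2) \<partial>lebesgue)"
        by (intro nn_integral_mono mult_left_mono ennreal_leI) (auto simp: v_def truncate_square_le)
      then have "energy (v k) + (\<integral>\<^sup>+x. real_density \<Omega> V x * ennreal ((v k x)\<^sup>2) \<partial>lebesgue) \<le> Q \<Omega> (potential \<Omega> V) u"
        unfolding QV using v_energy by (rule add_mono[rotated])
      also have "\<dots> < Q \<Omega> (potential \<Omega> V) u + ennreal (1 / Suc k)"
      proof (cases "Q \<Omega> (potential \<Omega> V) u")
        case (real c)
        then show ?thesis by (simp add: ennreal_plus[symmetric] ennreal_less_iff del: ennreal_plus of_nat_Suc)
      qed (use False in simp)
      finally have less: "energy (v k) + (\<integral>\<^sup>+x. real_density \<Omega> V x * ennreal ((v k x)\<^sup>2) \<partial>lebesgue)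
          < Q \<Omega> (potential \<Omega> V) u + ennreal (1 / Suc k)" .
      show ?thesis
        using order_tendstoD(2)[OF lim less] by (rule eventually_mono) (unfold P_def, rule less_imp_le)
    qed
    ultimately obtain \<kappa> where \<kappa>: "filterlim \<kappa> at_top sequentially" "\<And>n. P (\<kappa> n) n"
      using diagonal_selection[of P] by blast
    define us where "us n x = truncate (\<kappa> n) (u x)" for n x
    have us: "L2_converges \<Omega> us u" unfolding us_def by (rule L2_converges_truncate[OF u \<kappa>(1)])
    have "limsup (\<lambda>n. Q \<Omega> (potential \<Omega> (W n)) (us n))
        \<le> limsup (\<lambda>n. Q \<Omega> (potential \<Omega> V) u + ennreal (1 / Suc (\<kappa> n)))"
      using \<kappa>(2) unfolding P_def us_def by (intro Limsup_mono always_eventually allI)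
    also have "\<dots> = Q \<Omega> (potential \<Omega> V) u"
    proof (rule lim_imp_Limsup)
      have "(\<lambda>n. 1 / real (Suc (\<kappa> n))) \<longlonglongrightarrow> 0"
        using filterlim_compose[OF LIMSEQ_inverse_real_of_nat[unfolded inverse_eq_divide] \<kappa>(1)] .
      from tendsto_add[OF tendsto_const[of "Q \<Omega> (potential \<Omega> V) u"] tendsto_ennrealI[OF this]]
      show "(\<lambda>n. Q \<Omega> (potential \<Omega> V) u + ennreal (1 / Suc (\<kappa> n))) \<longlonglongrightarrow> Q \<Omega> (potential \<Omega> V) u"
        by simp
    qed simp
    finally show ?thesis using attain[OF us] us by blast
  qed
qed

lemma converges_on_sets_imp_gamma_converges:
  assumes K: "compactin (weak_L1 \<Omega>) K" and K_pos: "K \<subseteq> L1_pos \<Omega>"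
    and WV: "converges_on_sets \<Omega> K W V"
  shows "gamma_converges \<Omega> (\<lambda>n. potential \<Omega> (W n)) (potential \<Omega> V)"
  unfolding gamma_converges_def
proof (intro conjI allI impI ballI)
  note pos = limit_L1_pos[OF K K_pos WV]
  show "potential \<Omega> (W n) \<in> M_cap \<Omega>" for n
    by (rule potential_measure_in_M_cap[OF potential_density_measurable[OF pos(3)]])
  show "potential \<Omega> V \<in> M_cap \<Omega>"
    by (rule potential_measure_in_M_cap[OF potential_density_measurable[OF pos(4)]])
  show "Q \<Omega> (potential \<Omega> V) u \<le> liminf (\<lambda>n. Q \<Omega> (potential \<Omega> (W n)) (us n))" if "L2_converges \<Omega> us u" for us u
    by (rule Q_le_liminf[OF K K_pos WV that])
  show "\<exists>us. L2_converges \<Omega> us u \<and> (\<lambda>n. Q \<Omega> (potential \<Omega> (W n)) (us n)) \<longlonglongrightarrow> Q \<Omega> (potential \<Omega> V) u"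
    if "u \<in> L2 \<Omega>" for u
    by (rule recovery_sequence_exists[OF K K_pos WV that])
qed

end

section \<open>Existence of minimisers\<close>

theorem theorem3p1:
  fixes \<Omega> :: "'a::euclidean_space set"
    and F :: "('a \<Rightarrow> real) \<Rightarrow> real"
    and \<V> :: "('a \<Rightarrow> real) set"
  assumes "\<Omega> \<in> sets lebesgue"
    and "ae_invariant \<Omega> F"
    and "gamma_lsc \<Omega> F"
    and "\<V> \<subseteq> L1_pos \<Omega>"
    and "\<V> \<noteq> {}"
    and "compactin (weak_L1 \<Omega>) \<V>"
  shows "\<exists>V\<in>\<V>. \<forall>W\<in>\<V>. F V \<le> F W"
proof -
  define A where "A = (\<lambda>V. ereal (F V)) ` \<V>"
  have "A \<noteq> {}" using assms(5) by (simp add: A_def)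
  then obtain a where a: "\<And>n. a n \<in> A" "a \<longlonglongrightarrow> Inf A" using Inf_as_limit by blast
  then have "\<exists>V. V \<in> \<V> \<and> a n = ereal (F V)" for n unfolding A_def by blast
  then obtain x where x: "\<And>n. x n \<in> \<V>" "\<And>n. a n = ereal (F (x n))" by metis
  show ?thesis
  proof (rule converging_subsequence_on_sets[OF assms(1,6,4) x(1)])
    fix V r assume r: "strict_mono r" and conv: "converges_on_sets \<Omega> \<V> (\<lambda>k. x (r k)) V"
    have V: "V \<in> \<V>" using conv by (simp add: converges_on_sets_def)
    have "gamma_converges \<Omega> (\<lambda>k. potential \<Omega> (x (r k))) (potential \<Omega> V)"
      by (rule converges_on_sets_imp_gamma_converges[OF assms(1,6,4) conv])
    moreover have "x (r k) \<in> L1_pos \<Omega>" "V \<in> L1_pos \<Omega>" for k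
      using assms(4) V x(1) by auto
    ultimately have "ereal (F V) \<le> liminf (\<lambda>k. ereal (F (x (r k))))"
      using assms(3)[unfolded gamma_lsc_def, rule_format, of "\<lambda>k. x (r k)" V] by simp
    also have "\<dots> = Inf A"
      using LIMSEQ_subseq_LIMSEQ[OF a(2) r] by (intro lim_imp_Liminf) (simp_all add: comp_def x(2))
    finally have le: "ereal (F V) \<le> Inf A" .
    have "F V \<le> F W" if "W \<in> \<V>" for W
    proof -
      have "Inf A \<le> ereal (F W)" using that by (intro Inf_lower) (simp add: A_def)
      with le have "ereal (F V) \<le> ereal (F W)" by (rule order_trans)
      then show ?thesis by simp
    qed
    then show ?thesis using V by blast
  qed
qed

end
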